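(* Let assumptions $\mathrm{Asm}_1$–$\mathrm{Asm}_4$ (stated in the context) hold for the depth function $D$ and the distribution $P$, with a common exponent $\beta\in(1/2,1]$, and let $m,n\to\infty$ with $\frac{m}{m+n}\to\tau$ for some $0<\tau<1$. Then, under the null hypothesis $P=Q$, $$\sqrt{\frac{12\,m\,n}{m+n}}\left[\begin{pmatrix}\mathcal{LS}(\widehat P_m,\widehat Q_n)\\ \mathcal{LS}(\widehat Q_n,\widehat P_m)\end{pmatrix}-\begin{pmatrix}1/2\\1/2\end{pmatrix}\right]\xrightarrow{\mathcal D}N\left(\begin{pmatrix}0\\0\end{pmatrix},\begin{pmatrix}1&-1\\-1&1\end{pmatrix}\right).$$
   Context: $\Omega$ is a measurable space, $\mathcal P_\Omega$ the collection of probability measures on it, and $D:\Omega\times\mathcal P_\Omega\to\mathbb R_{\ge0}$ a depth function. $X,X_1,\dots,X_m$ are i.i.d. with distribution $P$, independent of $Y,Y_1,\dots,Y_n$ i.i.d. with distribution $Q$, all with values in $\Omega$. $\widehat P_m$ and $\widehat Q_n$ are the empirical measures of $X_1,\dots,X_m$ and $Y_1,\dots,Y_n$. For an index set $I$, $\widehat P_m^{-I}$ is the empirical measure of $\{X_i: i\in\{1,\dots,m\}\setminus I\}$. The $\mathcal{LS}$-statistic is $$\mathcal{LS}(\widehat P_m,\widehat Q_n)=\frac1{mn}\sum_{i=1}^m\sum_{j=1}^n\left(\mathbb 1_{\{D(X_i,\widehat P_m)<D(Y_j,\widehat P_m)\}}+\tfrac12\mathbb 1_{\{D(X_i,\widehat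 P_m)=D(Y_j,\widehat P_m)\}}\right),$$ and $\mathcal{LS}(\widehat Q_n,\widehat P_m)$ is obtained by exchanging the roles of the two samples (depths computed with respect to $\widehat Q_n$). Assumptions, for some $1/2<\beta\le1$: $\mathrm{Asm}_1$: there is $C>0$ with $\mathbb P(D(X,P)\in[y_1,y_2])\le C|y_2-y_1|^\beta$ for all $y_1,y_2\in\mathbb R_{\ge0}$. $\mathrm{Asm}_2$: $\mathbb E\big(\sup_{x\in\Omega}|D(x,\widehat P_m)-D(x,P)|^{2\beta}\big)=O(m^{-\beta})$. $\mathrm{Asm}_3$: there exist a deterministic constant $C_{\det}$ and an index $m_0$ such that for every $m\ge m_0$, $\sup_{x\in\Omega}|D(x,\widehat P_m)-D(x,\widehat P_m^{-\{1\}})|\le C_{\det}/m$ almost surely. $\mathrm{Asm}_4$: with $X$ an independent copy of $X_1,\dots,X_m$, for any constant $C>0$, $\mathbb E\Big(\big[\mathbb P\big(|D(X_1,\widehat P_m^{-\{1\}})-D(X,\widehat P_m^{-\{1\}})|\le \tfrac Cm\,\big|\,X_2,\dots,X_m\big)\big]^2\Big)=O(m^{-2\beta})$. $\xrightarrow{\mathcal D}$ denotes convergence in distribution. *)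

theory Defs
  imports "HOL-Probability.Probability" "HOL-Library.Landau_Symbols"
begin

section \<open>Empirical measures and depth functions\<close>

text \<open>
  Samples are 1-based: the sample of size m drawn from a sequence X is \<open>X 1, ..., X m\<close>,
  and \<open>X 0\<close> is reserved for the generic variable X, a further independent copy.
\<close>

definition empirical :: "'a measure \<Rightarrow> nat set \<Rightarrow> (nat \<Rightarrow> 'a) \<Rightarrow> 'a measure" where
  "empirical M J x = distr (uniform_count_measure J) M x"

text \<open>
  The empirical measure of the sample of size m with the indices in I left out; \<open>I = {}\<close> gives
  the full empirical measure. It is a probability measure as soon as \<open>{1..m} - I\<close> is nonempty.
\<close>

definition emp :: "'a measure \<Rightarrow> nat set \<Rightarrow> nat \<Rightarrow> (nat \<Rightarrow> 'a) \<Rightarrow> 'a measure" where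
  "emp M I m x = empirical M ({1..m} - I) x"

definition depth_function :: "'a measure \<Rightarrow> ('a \<Rightarrow> 'a measure \<Rightarrow> real) \<Rightarrow> bool" where
  "depth_function M D \<longleftrightarrow> (\<forall>x\<in>space M. \<forall>\<mu>\<in>space (prob_algebra M). 0 \<le> D x \<mu>)"

text \<open>The uniform distance may be infinite, hence the extended nonnegative reals.\<close>

definition sup_dist ::
  "'a measure \<Rightarrow> ('a \<Rightarrow> 'a measure \<Rightarrow> real) \<Rightarrow> 'a measure \<Rightarrow> 'a measure \<Rightarrow> ennreal" where
  "sup_dist M D \<mu> \<nu> = (SUP x\<in>space M. ennreal \<bar>D x \<mu> - D x \<nu>\<bar>)"

text \<open>
  The measurability that is implicit in speaking of probabilities and expectations of the
  depth quantities: depths of points and the uniform deviation are measurable functions of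
  the point and of the sample.
\<close>

definition depth_measurable ::
  "'a measure \<Rightarrow> ('a \<Rightarrow> 'a measure \<Rightarrow> real) \<Rightarrow> 'a measure \<Rightarrow> bool" where
  "depth_measurable M D P \<longleftrightarrow>
     (\<lambda>x. D x P) \<in> borel_measurable M \<and>
     (\<forall>m\<ge>1. (\<lambda>(x, s). D x (emp M {} m s)) \<in> borel_measurable (M \<Otimes>\<^sub>M (\<Pi>\<^sub>M i\<in>{1..m}. M))) \<and>
     (\<forall>m\<ge>1. (\<lambda>s. sup_dist M D (emp M {} m s) P) \<in> borel_measurable (\<Pi>\<^sub>M i\<in>{1..m}. M))"

section \<open>The assumptions\<close>

definition asm1 ::
  "'w measure \<Rightarrow> ('a \<Rightarrow> 'a measure \<Rightarrow> real) \<Rightarrow> 'a measure \<Rightarrow> (nat \<Rightarrow> 'w \<Rightarrow> 'a) \<Rightarrow> real \<Rightarrow> bool" where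
  "asm1 S D P X \<beta> \<longleftrightarrow>
     (\<exists>C>0. \<forall>y1\<ge>0. \<forall>y2\<ge>0.
        measure S {\<omega>\<in>space S. D (X 0 \<omega>) P \<in> {y1..y2}} \<le> C * \<bar>y2 - y1\<bar> powr \<beta>)"

text \<open>Real powers of extended nonnegative reals, for positive exponents.\<close>

definition epowr :: "ennreal \<Rightarrow> real \<Rightarrow> ennreal" where
  "epowr x p = (if x = \<infinity> then \<infinity> else ennreal (enn2real x powr p))"

text \<open>
  The O-bound is spelled out with the extended-valued integral, so that it includes
  finiteness of the expectation for all large m.
\<close>

definition asm2 ::
  "'w measure \<Rightarrow> 'a measure \<Rightarrow> ('a \<Rightarrow> 'a measure \<Rightarrow> real) \<Rightarrow> 'a measure \<Rightarrow>
   (nat \<Rightarrow> 'w \<Rightarrow> 'a) \<Rightarrow> real \<Rightarrow> bool" where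
  "asm2 S M D P X \<beta> \<longleftrightarrow>
     (\<exists>K>0. \<forall>\<^sub>F m in sequentially.
        (\<integral>\<^sup>+ \<omega>. epowr (sup_dist M D (emp M {} m (\<lambda>i. X i \<omega>)) P) (2 * \<beta>) \<partial>S)
          \<le> ennreal (K * real m powr (- \<beta>)))"

text \<open>The index \<open>m0\<close> is taken at least 2, since for \<open>m = 1\<close> the reduced sample is empty.\<close>

definition asm3 ::
  "'w measure \<Rightarrow> 'a measure \<Rightarrow> ('a \<Rightarrow> 'a measure \<Rightarrow> real) \<Rightarrow> (nat \<Rightarrow> 'w \<Rightarrow> 'a) \<Rightarrow> bool" where
  "asm3 S M D X \<longleftrightarrow>
     (\<exists>Cdet::real. \<exists>m0\<ge>2. \<forall>m\<ge>m0. AE \<omega> in S.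
        sup_dist M D (emp M {} m (\<lambda>i. X i \<omega>)) (emp M {1} m (\<lambda>i. X i \<omega>))
          \<le> ennreal (Cdet / real m))"

definition sigma_of ::
  "'w measure \<Rightarrow> 'a measure \<Rightarrow> (nat \<Rightarrow> 'w \<Rightarrow> 'a) \<Rightarrow> nat set \<Rightarrow> 'w measure" where
  "sigma_of S M X J = vimage_algebra (space S) (\<lambda>\<omega>. \<lambda>i\<in>J. X i \<omega>) (\<Pi>\<^sub>M i\<in>J. M)"

definition cond_prob_given :: "'w measure \<Rightarrow> 'w measure \<Rightarrow> ('w \<Rightarrow> bool) \<Rightarrow> 'w \<Rightarrow> real" where
  "cond_prob_given S F A = real_cond_exp S F (indicator {\<omega>\<in>space S. A \<omega>})"

definition asm4 ::
  "'w measure \<Rightarrow> 'a measure \<Rightarrow> ('a \<Rightarrow> 'a measure \<Rightarrow> real) \<Rightarrow> (nat \<Rightarrow> 'w \<Rightarrow> 'a) \<Rightarrow> real \<Rightarrow> bool" where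
  "asm4 S M D X \<beta> \<longleftrightarrow>
     (\<forall>C>0.
        (\<lambda>m. \<integral>\<omega>. (cond_prob_given S (sigma_of S M X {2..m})
                    (\<lambda>\<omega>. \<bar>D (X 1 \<omega>) (emp M {1} m (\<lambda>i. X i \<omega>)) -
                          D (X 0 \<omega>) (emp M {1} m (\<lambda>i. X i \<omega>))\<bar> \<le> C / real m) \<omega>)\<^sup>2 \<partial>S)
        \<in> O(\<lambda>m. real m powr (- 2 * \<beta>)))"

section \<open>The LS-statistic\<close>

text \<open>Depths are computed with respect to the empirical measure of the first sample.\<close>

definition LS ::
  "'a measure \<Rightarrow> ('a \<Rightarrow> 'a measure \<Rightarrow> real) \<Rightarrow> nat \<Rightarrow> (nat \<Rightarrow> 'a) \<Rightarrow> nat \<Rightarrow> (nat \<Rightarrow> 'a) \<Rightarrow> real" where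
  "LS M D m x n y =
     1 / (real m * real n) *
       (\<Sum>i=1..m. \<Sum>j=1..n.
          of_bool (D (x i) (emp M {} m x) < D (y j) (emp M {} m x)) +
          1 / 2 * of_bool (D (x i) (emp M {} m x) = D (y j) (emp M {} m x)))"

section \<open>Convergence in distribution and multivariate normal laws\<close>

definition converges_in_distribution ::
  "'w measure \<Rightarrow> (nat \<Rightarrow> 'w \<Rightarrow> 'b::topological_space) \<Rightarrow> 'b measure \<Rightarrow> bool" where
  "converges_in_distribution S Z N \<longleftrightarrow>
     (\<forall>k. Z k \<in> borel_measurable S) \<and>
     (\<forall>f :: 'b \<Rightarrow> real. continuous_on UNIV f \<longrightarrow> bounded (range f) \<longrightarrow>
        (\<lambda>k. \<integral>\<omega>. f (Z k \<omega>) \<partial>S) \<longlonglongrightarrow> (\<integral>z. f z \<partial>N))"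

text \<open>The univariate normal law with mean a and variance v, a point mass if \<open>v = 0\<close>.\<close>

definition normal_law :: "real \<Rightarrow> real \<Rightarrow> real measure" where
  "normal_law a v =
     (if v = 0 then return borel a else density lborel (normal_density a (sqrt v)))"

text \<open>
  N is the possibly degenerate multivariate normal law with mean \<open>\<mu>\<close> and covariance matrix
  \<open>\<Sigma>\<close>: every linear form \<open>t\<close> has the univariate normal law with the corresponding mean
  and variance. By the Cramer-Wold device this determines N.
\<close>

definition multivariate_normal :: "(real ^ 'd) measure \<Rightarrow> real ^ 'd \<Rightarrow> real ^ 'd ^ 'd \<Rightarrow> bool" where
  "multivariate_normal N \<mu> \<Sigma> \<longleftrightarrow>
     prob_space N \<and> sets N = sets borel \<and>
     (\<forall>t. distr N borel (\<lambda>z. t \<bullet> z) = normal_law (t \<bullet> \<mu>) (t \<bullet> (\<Sigma> *v t)))"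

end

theory Submission
  imports Defs
begin

text \<open>
  Let G be the distribution function of the depth of one observation with respect to P, ties counted
  by one half. The statistic \<open>LS - 1/2\<close> equals the difference of the sample means of G over the second
  and the first sample plus the double average of \<open>k(\<mu>; X i, Y j)\<close>, where \<open>\<mu>\<close> is the empirical measure
  of the first sample and \<open>k(\<mu>; x, y) = [D x \<mu> < D y \<mu>] + [D x \<mu> = D y \<mu>]/2 + G x - G y - 1/2\<close>.
  This average is of smaller order than \<open>1 / sqrt m\<close>. First \<open>\<mu>\<close> is replaced by the empirical measure
  without \<open>X i\<close>; by Asm3 the order of \<open>X i\<close> and \<open>Y j\<close> can only change if their depths are within
  \<open>2c/m\<close>, an event of probability \<open>O(1 / m powr \<beta>)\<close> by Asm4. Then the second moment is expanded. Since k is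
  antisymmetric in x and y, exchanging \<open>X i\<close> and \<open>Y j\<close> shows that for distinct \<open>i, i'\<close> and distinct
  \<open>j, j'\<close> the two factors may be replaced by their changes under removal of \<open>X i'\<close> and \<open>X i\<close>,
  respectively; the product of these changes is bounded by the indicator that both pairs are close,
  which is the squared conditional probability of Asm4 in mean, hence \<open>o(1/m)\<close>. The terms sharing one
  index are a fraction of order \<open>1/m\<close> and tend to zero because \<open>k(P; .)\<close> is degenerate, by Asm1 and
  Asm2. With the roles of the samples exchanged the linear part only changes its sign, and by the
  absence of ties G has mean 1/2 and variance 1/12, so the central limit theorem applies.
\<close>

section \<open>Empirical measures\<close>

text \<open>The obstacle is that depths are compared under a measure built from the very points
  \<open>X i\<close>, while nothing is known about how \<open>D x \<mu>\<close> varies with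
  \<open>x\<close>; a classical projection argument does not apply directly. Deleting
  \<open>X i\<close> makes \<open>X i\<close> and \<open>Y j\<close> exchangeable relative to the
  reference measure, but in a product of two such kernels the first measure still contains
  \<open>X i'\<close> and the second one \<open>X i\<close>. Deleting the other point as well and
  expanding \<open>(a - a') (b - b')\<close> isolates the part that exchanging cannot remove. On the
  scale \<open>sqrt m\<close> the second moment has to be \<open>o(1/m)\<close> and the mean cost of
  the first deletion \<open>o(1 / sqrt m)\<close>; the bound \<open>m powr (- 2 * \<beta>)\<close>
  of Asm4 and its square root give both because \<open>1 / 2 < \<beta>\<close>. Since P = Q, the
  same G serves both orders of the samples, so the limit is the law of \<open>(U, - U)\<close> with
  U standard normal and a one-dimensional central limit theorem suffices.\<close>

lemma empirical_cong:
  assumes "\<And>i. i \<in> J \<Longrightarrow> x i = y i"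
  shows "empirical M J x = empirical M J y"
  unfolding empirical_def using assms
  by (intro distr_cong) (auto simp: space_uniform_count_measure)

text \<open>Unfolding \<open>distr\<close> reduces the claim to counting preimages, so samples can
  be renumbered without carrying measurability of \<open>x\<close> along.\<close>

lemma empirical_reindex:
  assumes "bij_betw g A B" "finite A"
  shows "empirical M B x = empirical M A (\<lambda>i. x (g i))"
proof -
  have B: "finite B" "card B = card A"
    using assms bij_betw_finite bij_betw_same_card by fastforce+
  have "emeasure (uniform_count_measure B) (x -` C \<inter> B) =
        emeasure (uniform_count_measure A) ((\<lambda>i. x (g i)) -` C \<inter> A)" for C
  proof -
    have "bij_betw g ((\<lambda>i. x (g i)) -` C \<inter> A) (x -` C \<inter> B)"
      using assms(1) unfolding bij_betw_def inj_on_def by auto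
    then have "card ((\<lambda>i. x (g i)) -` C \<inter> A) = card (x -` C \<inter> B)"
      by (rule bij_betw_same_card)
    then show ?thesis
      using assms(2) B by (simp add: emeasure_uniform_count_measure)
  qed
  then show ?thesis
    unfolding empirical_def distr_def by (simp add: space_uniform_count_measure)
qed

lemma emp_empty: "emp M {} m x = empirical M {1..m} x"
  by (simp add: emp_def)

text \<open>\<open>depth_measurable\<close> speaks only of samples indexed by \<open>{1..m}\<close>.
  Renumbering makes it available for reduced samples, whose index sets have gaps.\<close>

lemma measurable_depth_empirical:
  assumes D: "depth_measurable M D P" and J: "finite J" "J \<noteq> {}"
    and g: "g \<in> measurable N M" and h: "\<And>i. i \<in> J \<Longrightarrow> h i \<in> measurable N M"
  shows "(\<lambda>\<omega>. D (g \<omega>) (empirical M J (\<lambda>i. h i \<omega>))) \<in> borel_measurable N"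
proof -
  obtain b where b: "bij_betw b {1..card J} J"
    using J ex_bij_betw_nat_finite_1 by blast
  have k: "card J \<ge> 1" using J by (simp add: Suc_le_eq card_gt_0_iff)
  have bJ: "b i \<in> J" if "i \<in> {1..card J}" for i using b that by (rule bij_betw_apply)
  have "(\<lambda>\<omega>. (g \<omega>, \<lambda>i\<in>{1..card J}. h (b i) \<omega>)) \<in> N \<rightarrow>\<^sub>M M \<Otimes>\<^sub>M (\<Pi>\<^sub>M i\<in>{1..card J}. M)"
    using g h bJ by (intro measurable_Pair measurable_restrict) auto
  moreover have "(\<lambda>(x, s). D x (emp M {} (card J) s)) \<in> borel_measurable (M \<Otimes>\<^sub>M (\<Pi>\<^sub>M i\<in>{1..card J}. M))"
    using D k by (simp add: depth_measurable_def)
  ultimately have "(\<lambda>\<omega>. D (g \<omega>) (emp M {} (card J) (\<lambda>i\<in>{1..card J}. h (b i) \<omega>))) \<in> borel_measurable N"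
    by (rule measurable_compose[THEN measurable_cong[THEN iffD1, rotated]]) auto
  moreover have "emp M {} (card J) (\<lambda>i\<in>{1..card J}. h (b i) \<omega>) = empirical M J (\<lambda>i. h i \<omega>)" for \<omega>
    unfolding emp_empty by (subst empirical_reindex[OF b]) (auto intro: empirical_cong)
  ultimately show ?thesis by simp
qed

section \<open>Independent families\<close>

locale iid_family = prob_space S for S :: "'w measure" +
  fixes M P :: "'a measure" and V :: "'i \<Rightarrow> 'w \<Rightarrow> 'a"
  assumes P: "P \<in> space (prob_algebra M)"
    and indep: "indep_vars (\<lambda>_. M) V UNIV"
    and distr_V: "distr S M (V i) = P"
begin

sublocale P: prob_space P
  using P by (simp add: space_prob_algebra)

lemma sets_P [simp, measurable_cong]: "sets P = sets M"
  using P by (simp add: space_prob_algebra)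

lemma space_P [simp]: "space P = space M"
  by (rule sets_eq_imp_space_eq) simp

lemma prob_P_space [simp]: "P.prob (space M) = 1"
  using P.prob_space by simp

lemma V_measurable [measurable]: "V i \<in> S \<rightarrow>\<^sub>M M"
  using indep by (auto simp: indep_vars_def)

lemma V_space: "\<omega> \<in> space S \<Longrightarrow> V i \<omega> \<in> space M"
  using V_measurable by (rule measurable_space)

text \<open>Every exchangeability argument rests on this: by \<open>distr_process\<close>, all
  injective renumberings of the family have the same joint law. The blocks are the singletons
  \<open>{f j}\<close>, disjoint by injectivity.\<close>

lemma reindex:
  assumes "inj f"
  shows "iid_family S M P (\<lambda>j. V (f j))"
proof
  show "P \<in> space (prob_algebra M)" by (rule P)
  show "distr S M (V (f i)) = P" for i by (rule distr_V)
  have "indep_vars (\<lambda>j. PiM {f j} (\<lambda>_. M)) (\<lambda>j \<omega>. restrict (\<lambda>i. V i \<omega>) {f j}) UNIV"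
    using assms by (intro indep_vars_restrict[OF indep]) (auto simp: disjoint_family_on_def inj_def)
  from indep_vars_compose2[OF this, where Y="\<lambda>j s. s (f j)" and N="\<lambda>_. M"]
  show "indep_vars (\<lambda>_. M) (\<lambda>j. V (f j)) UNIV" by simp
qed

lemma process_measurable [measurable]: "(\<lambda>\<omega> i. V i \<omega>) \<in> S \<rightarrow>\<^sub>M PiM UNIV (\<lambda>_. M)"
  by (rule measurable_PiM_single') (auto simp: V_space)

lemma distr_process: "distr S (PiM UNIV (\<lambda>_. M)) (\<lambda>\<omega> i. V i \<omega>) = PiM UNIV (\<lambda>_. P)"
proof -
  have "distr S (PiM UNIV (\<lambda>_. M)) (\<lambda>\<omega>. \<lambda>i\<in>UNIV. V i \<omega>) = PiM UNIV (\<lambda>i. distr S M (V i))"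
    using indep by (intro indep_vars_iff_distr_eq_PiM'[THEN iffD1]) auto
  then show ?thesis by (simp add: distr_V restrict_UNIV)
qed

lemma expectation_process:
  fixes \<phi> :: "('i \<Rightarrow> 'a) \<Rightarrow> real"
  assumes "\<phi> \<in> borel_measurable (PiM UNIV (\<lambda>_. M))"
  shows "(\<integral>\<omega>. \<phi> (\<lambda>i. V i \<omega>) \<partial>S) = (\<integral>s. \<phi> s \<partial>PiM UNIV (\<lambda>_. P))"
  unfolding distr_process[symmetric] using assms by (simp add: integral_distr)

lemma AE_process:
  assumes "Measurable.pred (PiM UNIV (\<lambda>_. M)) Q"
  shows "(AE \<omega> in S. Q (\<lambda>i. V i \<omega>)) \<longleftrightarrow> (AE s in PiM UNIV (\<lambda>_. P). Q s)"
  unfolding distr_process[symmetric] using assms by (subst AE_distr_iff) (auto simp: pred_def)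

lemma prob_process:
  assumes "Measurable.pred (PiM UNIV (\<lambda>_. M)) Q"
  shows "\<P>(\<omega> in S. Q (\<lambda>i. V i \<omega>)) = \<P>(s in PiM UNIV (\<lambda>_. P). Q s)"
  unfolding distr_process[symmetric] using assms
  by (subst measure_distr) (auto simp: pred_def vimage_def V_space space_PiM intro!: arg_cong[where f=prob])

text \<open>Renumbering by \<open>\<sigma>\<close> keeps the law and reverses the sign of
  \<open>\<phi>\<close>, so the expectation is its own negative.\<close>

lemma expectation_antisym:
  fixes \<phi> :: "('i \<Rightarrow> 'a) \<Rightarrow> real"
  assumes [measurable]: "\<phi> \<in> borel_measurable (PiM UNIV (\<lambda>_. M))" and "inj \<sigma>"
    and "\<And>s. \<phi> (\<lambda>i. s (\<sigma> i)) = - \<phi> s"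
  shows "(\<integral>\<omega>. \<phi> (\<lambda>i. V i \<omega>) \<partial>S) = 0"
proof -
  interpret W: iid_family S M P "\<lambda>i. V (\<sigma> i)" by (rule reindex) fact
  have "(\<integral>\<omega>. \<phi> (\<lambda>i. V i \<omega>) \<partial>S) = (\<integral>\<omega>. \<phi> (\<lambda>i. V (\<sigma> i) \<omega>) \<partial>S)"
    using W.expectation_process expectation_process assms by simp
  also have "\<dots> = (\<integral>\<omega>. - \<phi> (\<lambda>i. V i \<omega>) \<partial>S)"
    using assms(3)[of "\<lambda>i. V i \<omega>" for \<omega>] by simp
  finally show ?thesis by simp
qed

end

text \<open>Fubini for the product of the two laws. The inner integral runs over a second variable
  \<open>\<omega>'\<close> on the same space, so independent copies never require an enlarged
  one.\<close>

lemma (in prob_space) indep_var_decouple: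
  fixes g :: "_ \<Rightarrow> real"
  assumes ind: "indep_var N1 U N2 W" and g[measurable]: "g \<in> borel_measurable (N1 \<Otimes>\<^sub>M N2)"
    and bound: "\<And>z. \<bar>g z\<bar> \<le> B"
  shows "(\<integral>\<omega>. g (U \<omega>, W \<omega>) \<partial>M) = (\<integral>\<omega>. (\<integral>\<omega>'. g (U \<omega>', W \<omega>) \<partial>M) \<partial>M)"
proof -
  have U[measurable]: "U \<in> measurable M N1" and W[measurable]: "W \<in> measurable M N2"
    using ind by (auto dest: indep_var_rv1 indep_var_rv2)
  interpret D1: prob_space "distr M N1 U" by (rule prob_space_distr) fact
  interpret D2: prob_space "distr M N2 W" by (rule prob_space_distr) fact
  interpret D12: pair_prob_space "distr M N1 U" "distr M N2 W" ..
  have eq: "distr M N1 U \<Otimes>\<^sub>M distr M N2 W = distr M (N1 \<Otimes>\<^sub>M N2) (\<lambda>\<omega>. (U \<omega>, W \<omega>))"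
    using ind by (simp add: indep_var_distribution_eq)
  have "(\<integral>\<omega>. g (U \<omega>, W \<omega>) \<partial>M) = (\<integral>z. g z \<partial>(distr M N1 U \<Otimes>\<^sub>M distr M N2 W))"
    unfolding eq by (simp add: integral_distr)
  also have "\<dots> = (\<integral>w. (\<integral>u. g (u, w) \<partial>distr M N1 U) \<partial>distr M N2 W)"
    using bound by (subst D12.integral_snd) (auto intro!: D12.P.integrable_const_bound[where B=B])
  also have "\<dots> = (\<integral>w. (\<integral>\<omega>'. g (U \<omega>', w) \<partial>M) \<partial>distr M N2 W)"
    by (intro Bochner_Integration.integral_cong refl integral_distr) auto
  also have "\<dots> = (\<integral>\<omega>. (\<integral>\<omega>'. g (U \<omega>', W \<omega>) \<partial>M) \<partial>M)"
    by (rule integral_distr) auto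
  finally show ?thesis .
qed

section \<open>Independence of disjoint blocks\<close>

context iid_family
begin

lemma indep_blocks:
  assumes "A \<inter> K = {}"
  shows "indep_var (PiM A (\<lambda>_. M)) (\<lambda>\<omega>. restrict (\<lambda>i. V i \<omega>) A) (PiM K (\<lambda>_. M)) (\<lambda>\<omega>. restrict (\<lambda>i. V i \<omega>) K)"
proof -
  have "indep_vars (\<lambda>b. PiM (case_bool A K b) (\<lambda>_. M)) (\<lambda>b \<omega>. restrict (\<lambda>i. V i \<omega>) (case_bool A K b)) UNIV"
    using assms by (intro indep_vars_restrict[OF indep])
      (auto simp: disjoint_family_on_def split: bool.splits)
  then show ?thesis
    unfolding indep_var_def
    by (rule indep_vars_cong[THEN iffD1, rotated -1]) (auto split: bool.splits)
qed

lemma expectation_V: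
  fixes \<phi> :: "'a \<Rightarrow> real"
  assumes [measurable]: "\<phi> \<in> borel_measurable M"
  shows "(\<integral>\<omega>. \<phi> (V i \<omega>) \<partial>S) = (\<integral>x. \<phi> x \<partial>P)"
  unfolding distr_V[symmetric, of i] by (simp add: integral_distr)

end

section \<open>The degenerate comparison kernel\<close>

definition cmp :: "real \<Rightarrow> real \<Rightarrow> real" where
  "cmp a b = of_bool (a < b) + 1 / 2 * of_bool (a = b)"

lemma cmp_bounds: "0 \<le> cmp a b" "cmp a b \<le> 1"
  by (auto simp: cmp_def)

lemma abs_cmp: "\<bar>cmp a b\<bar> \<le> 1"
  by (auto simp: cmp_def)

lemma cmp_flip: "cmp b a = 1 - cmp a b"
  by (auto simp: cmp_def)

text \<open>If \<open>a'\<close> and \<open>b'\<close> are more than \<open>2 * e\<close> apart,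
  moving each by at most \<open>e\<close> preserves their strict order and the comparisons agree;
  otherwise two values in the unit interval differ by at most 1.\<close>

lemma cmp_diff_le:
  assumes "\<bar>a - a'\<bar> \<le> e" "\<bar>b - b'\<bar> \<le> e"
  shows "\<bar>cmp a b - cmp a' b'\<bar> \<le> of_bool (\<bar>a' - b'\<bar> \<le> 2 * e)"
  using assms by (auto simp: cmp_def)

lemma cmp_measurable [measurable (raw)]:
  assumes [measurable]: "f \<in> borel_measurable N" "g \<in> borel_measurable N"
  shows "(\<lambda>x. cmp (f x) (g x)) \<in> borel_measurable N"
  unfolding cmp_def by measurable

text \<open>Counting ties by one half makes this the projection of the comparison for every P.\<close>

definition mid_cdf :: "('a \<Rightarrow> 'a measure \<Rightarrow> real) \<Rightarrow> 'a measure \<Rightarrow> 'a \<Rightarrow> real" where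
  "mid_cdf D P y = (\<integral>x. cmp (D x P) (D y P) \<partial>P)"

text \<open>
  The centred comparison of two points at \<open>\<mu>\<close> without its projections at P: it is antisymmetric in the
  two points for every \<open>\<mu>\<close>, and completely degenerate for \<open>\<mu> = P\<close>.
\<close>

definition kern :: "('a \<Rightarrow> 'a measure \<Rightarrow> real) \<Rightarrow> 'a measure \<Rightarrow> 'a measure \<Rightarrow> 'a \<Rightarrow> 'a \<Rightarrow> real" where
  "kern D P \<mu> x y = cmp (D x \<mu>) (D y \<mu>) + mid_cdf D P x - mid_cdf D P y - 1 / 2"

lemma kern_flip: "kern D P \<mu> y x = - kern D P \<mu> x y"
  unfolding kern_def by (subst cmp_flip) simp

lemma kern_diff_le:
  assumes "\<bar>D x \<mu> - D x \<nu>\<bar> \<le> e" "\<bar>D y \<mu> - D y \<nu>\<bar> \<le> e"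
  shows "\<bar>kern D P \<mu> x y - kern D P \<nu> x y\<bar> \<le> of_bool (\<bar>D x \<nu> - D y \<nu>\<bar> \<le> 2 * e)"
  using cmp_diff_le[OF assms] by (simp add: kern_def)

text \<open>The index type stays open: \<open>nat\<close> for the sequence in the assumptions,
  \<open>nat + nat\<close> for two samples at once.\<close>

locale depth_family = iid_family S M P V
  for S :: "'w measure" and M P :: "'a measure" and V :: "'i \<Rightarrow> 'w \<Rightarrow> 'a" +
  fixes D :: "'a \<Rightarrow> 'a measure \<Rightarrow> real"
  assumes D: "depth_measurable M D P"
begin

lemma depth_P_measurable [measurable]: "(\<lambda>x. D x P) \<in> borel_measurable M"
  using D by (simp add: depth_measurable_def)

lemmas depth_empirical_measurable = measurable_depth_empirical[OF D]

lemma mid_cdf_measurable [measurable]: "mid_cdf D P \<in> borel_measurable M"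
  unfolding mid_cdf_def[abs_def] by (rule P.borel_measurable_lebesgue_integral) measurable

lemma integrable_cmp:
  assumes [measurable]: "f \<in> borel_measurable M" "g \<in> borel_measurable M"
  shows "integrable P (\<lambda>x. cmp (f x) (g x))"
  by (intro P.integrable_const_bound[where B=1]) (auto simp: abs_cmp)

lemma mid_cdf_bounds: "0 \<le> mid_cdf D P y" "mid_cdf D P y \<le> 1"
proof -
  show "0 \<le> mid_cdf D P y" unfolding mid_cdf_def by (intro integral_nonneg_AE) (auto simp: cmp_bounds)
  have "mid_cdf D P y \<le> (\<integral>x. 1 \<partial>P)"
    unfolding mid_cdf_def by (intro integral_mono integrable_cmp) (auto simp: cmp_bounds)
  then show "mid_cdf D P y \<le> 1" by (simp add: P.prob_space)
qed

lemma integrable_mid_cdf: "integrable P (mid_cdf D P)"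
  using mid_cdf_bounds by (intro P.integrable_const_bound[where B=1]) (auto simp: abs_le_iff intro: order_trans[of _ 0])

lemma mid_cdf_flip: "(\<integral>x. cmp (D y P) (D x P) \<partial>P) = 1 - mid_cdf D P y"
proof -
  have "(\<integral>x. cmp (D y P) (D x P) \<partial>P) = (\<integral>x. 1 - cmp (D x P) (D y P) \<partial>P)"
    by (subst cmp_flip) simp
  then show ?thesis
    unfolding mid_cdf_def by (simp add: integrable_cmp P.prob_space)
qed

text \<open>Integrating the comparison of two independent points in either order gives the mean of
  \<open>mid_cdf\<close> and its complement to 1.\<close>

lemma integral_mid_cdf: "(\<integral>y. mid_cdf D P y \<partial>P) = 1 / 2"
proof -
  interpret PP: pair_prob_space P P ..
  let ?c = "\<lambda>(x, y). cmp (D x P) (D y P)"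
  have i: "integrable (P \<Otimes>\<^sub>M P) ?c"
    by (intro PP.P.integrable_const_bound[where B=1]) (auto simp: abs_cmp)
  have "(\<integral>y. mid_cdf D P y \<partial>P) = (\<integral>z. ?c z \<partial>(P \<Otimes>\<^sub>M P))"
    unfolding mid_cdf_def using PP.integral_snd[OF i] by simp
  also have "\<dots> = (\<integral>x. 1 - mid_cdf D P x \<partial>P)"
    using PP.integral_fst[OF i] by (simp add: mid_cdf_flip)
  also have "\<dots> = 1 - (\<integral>y. mid_cdf D P y \<partial>P)"
    by (simp add: integrable_mid_cdf)
  finally show ?thesis by simp
qed

text \<open>The comparison minus 1/2 is at most 1/2 in absolute value, the difference of the two
  projections at most 1.\<close>

lemma kern_bound: "\<bar>kern D P \<mu> x y\<bar> \<le> 3 / 2"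
  using cmp_bounds[of "D x \<mu>" "D y \<mu>"] mid_cdf_bounds[of x] mid_cdf_bounds[of y]
  unfolding kern_def by linarith

lemma integral_kern_P: "(\<integral>y. kern D P P x y \<partial>P) = 0"
proof -
  have "integrable P (\<lambda>y. cmp (D x P) (D y P))"
    by (rule integrable_cmp) measurable
  then show ?thesis
    unfolding kern_def by (simp add: integrable_mid_cdf mid_cdf_flip integral_mid_cdf)
qed

lemma kern_P_measurable [measurable]: "(\<lambda>(x, y). kern D P P x y) \<in> borel_measurable (M \<Otimes>\<^sub>M M)"
  unfolding kern_def by measurable

lemma kern_empirical_measurable:
  assumes "finite J" "J \<noteq> {}" and [measurable]: "g \<in> N \<rightarrow>\<^sub>M M" "h \<in> N \<rightarrow>\<^sub>M M"
    and "\<And>i. i \<in> J \<Longrightarrow> z i \<in> N \<rightarrow>\<^sub>M M"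
  shows "(\<lambda>\<omega>. kern D P (empirical M J (\<lambda>i. z i \<omega>)) (g \<omega>) (h \<omega>)) \<in> borel_measurable N"
proof -
  have [measurable]: "(\<lambda>\<omega>. D (g \<omega>) (empirical M J (\<lambda>i. z i \<omega>))) \<in> borel_measurable N"
    "(\<lambda>\<omega>. D (h \<omega>) (empirical M J (\<lambda>i. z i \<omega>))) \<in> borel_measurable N"
    using assms by (auto intro!: depth_empirical_measurable)
  show ?thesis unfolding kern_def by measurable
qed

text \<open>With the points numbered \<open>a\<close> and \<open>b\<close> frozen, only the second
  factor depends on \<open>c\<close>, and its mean vanishes by
  \<open>integral_kern_P\<close>.\<close>

lemma kern_P_orthogonal:
  assumes "a \<noteq> b" "a \<noteq> c" "b \<noteq> c"
  shows "(\<integral>\<omega>. kern D P P (V a \<omega>) (V b \<omega>) * kern D P P (V a \<omega>) (V c \<omega>) \<partial>S) = 0"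
proof -
  let ?g = "\<lambda>(u, w). kern D P P (w a) (w b) * kern D P P (w a) (u c)"
  have ind: "indep_var (PiM {c} (\<lambda>_. M)) (\<lambda>\<omega>. restrict (\<lambda>i. V i \<omega>) {c})
      (PiM {a, b} (\<lambda>_. M)) (\<lambda>\<omega>. restrict (\<lambda>i. V i \<omega>) {a, b})"
    using assms by (intro indep_blocks) auto
  have meas: "?g \<in> borel_measurable (PiM {c} (\<lambda>_. M) \<Otimes>\<^sub>M PiM {a, b} (\<lambda>_. M))"
    by measurable
  have bound: "\<bar>?g z\<bar> \<le> 3 / 2 * (3 / 2)" for z
    using kern_bound unfolding split_beta abs_mult by (intro mult_mono) auto
  have "(\<integral>\<omega>. kern D P P (V a \<omega>) (V b \<omega>) * kern D P P (V a \<omega>) (V c \<omega>) \<partial>S) =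
    (\<integral>\<omega>. (\<integral>\<omega>'. kern D P P (V a \<omega>) (V b \<omega>) * kern D P P (V a \<omega>) (V c \<omega>') \<partial>S) \<partial>S)"
    using indep_var_decouple[OF ind meas bound] by simp
  also have "(\<integral>\<omega>'. kern D P P (V a \<omega>) (V c \<omega>') \<partial>S) = 0" if "\<omega> \<in> space S" for \<omega>
    using V_space[OF that] by (subst expectation_V) (auto simp: integral_kern_P)
  then have "(\<integral>\<omega>. (\<integral>\<omega>'. kern D P P (V a \<omega>) (V b \<omega>) * kern D P P (V a \<omega>) (V c \<omega>') \<partial>S) \<partial>S) = 0"
    by (subst Bochner_Integration.integral_cong[OF refl, where g="\<lambda>_. 0"]) auto
  finally show ?thesis .
qed

end

section \<open>Leave-one-out stability\<close>

text \<open>\<open>reindex\<close> wants an injection of all of \<open>nat\<close>, while only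
  finitely many positions are prescribed; the others are sent injectively into the infinite
  complement of the image.\<close>

lemma inj_extend:
  fixes f :: "nat \<Rightarrow> 'b"
  assumes "infinite (UNIV :: 'b set)" "finite A" "inj_on f A"
  obtains f' where "inj f'" "\<And>x. x \<in> A \<Longrightarrow> f' x = f x"
proof -
  have "infinite (- f ` A)"
    using assms by (metis Compl_eq_Diff_UNIV Diff_infinite_finite finite_imageI)
  then obtain h :: "nat \<Rightarrow> 'b" where h: "inj h" "range h \<subseteq> - f ` A"
    by (meson infinite_countable_subset)
  define f' where "f' x = (if x \<in> A then f x else h x)" for x
  have "inj f'"
  proof (rule injI)
    fix x y assume e: "f' x = f' y"
    have "h z \<notin> f ` A" for z using h(2) by blast
    then have "f z \<noteq> h z'" "h z' \<noteq> f z" if "z \<in> A" for z z' using that by (metis image_eqI)+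
    then show "x = y"
      using e assms(3) h(1) unfolding f'_def by (cases "x \<in> A"; cases "y \<in> A") (simp_all add: inj_on_eq_iff inj_eq)
  qed
  then show thesis by (rule that) (simp add: f'_def)
qed

text \<open>Asm3 and Asm4 remove the point with index 1, so the point to be removed has to be
  numbered 1; a transposition moves it there.\<close>

lemma ex_bij_betw_nat_finite_1_fixing:
  assumes "finite J" "k \<in> J"
  obtains g where "bij_betw g {1..card J} J" "g 1 = k"
proof -
  obtain b where b: "bij_betw b {1..card J} J"
    using assms ex_bij_betw_nat_finite_1 by blast
  then have "k \<in> b ` {1..card J}" using assms(2) by (simp add: bij_betw_imp_surj_on)
  then obtain l where l: "l \<in> {1..card J}" "b l = k" by blast
  have one: "(1::nat) \<in> {1..card J}" using l by simp
  have "bij_betw (Transposition.transpose 1 l) {1..card J} {1..card J}"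
    using l(1) one by (auto simp: bij_betw_def transpose_image_eq)
  then have "bij_betw (b \<circ> Transposition.transpose 1 l) {1..card J} J" using b by (rule bij_betw_trans)
  then show thesis using l by (intro that[of "b \<circ> Transposition.transpose 1 l"]) simp_all
qed

text \<open>Renumbers part of two samples as a single sequence of the kind in the assumptions: index
  0 is a generic point, index 1 the point to be removed, indices up to \<open>card J\<close> the
  rest of the sample, and the next two a further pair outside it.\<close>

lemma sample_injection:
  fixes a b d :: "nat + nat" and M :: "'m measure"
  assumes J: "finite J" "k \<in> J" and dist: "{a, b, d} \<inter> Inl ` J = {}" "a \<noteq> b" "a \<noteq> d" "b \<noteq> d"
  shows "\<exists>f. inj f \<and> f 0 = a \<and> f 1 = Inl k \<and> f (card J + 1) = b \<and> f (card J + 2) = d \<and>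
    (\<forall>x. emp M {} (card J) (\<lambda>l. x (f l)) = empirical M J (\<lambda>i. x (Inl i))) \<and>
    (\<forall>x. emp M {1} (card J) (\<lambda>l. x (f l)) = empirical M (J - {k}) (\<lambda>i. x (Inl i)))"
proof -
  define p where "p = card J"
  have p: "p \<ge> 1" using J by (auto simp: p_def Suc_le_eq card_gt_0_iff)
  obtain g where g: "bij_betw g {1..p} J" "g 1 = k"
    using ex_bij_betw_nat_finite_1_fixing[OF J] unfolding p_def .
  define f0 where "f0 l = (if l = 0 then a else if l \<le> p then Inl (g l) else if l = p + 1 then b else d)" for l
  have gJ: "g l \<in> J" if "1 \<le> l" "l \<le> p" for l
    using bij_betw_apply[OF g(1), of l] that by simp
  have "inj_on f0 {0..p + 2}"
  proof (rule linorder_inj_onI)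
    fix x y assume xy: "x < y" "x \<in> {0..p + 2}" "y \<in> {0..p + 2}"
    have out: "a \<noteq> Inl (g l)" "b \<noteq> Inl (g l)" "d \<noteq> Inl (g l)" if "1 \<le> l" "l \<le> p" for l
      using dist(1) gJ[OF that] by auto
    have gi: "g x \<noteq> g y" if "1 \<le> x" "y \<le> p"
      using inj_onD[OF bij_betw_imp_inj_on[OF g(1)], of x y] that xy(1) by force
    consider "y \<le> p" | "y = p + 1" | "y = p + 2" using xy by force
    then show "f0 x \<noteq> f0 y"
    proof cases
      case 1
      then show ?thesis using xy(1) out(1)[of y] gi by (cases "x = 0") (auto simp: f0_def)
    next
      case 2
      then show ?thesis using xy(1) out(2)[of x] dist(2) by (cases "x = 0") (auto simp: f0_def)
    next
      case 3
      then show ?thesis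
        using xy(1) out(3)[of x] dist(3,4) by (cases "x = 0"; cases "x \<le> p") (auto simp: f0_def)
    qed
  qed auto
  then obtain f :: "nat \<Rightarrow> nat + nat" where f: "inj f" "\<And>x. x \<in> {0..p + 2} \<Longrightarrow> f x = f0 x"
    using inj_extend[of "{0..p + 2}" f0] by auto
  have fg: "f l = Inl (g l)" if "l \<in> {1..p}" for l using f(2)[of l] that by (auto simp: f0_def)
  have 1: "emp M {} (card J) (\<lambda>l. x (f l)) = empirical M J (\<lambda>i. x (Inl i))" for x
    unfolding emp_empty p_def[symmetric] empirical_reindex[OF g(1) finite_atLeastAtMost]
    by (rule empirical_cong) (simp add: fg)
  have g': "bij_betw g ({1..p} - {1}) (J - {k})"
    using g p J(2) by (intro bij_betw_DiffI) auto
  have 2: "emp M {1} (card J) (\<lambda>l. x (f l)) = empirical M (J - {k}) (\<lambda>i. x (Inl i))" for x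
    unfolding emp_def p_def[symmetric] by (subst empirical_reindex[OF g']) (auto intro!: empirical_cong simp: fg)
  have "f 0 = a" "f (card J + 1) = b" "f (card J + 2) = d"
    using f(2)[of 0] f(2)[of "p + 1"] f(2)[of "p + 2"] by (simp_all add: f0_def p_def)
  moreover have "f 1 = Inl k" using p g(2) fg[of 1] by simp
  ultimately show ?thesis using f(1) 1 2 by blast
qed

text \<open>
  Removing \<open>s 1\<close> from the sample moves each depth by at most \<open>c / m\<close>, so it can change the order of
  two points only if their depths differ by at most twice that.
\<close>

definition loo_near :: "'a measure \<Rightarrow> ('a \<Rightarrow> 'a measure \<Rightarrow> real) \<Rightarrow> real \<Rightarrow> nat \<Rightarrow> (nat \<Rightarrow> 'a) \<Rightarrow> 'a \<Rightarrow> 'a \<Rightarrow> bool" where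
  "loo_near M D c m s x y \<longleftrightarrow> \<bar>D x (emp M {1} m s) - D y (emp M {1} m s)\<bar> \<le> 2 * (c / real m)"

context depth_family
begin

lemma depth_emp_seq_measurable:
  assumes "{1..m} - I \<noteq> {}"
  shows "(\<lambda>s. D (s l) (emp M I m s)) \<in> borel_measurable (PiM (UNIV :: nat set) (\<lambda>_. M))"
  unfolding emp_def using assms by (intro depth_empirical_measurable) auto

lemma stable_measurable:
  assumes "m \<ge> 2"
  shows "Measurable.pred (PiM (UNIV :: nat set) (\<lambda>_. M))
    (\<lambda>s. \<bar>D (s l) (emp M {} m s) - D (s l) (emp M {1} m s)\<bar> \<le> r)"
proof -
  have "2 \<in> {1..m} - {1}" using assms by simp
  then have "{1..m} - {1} \<noteq> {}" "{1..m} - {} \<noteq> {}" by blast+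
  note [measurable] = this[THEN depth_emp_seq_measurable]
  show ?thesis by measurable
qed

lemma loo_near_measurable:
  assumes "m \<ge> 2"
  shows "Measurable.pred (PiM (UNIV :: nat set) (\<lambda>_. M)) (\<lambda>s. loo_near M D c m s (s l) (s l'))"
proof -
  have "2 \<in> {1..m} - {1}" using assms by simp
  then have "{1..m} - {1} \<noteq> {}" by blast
  note [measurable] = depth_emp_seq_measurable[OF this]
  show ?thesis unfolding loo_near_def by measurable
qed

end

text \<open>Stability is stated on the product space, so the same assumption serves both orders of
  the samples. The point of evaluation has either index 0, outside the sample, or index 1, the
  removed point itself.\<close>

locale two_sample = depth_family S M P V D
  for S :: "'w measure" and M P :: "'a measure" and V :: "nat + nat \<Rightarrow> 'w \<Rightarrow> 'a" and D +
  fixes c :: real and m0 :: nat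
  assumes m0: "2 \<le> m0"
    and stable0: "\<And>m. m0 \<le> m \<Longrightarrow> AE s in PiM UNIV (\<lambda>_. P).
      \<bar>D (s 0) (emp M {} m s) - D (s 0) (emp M {1} m s)\<bar> \<le> c / real m"
    and stable1: "\<And>m. m0 \<le> m \<Longrightarrow> AE s in PiM UNIV (\<lambda>_. P).
      \<bar>D (s 1) (emp M {} m s) - D (s 1) (emp M {1} m s)\<bar> \<le> c / real m"
begin

section \<open>Leave-one-out quantities for arbitrary index sets of the first sample\<close>

abbreviation "XX i \<equiv> V (Inl i)"
abbreviation "YY j \<equiv> V (Inr j)"
abbreviation "em J \<omega> \<equiv> empirical M J (\<lambda>i. V (Inl i) \<omega>)"

text \<open>A probability under the product law rather than on \<open>S\<close>, hence the same
  number for both orders of the samples.\<close>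

definition "near1 m = \<P>(s in PiM UNIV (\<lambda>_. P). loo_near M D c m s (s 0) (s 1))"
text \<open>Indices \<open>m + 1\<close> and \<open>m + 2\<close> lie outside the sample, so the two
  pairs are disjoint from each other and from the reduced sample \<open>{2..m}\<close>; given that
  sample, their closeness events are independent and equally likely.\<close>

definition "near2 m = \<P>(s in PiM UNIV (\<lambda>_. P).
  loo_near M D c m s (s 0) (s 1) \<and> loo_near M D c m s (s (m + 1)) (s (m + 2)))"
definition "kdev m = (\<integral>s. \<bar>kern D P (emp M {1} m s) (s 0) (s 1) - kern D P P (s 0) (s 1)\<bar> \<partial>PiM UNIV (\<lambda>_. P))"

text \<open>The point \<open>a\<close> takes the role of the generic index 0; it may come from
  either sample as long as it is not one of the points in \<open>J\<close>.\<close>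

lemma stable_far:
  assumes J: "finite J" "k \<in> J" "m0 \<le> card J" and a: "a \<notin> Inl ` J"
  shows "AE \<omega> in S. \<bar>D (V a \<omega>) (em J \<omega>) - D (V a \<omega>) (em (J - {k}) \<omega>)\<bar> \<le> c / real (card J)"
proof -
  \<comment> \<open>Fillers for the last two positions of \<open>sample_injection\<close>, taken
    from the second sample and away from \<open>a\<close>.\<close>
  obtain b d :: "nat + nat" where bd: "a \<noteq> b" "a \<noteq> d" "b \<noteq> d" "b \<notin> range Inl" "d \<notin> range Inl"
  proof (cases a)
    case (Inl l)
    then show thesis by (intro that[of "Inr 0" "Inr 1"]) auto
  next
    case (Inr j)
    then show thesis by (intro that[of "Inr (j + 1)" "Inr (j + 2)"]) auto
  qed
  have dist: "{a, b, d} \<inter> Inl ` J = {}" "a \<noteq> b" "a \<noteq> d" "b \<noteq> d"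
    using a bd by auto
  obtain f :: "nat \<Rightarrow> nat + nat" where f: "inj f" "f 0 = a"
    "\<And>x. emp M {} (card J) (\<lambda>l. x (f l)) = empirical M J (\<lambda>i. x (Inl i))"
    "\<And>x. emp M {1} (card J) (\<lambda>l. x (f l)) = empirical M (J - {k}) (\<lambda>i. x (Inl i))"
    using sample_injection[OF J(1,2) dist, where M=M]
    by (elim exE conjE) (rule that; (assumption | erule spec))
  interpret W: iid_family S M P "\<lambda>l. V (f l)" using f(1) by (rule reindex)
  note fV = f(3)[of "\<lambda>i. V i \<omega>" for \<omega>] f(4)[of "\<lambda>i. V i \<omega>" for \<omega>]
  have "AE \<omega> in S. \<bar>D (V (f 0) \<omega>) (emp M {} (card J) (\<lambda>l. V (f l) \<omega>)) - D (V (f 0) \<omega>) (emp M {1} (card J) (\<lambda>l. V (f l) \<omega>))\<bar> \<le> c / real (card J)"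
    using W.AE_process[OF stable_measurable, of "card J" 0] stable0[OF J(3)] J(3) m0 by simp
  then show ?thesis unfolding fV f(2) .
qed

text \<open>Here the depth is taken at the removed point, a member of the full sample; it becomes
  index 1.\<close>

lemma stable_self:
  assumes J: "finite J" "k \<in> J" "m0 \<le> card J"
  shows "AE \<omega> in S. \<bar>D (XX k \<omega>) (em J \<omega>) - D (XX k \<omega>) (em (J - {k}) \<omega>)\<bar> \<le> c / real (card J)"
proof -
  have dist: "{Inr 0, Inr 1, Inr 2} \<inter> Inl ` J = {}"
    "(Inr 0 :: nat + nat) \<noteq> Inr 1" "(Inr 0 :: nat + nat) \<noteq> Inr 2" "(Inr 1 :: nat + nat) \<noteq> Inr 2"
    by auto
  obtain f :: "nat \<Rightarrow> nat + nat" where f: "inj f" "f 1 = Inl k"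
    "\<And>x. emp M {} (card J) (\<lambda>l. x (f l)) = empirical M J (\<lambda>i. x (Inl i))"
    "\<And>x. emp M {1} (card J) (\<lambda>l. x (f l)) = empirical M (J - {k}) (\<lambda>i. x (Inl i))"
    using sample_injection[OF J(1,2) dist, where M=M]
    by (elim exE conjE) (rule that; (assumption | erule spec))
  interpret W: iid_family S M P "\<lambda>l. V (f l)" using f(1) by (rule reindex)
  note fV = f(3)[of "\<lambda>i. V i \<omega>" for \<omega>] f(4)[of "\<lambda>i. V i \<omega>" for \<omega>]
  have "AE \<omega> in S. \<bar>D (V (f 1) \<omega>) (emp M {} (card J) (\<lambda>l. V (f l) \<omega>)) - D (V (f 1) \<omega>) (emp M {1} (card J) (\<lambda>l. V (f l) \<omega>))\<bar> \<le> c / real (card J)"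
    using W.AE_process[OF stable_measurable, of "card J" 1] stable1[OF J(3)] J(3) m0 by simp
  then show ?thesis unfolding fV f(2) .
qed

abbreviation "close J r a b \<omega> \<equiv> \<bar>D (V a \<omega>) (em J \<omega>) - D (V b \<omega>) (em J \<omega>)\<bar> \<le> 2 * (c / real r)"

lemma near1_eq:
  assumes J: "finite J" "k \<in> J" "2 \<le> card J"
  shows "\<P>(\<omega> in S. close (J - {k}) (card J) (Inr j) (Inl k) \<omega>) = near1 (card J)"
proof -
  have dist: "{Inr j, Inr (j + 1), Inr (j + 2)} \<inter> Inl ` J = {}"
    "(Inr j :: nat + nat) \<noteq> Inr (j + 1)" "(Inr j :: nat + nat) \<noteq> Inr (j + 2)" "(Inr (j + 1) :: nat + nat) \<noteq> Inr (j + 2)"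
    by auto
  obtain f :: "nat \<Rightarrow> nat + nat" where f: "inj f" "f 0 = Inr j" "f 1 = Inl k"
    "\<And>x. emp M {1} (card J) (\<lambda>l. x (f l)) = empirical M (J - {k}) (\<lambda>i. x (Inl i))"
    using sample_injection[OF J(1,2) dist, where M=M]
    by (elim exE conjE) (rule that; (assumption | erule spec))
  interpret W: iid_family S M P "\<lambda>l. V (f l)" using f(1) by (rule reindex)
  note fV = f(4)[of "\<lambda>i. V i \<omega>" for \<omega>]
  have "\<P>(\<omega> in S. loo_near M D c (card J) (\<lambda>l. V (f l) \<omega>) (V (f 0) \<omega>) (V (f 1) \<omega>)) = near1 (card J)"
    unfolding near1_def by (rule W.prob_process[OF loo_near_measurable[OF J(3)]])
  then show ?thesis unfolding loo_near_def fV f(2-3) .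
qed

text \<open>The removed point \<open>Inl k\<close> at index 1 is paired with \<open>Inr l\<close> at
  index 0, and \<open>Inr j\<close>, \<open>Inl i\<close> take the two indices after the sample.
  That \<open>i\<close> is outside \<open>J\<close> fits the situation where \<open>i\<close> has
  been removed before.\<close>

lemma near2_eq:
  assumes J: "finite J" "k \<in> J" "2 \<le> card J" and "i \<notin> J" "j \<noteq> l"
  shows "\<P>(\<omega> in S. close (J - {k}) (card J) (Inr l) (Inl k) \<omega> \<and> close (J - {k}) (card J) (Inr j) (Inl i) \<omega>) = near2 (card J)"
proof -
  have dist: "{Inr l, Inr j, Inl i} \<inter> Inl ` J = {}"
    "(Inr l :: nat + nat) \<noteq> Inr j" "Inr l \<noteq> Inl i" "Inr j \<noteq> Inl i"
    using assms by auto
  obtain f :: "nat \<Rightarrow> nat + nat" where f: "inj f" "f 0 = Inr l" "f 1 = Inl k" "f (card J + 1) = Inr j" "f (card J + 2) = Inl i"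
    "\<And>x. emp M {1} (card J) (\<lambda>l. x (f l)) = empirical M (J - {k}) (\<lambda>i. x (Inl i))"
    using sample_injection[OF J(1,2) dist, where M=M]
    by (elim exE conjE) (rule that; (assumption | erule spec))
  interpret W: iid_family S M P "\<lambda>l. V (f l)" using f(1) by (rule reindex)
  note fV = f(6)[of "\<lambda>i. V i \<omega>" for \<omega>]
  note [measurable] = loo_near_measurable[OF J(3)]
  have "\<P>(\<omega> in S. loo_near M D c (card J) (\<lambda>l. V (f l) \<omega>) (V (f 0) \<omega>) (V (f 1) \<omega>) \<and>
      loo_near M D c (card J) (\<lambda>l. V (f l) \<omega>) (V (f (card J + 1)) \<omega>) (V (f (card J + 2)) \<omega>)) = near2 (card J)"
    unfolding near2_def by (rule W.prob_process) measurable
  then show ?thesis unfolding loo_near_def fV f(2-5) .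
qed

lemma kdev_eq:
  assumes J: "finite J" "k \<in> J" "2 \<le> card J"
  shows "(\<integral>\<omega>. \<bar>kern D P (em (J - {k}) \<omega>) (XX k \<omega>) (YY j \<omega>) - kern D P P (XX k \<omega>) (YY j \<omega>)\<bar> \<partial>S) = kdev (card J)"
proof -
  have dist: "{Inr j, Inr (j + 1), Inr (j + 2)} \<inter> Inl ` J = {}"
    "(Inr j :: nat + nat) \<noteq> Inr (j + 1)" "(Inr j :: nat + nat) \<noteq> Inr (j + 2)" "(Inr (j + 1) :: nat + nat) \<noteq> Inr (j + 2)"
    by auto
  obtain f :: "nat \<Rightarrow> nat + nat" where f: "inj f" "f 0 = Inr j" "f 1 = Inl k"
    "\<And>x. emp M {1} (card J) (\<lambda>l. x (f l)) = empirical M (J - {k}) (\<lambda>i. x (Inl i))"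
    using sample_injection[OF J(1,2) dist, where M=M]
    by (elim exE conjE) (rule that; (assumption | erule spec))
  interpret W: iid_family S M P "\<lambda>l. V (f l)" using f(1) by (rule reindex)
  note fV = f(4)[of "\<lambda>i. V i \<omega>" for \<omega>]
  have "2 \<in> {1..card J} - {1}" using J(3) by simp
  then have ne: "{1..card J} - {1} \<noteq> {}" by blast
  have [measurable]: "(\<lambda>s. kern D P (emp M {1} (card J) s) (s 0) (s 1)) \<in> borel_measurable (PiM (UNIV :: nat set) (\<lambda>_. M))"
    unfolding emp_def using ne by (intro kern_empirical_measurable) auto
  have "(\<integral>\<omega>. \<bar>kern D P (emp M {1} (card J) (\<lambda>l. V (f l) \<omega>)) (V (f 0) \<omega>) (V (f 1) \<omega>) - kern D P P (V (f 0) \<omega>) (V (f 1) \<omega>)\<bar> \<partial>S) = kdev (card J)"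
    unfolding kdev_def by (rule W.expectation_process) measurable
  \<comment> \<open>The renumbering puts the \<open>Y\<close> point at index 0 and the
    \<open>X\<close> point at index 1, the reverse of the order here; flipping both kernels keeps
    the absolute difference.\<close>
  moreover have "\<bar>kern D P \<mu> y x - kern D P \<nu> y x\<bar> = \<bar>kern D P \<mu> x y - kern D P \<nu> x y\<bar>" for \<mu> \<nu> x y
    by (subst (1 2) kern_flip) simp
  ultimately show ?thesis unfolding fV f(2-3) by simp
qed

end

lemma (in prob_space) prob_eq_expectation_of_bool:
  assumes "Measurable.pred M Q"
  shows "\<P>(\<omega> in M. Q \<omega>) = expectation (\<lambda>\<omega>. of_bool (Q \<omega>))"
proof -
  have "expectation (\<lambda>\<omega>. of_bool (Q \<omega>)) = expectation (\<lambda>\<omega>. indicator {\<omega> \<in> space M. Q \<omega>} \<omega> :: real)"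
    by (rule Bochner_Integration.integral_cong) (auto simp: indicator_def)
  then show ?thesis using assms by simp
qed

lemma (in prob_space) expectation_le_prob:
  fixes f :: "'a \<Rightarrow> real"
  assumes [measurable]: "f \<in> borel_measurable M" "Measurable.pred M Q"
    and "AE \<omega> in M. f \<omega> \<le> of_bool (Q \<omega>)" "\<And>\<omega>. 0 \<le> f \<omega>"
  shows "expectation f \<le> \<P>(\<omega> in M. Q \<omega>)"
proof -
  have b: "AE \<omega> in M. norm (f \<omega>) \<le> 1"
    using assms(3) by eventually_elim (use assms(4) in \<open>auto split: if_splits simp: of_bool_def\<close>)
  have "expectation f \<le> expectation (\<lambda>\<omega>. of_bool (Q \<omega>))"
    by (intro integral_mono_AE assms integrable_const_bound[OF b]) (auto intro!: integrable_const_bound[where B=1])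
  also have "\<dots> = \<P>(\<omega> in M. Q \<omega>)"
    by (rule prob_eq_expectation_of_bool[symmetric]) measurable
  finally show ?thesis .
qed

section \<open>Covariances of the pair kernels\<close>

context two_sample
begin

abbreviation "pair_kern J i j \<omega> \<equiv> kern D P (em J \<omega>) (V (Inl i) \<omega>) (V (Inr j) \<omega>)"
abbreviation "pair_kern_P i j \<omega> \<equiv> kern D P P (V (Inl i) \<omega>) (V (Inr j) \<omega>)"

lemma pair_kern_measurable:
  assumes "finite J" "J \<noteq> {}"
  shows "pair_kern J i j \<in> borel_measurable S"
  using assms by (intro kern_empirical_measurable) auto

lemma integrable_pair_kern:
  assumes "finite J" "J \<noteq> {}"
  shows "integrable S (pair_kern J i j)"
  using kern_bound by (intro integrable_const_bound[where B="3/2"] pair_kern_measurable assms) auto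

lemma abs_mult_kern: "\<bar>kern D P \<mu> x y * kern D P \<nu> x' y'\<bar> \<le> 9 / 4"
proof -
  have "\<bar>kern D P \<mu> x y * kern D P \<nu> x' y'\<bar> \<le> 3 / 2 * (3 / 2)"
    unfolding abs_mult by (intro mult_mono kern_bound) auto
  then show ?thesis by simp
qed

lemma integrable_pair_kern_mult:
  assumes "finite J" "J \<noteq> {}" "finite K" "K \<noteq> {}"
  shows "integrable S (\<lambda>\<omega>. pair_kern J i j \<omega> * pair_kern K k l \<omega>)"
  using abs_mult_kern
  by (intro integrable_const_bound[where B="9/4"] borel_measurable_times pair_kern_measurable assms) auto

lemma integrable_pair_kern_P_mult: "integrable S (\<lambda>\<omega>. pair_kern_P i j \<omega> * pair_kern_P k l \<omega>)"
  using abs_mult_kern by (intro integrable_const_bound[where B="9/4"]) auto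

lemma close_measurable:
  assumes "finite J" "J \<noteq> {}"
  shows "Measurable.pred S (close J r a b)"
proof -
  have [measurable]: "(\<lambda>\<omega>. D (V a \<omega>) (em J \<omega>)) \<in> borel_measurable S" for a
    using assms by (intro depth_empirical_measurable) auto
  show ?thesis by measurable
qed

text \<open>Both depths move by at most \<open>c / card J\<close>. The point \<open>Inr j\<close> is
  never in the sample; \<open>Inl i\<close> is either outside it, which occurs at a second removal,
  or is the removed point, which occurs at the first.\<close>

lemma pair_kern_loo_diff:
  assumes J: "finite J" "k \<in> J" "m0 \<le> card J" and i: "i \<notin> J \<or> i = k"
  shows "AE \<omega> in S. \<bar>pair_kern J i j \<omega> - pair_kern (J - {k}) i j \<omega>\<bar> \<le> of_bool (close (J - {k}) (card J) (Inr j) (Inl i) \<omega>)"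
proof -
  have Y: "AE \<omega> in S. \<bar>D (YY j \<omega>) (em J \<omega>) - D (YY j \<omega>) (em (J - {k}) \<omega>)\<bar> \<le> c / real (card J)"
    using J by (intro stable_far) auto
  have X: "AE \<omega> in S. \<bar>D (XX i \<omega>) (em J \<omega>) - D (XX i \<omega>) (em (J - {k}) \<omega>)\<bar> \<le> c / real (card J)"
    using i
  proof
    assume "i \<notin> J" then show ?thesis using J by (intro stable_far) auto
  next
    assume "i = k" then show ?thesis using stable_self[OF J] by simp
  qed
  from X Y show ?thesis
  proof eventually_elim
    case (elim \<omega>)
    then show ?case using kern_diff_le[OF elim(1,2), of P] by (simp only: abs_minus_commute)
  qed
qed

lemma loo_nonempty:
  assumes "finite J" "2 \<le> card J"
  shows "J - {k} \<noteq> {}"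
proof
  assume "J - {k} = {}"
  then have "card J \<le> card {k}" by (intro card_mono) auto
  then show False using assms by simp
qed

lemma pair_kern_loo_expectation:
  assumes J: "finite J" "k \<in> J" "m0 \<le> card J"
  shows "(\<integral>\<omega>. \<bar>pair_kern J k j \<omega> - pair_kern (J - {k}) k j \<omega>\<bar> \<partial>S) \<le> near1 (card J)"
proof -
  have ne: "J - {k} \<noteq> {}" "J \<noteq> {}" using loo_nonempty[of J k] J m0 by auto
  have "(\<integral>\<omega>. \<bar>pair_kern J k j \<omega> - pair_kern (J - {k}) k j \<omega>\<bar> \<partial>S) \<le> \<P>(\<omega> in S. close (J - {k}) (card J) (Inr j) (Inl k) \<omega>)"
    using pair_kern_loo_diff[OF J, of k j] J ne
    by (intro expectation_le_prob borel_measurable_abs borel_measurable_diff pair_kern_measurable close_measurable) auto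
  then show ?thesis using near1_eq[OF J(1,2)] J m0 by simp
qed

text \<open>Exchange \<open>Inl i\<close> with \<open>Inr j\<close>: as \<open>i\<close> is in
  neither index set, both empirical measures stay fixed; the second pair is disjoint from the first,
  so only the first kernel changes sign.\<close>

lemma pair_kern_orthogonal:
  assumes J: "finite J" "J \<noteq> {}" "i \<notin> J" and K: "finite K" "K \<noteq> {}" "i \<notin> K" and "i \<noteq> k" "j \<noteq> l"
  shows "(\<integral>\<omega>. pair_kern J i j \<omega> * pair_kern K k l \<omega> \<partial>S) = 0"
proof -
  let ?k = "\<lambda>J i j s. kern D P (empirical M J (\<lambda>i. s (Inl i))) (s (Inl i)) (s (Inr j))"
  define \<phi> where "\<phi> s = ?k J i j s * ?k K k l s" for s
  let ?\<sigma> = "Transposition.transpose (Inl i) (Inr j)"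
  have inv: "empirical M L (\<lambda>x. s (?\<sigma> (Inl x))) = empirical M L (\<lambda>x. s (Inl x))" if "i \<notin> L" for L s
    using that by (intro empirical_cong) (auto simp: Transposition.transpose_def)
  have "(\<integral>\<omega>. \<phi> (\<lambda>i. V i \<omega>) \<partial>S) = 0"
  proof (rule expectation_antisym)
    show "\<phi> \<in> borel_measurable (PiM UNIV (\<lambda>_. M))"
      unfolding \<phi>_def using J K
      by (intro borel_measurable_times kern_empirical_measurable) auto
    show "inj ?\<sigma>" by (rule inj_transpose)
    show "\<phi> (\<lambda>i. s (?\<sigma> i)) = - \<phi> s" for s
    proof -
      have "?\<sigma> (Inl k) = Inl k" "?\<sigma> (Inr l) = Inr l"
        using assms by (auto simp: Transposition.transpose_def)
      then show ?thesis
        unfolding \<phi>_def inv[OF J(3)] inv[OF K(3)]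
        using kern_flip[of D P _ "s (Inr j)" "s (Inl i)"] by simp
    qed
  qed
  then show ?thesis by (simp add: \<phi>_def)
qed

text \<open>Exchanging does not apply to \<open>?a * ?b\<close> itself, because the measure in
  \<open>?a\<close> contains \<open>X k\<close> and that in \<open>?b\<close> contains
  \<open>X i\<close>. The kernels \<open>?a'\<close> and \<open>?b'\<close> use the sample without
  both points, and each product containing one of them has mean zero.\<close>

lemma expectation_pair_kern_distinct:
  assumes I: "finite I" "i \<in> I" "k \<in> I" "m0 < card I" and d: "i \<noteq> k" "j \<noteq> l"
  shows "(\<integral>\<omega>. pair_kern (I - {i}) i j \<omega> * pair_kern (I - {k}) k l \<omega> \<partial>S) \<le> near2 (card I - 1)"
proof -
  define K where "K = I - {i} - {k}"
  have K': "K = I - {k} - {i}" by (auto simp: K_def)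
  have c: "card (I - {i}) = card I - 1" "card (I - {k}) = card I - 1" using I by auto
  have ne: "I - {i} \<noteq> {}" "I - {k} \<noteq> {}" "K \<noteq> {}" "finite (I - {i})" "finite (I - {k})" "finite K"
    using I m0 c loo_nonempty[of I i] loo_nonempty[of I k] loo_nonempty[of "I - {i}" k] by (simp_all add: K_def)
  have iK: "i \<notin> K" "k \<notin> K" by (auto simp: K_def)
  let ?a = "pair_kern (I - {i}) i j" and ?b = "pair_kern (I - {k}) k l" and ?a' = "pair_kern K i j" and ?b' = "pair_kern K k l"
  \<comment> \<open>In the third product the exchanged pair is \<open>k\<close>, \<open>l\<close>:
    \<open>k\<close> is missing from both \<open>I - {k}\<close> and \<open>K\<close>, whereas
    \<open>i\<close> belongs to \<open>I - {k}\<close>.\<close>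
  have z: "(\<integral>\<omega>. ?a \<omega> * ?b' \<omega> \<partial>S) = 0" "(\<integral>\<omega>. ?a' \<omega> * ?b' \<omega> \<partial>S) = 0" "(\<integral>\<omega>. ?b \<omega> * ?a' \<omega> \<partial>S) = 0"
    using ne iK d by (auto intro!: pair_kern_orthogonal)
  let ?Q = "\<lambda>\<omega>. close K (card I - 1) (Inr l) (Inl k) \<omega> \<and> close K (card I - 1) (Inr j) (Inl i) \<omega>"
  note [measurable] = pair_kern_measurable[OF ne(4,1)] pair_kern_measurable[OF ne(5,2)] pair_kern_measurable[OF ne(6,3)] close_measurable[OF ne(6,3)]
  have da: "AE \<omega> in S. \<bar>?a \<omega> - ?a' \<omega>\<bar> \<le> of_bool (close K (card I - 1) (Inr j) (Inl i) \<omega>)"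
    using pair_kern_loo_diff[of "I - {i}" k i j] I d c unfolding K_def by simp
  have db: "AE \<omega> in S. \<bar>?b \<omega> - ?b' \<omega>\<bar> \<le> of_bool (close K (card I - 1) (Inr l) (Inl k) \<omega>)"
    using pair_kern_loo_diff[of "I - {k}" i k l] I d c unfolding K' by simp
  have "(\<integral>\<omega>. (?a \<omega> - ?a' \<omega>) * (?b \<omega> - ?b' \<omega>) \<partial>S)
      = (\<integral>\<omega>. ?a \<omega> * ?b \<omega> - ?a \<omega> * ?b' \<omega> - ?b \<omega> * ?a' \<omega> + ?a' \<omega> * ?b' \<omega> \<partial>S)"
    by (rule Bochner_Integration.integral_cong) (auto simp: algebra_simps)
  also have "\<dots> = (\<integral>\<omega>. ?a \<omega> * ?b \<omega> \<partial>S)" \<comment> \<open>the other three terms change sign when a point is swapped with its partner\<close>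
    using ne z by (simp add: integrable_pair_kern_mult)
  finally have "(\<integral>\<omega>. ?a \<omega> * ?b \<omega> \<partial>S) = (\<integral>\<omega>. (?a \<omega> - ?a' \<omega>) * (?b \<omega> - ?b' \<omega>) \<partial>S)" ..
  also have "\<dots> \<le> (\<integral>\<omega>. \<bar>(?a \<omega> - ?a' \<omega>) * (?b \<omega> - ?b' \<omega>)\<bar> \<partial>S)"
    by (rule integral_abs_bound[THEN order_trans[OF abs_ge_self]])
  also have "\<dots> \<le> \<P>(\<omega> in S. ?Q \<omega>)"
  proof (rule expectation_le_prob)
    show "AE \<omega> in S. \<bar>(?a \<omega> - ?a' \<omega>) * (?b \<omega> - ?b' \<omega>)\<bar> \<le> of_bool (?Q \<omega>)"
      using da db
    proof eventually_elim
      case (elim \<omega>)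
      have "\<bar>(?a \<omega> - ?a' \<omega>) * (?b \<omega> - ?b' \<omega>)\<bar> \<le> of_bool (close K (card I - 1) (Inr j) (Inl i) \<omega>) * of_bool (close K (card I - 1) (Inr l) (Inl k) \<omega>)"
        unfolding abs_mult using elim by (intro mult_mono) auto
      then show ?case by (simp add: of_bool_def split: if_splits)
    qed
    show "Measurable.pred S ?Q" by measurable
  qed auto
  \<comment> \<open>The second removal starts from \<open>card I - 1\<close> points, hence the
    shifted argument of \<open>near2\<close>.\<close>
  also have "\<dots> = near2 (card (I - {i}))"
    using near2_eq[of "I - {i}" k i j l] I d c m0 unfolding K_def by simp
  finally show ?thesis using c by simp
qed

text \<open>For a shared first point this is degeneracy around \<open>Inl i\<close>; for a shared
  second point both kernels are flipped and the signs cancel.\<close>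

lemma pair_kern_P_orthogonal:
  assumes "i = k \<and> j \<noteq> l \<or> i \<noteq> k \<and> j = l"
  shows "(\<integral>\<omega>. pair_kern_P i j \<omega> * pair_kern_P k l \<omega> \<partial>S) = 0"
  using assms
proof (elim disjE conjE)
  assume "i = k" "j \<noteq> l"
  then show ?thesis using kern_P_orthogonal[of "Inl i" "Inr j" "Inr l"] by simp
next
  assume "i \<noteq> k" "j = l"
  have e: "pair_kern_P i l \<omega> * pair_kern_P k l \<omega> = kern D P P (YY l \<omega>) (XX i \<omega>) * kern D P P (YY l \<omega>) (XX k \<omega>)" for \<omega>
    using kern_flip[of D P P "YY l \<omega>" "XX i \<omega>"] kern_flip[of D P P "YY l \<omega>" "XX k \<omega>"] by simp
  from \<open>i \<noteq> k\<close> \<open>j = l\<close> show ?thesis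
    using kern_P_orthogonal[of "Inr j" "Inl i" "Inl k"]
    by (simp add: e)
qed

text \<open>At P the product has mean zero. Replacing the two kernels one after the other costs
  \<open>3 / 2 * kdev\<close> each, where 3/2 bounds the factor left in place.\<close>

lemma expectation_pair_kern_shared:
  assumes I: "finite I" "i \<in> I" "k \<in> I" "2 \<le> card I" and d: "i = k \<and> j \<noteq> l \<or> i \<noteq> k \<and> j = l"
  shows "(\<integral>\<omega>. pair_kern (I - {i}) i j \<omega> * pair_kern (I - {k}) k l \<omega> \<partial>S) \<le> 3 * kdev (card I)"
proof -
  have ne: "I - {i} \<noteq> {}" "I - {k} \<noteq> {}" "finite (I - {i})" "finite (I - {k})"
    using I loo_nonempty[of I] by auto
  let ?a = "pair_kern (I - {i}) i j" and ?b = "pair_kern (I - {k}) k l" and ?a' = "pair_kern_P i j" and ?b' = "pair_kern_P k l"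
  note [measurable] = pair_kern_measurable[OF ne(3,1)] pair_kern_measurable[OF ne(4,2)]
  have bd: "\<bar>?a \<omega>\<bar> \<le> 3 / 2" "\<bar>?b \<omega>\<bar> \<le> 3 / 2" "\<bar>?a' \<omega>\<bar> \<le> 3 / 2" "\<bar>?b' \<omega>\<bar> \<le> 3 / 2" for \<omega>
    by (rule kern_bound)+
  have bd3: "\<bar>kern D P \<mu> x y - kern D P \<nu> x y\<bar> \<le> 3" for \<mu> \<nu> x y
    using kern_bound[of \<mu> x y] kern_bound[of \<nu> x y] by linarith
  have i: "integrable S (\<lambda>\<omega>. \<bar>?a \<omega> - ?a' \<omega>\<bar>)" "integrable S (\<lambda>\<omega>. \<bar>?b \<omega> - ?b' \<omega>\<bar>)"
    by (auto intro!: integrable_const_bound[where B=3] AE_I2 bd3)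
  have "(\<integral>\<omega>. ?a \<omega> * ?b \<omega> \<partial>S) = (\<integral>\<omega>. ?a \<omega> * ?b \<omega> \<partial>S) - (\<integral>\<omega>. ?a' \<omega> * ?b' \<omega> \<partial>S)"
    using pair_kern_P_orthogonal[OF d] by simp
  also have "\<dots> = (\<integral>\<omega>. ?a \<omega> * ?b \<omega> - ?a' \<omega> * ?b' \<omega> \<partial>S)"
    using ne by (intro Bochner_Integration.integral_diff[symmetric] integrable_pair_kern_mult integrable_pair_kern_P_mult)
  also have "\<dots> \<le> (\<integral>\<omega>. 3 / 2 * \<bar>?a \<omega> - ?a' \<omega>\<bar> + 3 / 2 * \<bar>?b \<omega> - ?b' \<omega>\<bar> \<partial>S)"
  proof (rule integral_mono)
    show "integrable S (\<lambda>\<omega>. ?a \<omega> * ?b \<omega> - ?a' \<omega> * ?b' \<omega>)"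
      using ne by (intro Bochner_Integration.integrable_diff integrable_pair_kern_mult integrable_pair_kern_P_mult)
    show "integrable S (\<lambda>\<omega>. 3 / 2 * \<bar>?a \<omega> - ?a' \<omega>\<bar> + 3 / 2 * \<bar>?b \<omega> - ?b' \<omega>\<bar>)"
      using i by auto
    fix \<omega>
    have "?a \<omega> * ?b \<omega> - ?a' \<omega> * ?b' \<omega> = ?b \<omega> * (?a \<omega> - ?a' \<omega>) + ?a' \<omega> * (?b \<omega> - ?b' \<omega>)"
      by (simp add: algebra_simps)
    also have "\<dots> \<le> \<bar>?b \<omega>\<bar> * \<bar>?a \<omega> - ?a' \<omega>\<bar> + \<bar>?a' \<omega>\<bar> * \<bar>?b \<omega> - ?b' \<omega>\<bar>"
      unfolding abs_mult[symmetric] by (intro add_mono abs_ge_self)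
    also have "\<dots> \<le> 3 / 2 * \<bar>?a \<omega> - ?a' \<omega>\<bar> + 3 / 2 * \<bar>?b \<omega> - ?b' \<omega>\<bar>"
      using bd by (intro add_mono mult_right_mono) auto
    finally show "?a \<omega> * ?b \<omega> - ?a' \<omega> * ?b' \<omega> \<le> 3 / 2 * \<bar>?a \<omega> - ?a' \<omega>\<bar> + 3 / 2 * \<bar>?b \<omega> - ?b' \<omega>\<bar>" .
  qed
  also have "\<dots> = 3 / 2 * kdev (card I) + 3 / 2 * kdev (card I)"
    using i by (simp add: kdev_eq[OF I(1,2,4)] kdev_eq[OF I(1,3,4)])
  finally show ?thesis by simp
qed

end

text \<open>The Cauchy-Schwarz inequality against the constant 1, obtained from the nonnegative
  variance of \<open>\<bar>f\<bar>\<close>.\<close>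

lemma (in prob_space) expectation_abs_le_sqrt:
  fixes f :: "'a \<Rightarrow> real"
  assumes "integrable M f" "integrable M (\<lambda>\<omega>. (f \<omega>)\<^sup>2)"
  shows "expectation (\<lambda>\<omega>. \<bar>f \<omega>\<bar>) \<le> sqrt (expectation (\<lambda>\<omega>. (f \<omega>)\<^sup>2))"
proof (rule real_le_rsqrt)
  have "0 \<le> variance (\<lambda>\<omega>. \<bar>f \<omega>\<bar>)" by (rule variance_positive)
  also have "\<dots> = expectation (\<lambda>\<omega>. \<bar>f \<omega>\<bar>\<^sup>2) - (expectation (\<lambda>\<omega>. \<bar>f \<omega>\<bar>))\<^sup>2"
    using assms by (intro variance_eq) auto
  finally show "(expectation (\<lambda>\<omega>. \<bar>f \<omega>\<bar>))\<^sup>2 \<le> expectation (\<lambda>\<omega>. (f \<omega>)\<^sup>2)" by simp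
qed

section \<open>Linearization of the LS-statistic\<close>

text \<open>Evaluates the majorant of the covariances of two index pairs. The diagonal is counted in
  every term, which only enlarges the majorant for nonnegative \<open>b\<close> and \<open>c\<close>
  and keeps the count simple.\<close>

lemma array_sum:
  fixes a b c :: real and m n :: nat
  defines "A \<equiv> {1..m} \<times> {1..n}"
  shows "(\<Sum>p\<in>A. \<Sum>q\<in>A. a * of_bool (p = q) + b * (of_bool (fst p = fst q) + of_bool (snd p = snd q)) + c)
    = a * (real m * real n) + b * (real m * real n * (real m + real n)) + c * (real m * real n)\<^sup>2"
proof -
  have card: "real (card A) = real m * real n" and fin: "finite A" by (auto simp: A_def)
  have eq: "(\<Sum>q\<in>A. of_bool (p = q)) = (1 :: real)" if "p \<in> A" for p
    using that fin by (simp add: of_bool_def)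
  have prod: "(\<Sum>q\<in>A. g (fst q) (snd q)) = (\<Sum>k\<in>{1..m}. \<Sum>l\<in>{1..n}. g k l)" for g :: "nat \<Rightarrow> nat \<Rightarrow> real"
    unfolding A_def by (simp add: sum.cartesian_product split_beta)
  have f: "(\<Sum>q\<in>A. of_bool (fst p = fst q)) = real n" if "p \<in> A" for p
  proof -
    have "(\<Sum>q\<in>A. of_bool (fst p = fst q)) = (\<Sum>k\<in>{1..m}. \<Sum>l\<in>{1..n}. of_bool (fst p = k) :: real)"
      by (rule prod)
    also have "\<dots> = (\<Sum>k\<in>{1..m}. if fst p = k then real n else 0)"
      by (intro sum.cong) auto
    finally show ?thesis using that by (auto simp: A_def)
  qed
  have s: "(\<Sum>q\<in>A. of_bool (snd p = snd q)) = real m" if "p \<in> A" for p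
  proof -
    have "(\<Sum>q\<in>A. of_bool (snd p = snd q)) = (\<Sum>k\<in>{1..m}. \<Sum>l\<in>{1..n}. of_bool (snd p = l) :: real)"
      by (rule prod)
    also have "\<dots> = (\<Sum>k\<in>{1..m}. 1)"
      using that by (intro sum.cong) (auto simp: A_def of_bool_def)
    finally show ?thesis by simp
  qed
  have "(\<Sum>q\<in>A. a * of_bool (p = q) + b * (of_bool (fst p = fst q) + of_bool (snd p = snd q)) + c)
      = a + b * (real n + real m) + c * (real m * real n)" if "p \<in> A" for p
    unfolding sum.distrib sum_distrib_left[symmetric] using that by (simp add: eq f s card)
  then show ?thesis by (simp add: card) (simp add: algebra_simps power2_eq_square)
qed

text \<open>An exact identity for arbitrary sequences: \<open>kern\<close> differs from the
  comparison by a constant and terms in one point only, whose double sums collapse to single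
  sums.\<close>

lemma LS_expansion:
  assumes "1 \<le> m" "1 \<le> n"
  shows "LS M D m x n y - 1 / 2 - ((\<Sum>j=1..n. mid_cdf D P (y j)) / real n - (\<Sum>i=1..m. mid_cdf D P (x i)) / real m)
    = (\<Sum>p\<in>{1..m} \<times> {1..n}. kern D P (emp M {} m x) (x (fst p)) (y (snd p))) / (real m * real n)"
proof -
  define C where "C = (\<Sum>i=1..m. \<Sum>j=1..n. cmp (D (x i) (emp M {} m x)) (D (y j) (emp M {} m x)))"
  have LS: "LS M D m x n y = C / (real m * real n)"
    by (simp add: LS_def C_def cmp_def)
  have "(\<Sum>p\<in>{1..m} \<times> {1..n}. kern D P (emp M {} m x) (x (fst p)) (y (snd p)))
     = (\<Sum>i=1..m. \<Sum>j=1..n. kern D P (emp M {} m x) (x i) (y j))"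
    by (simp add: sum.cartesian_product split_beta)
  also have "\<dots> = C
     + real n * (\<Sum>i=1..m. mid_cdf D P (x i)) - real m * (\<Sum>j=1..n. mid_cdf D P (y j)) - real m * real n / 2"
    unfolding kern_def C_def by (simp add: sum.distrib sum_subtractf sum_distrib_left)
  finally show ?thesis unfolding LS using assms by (simp only:) (simp add: field_simps)
qed

section \<open>Second moment and mean remainder of the linearization\<close>

context two_sample
begin

lemma near2_nonneg: "0 \<le> near2 m" and near1_nonneg: "0 \<le> near1 m" and kdev_nonneg: "0 \<le> kdev m"
  by (auto simp: near1_def near2_def kdev_def)

lemma second_moment:
  fixes m n :: nat
  assumes m: "m0 < m"
  defines "A \<equiv> {1..m} \<times> {1..n}"
  shows "(\<integral>\<omega>. (\<Sum>p\<in>A. pair_kern ({1..m} - {fst p}) (fst p) (snd p) \<omega>)\<^sup>2 \<partial>S)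
    \<le> 9 / 4 * (real m * real n) + 3 * kdev m * (real m * real n * (real m + real n)) + near2 (m - 1) * (real m * real n)\<^sup>2"
proof -
  let ?z = "\<lambda>p. pair_kern ({1..m} - {fst p}) (fst p) (snd p)"
  have ne: "{1..m} - {k} \<noteq> {}" for k
    using m m0 by (intro loo_nonempty) auto
  have "(\<integral>\<omega>. (\<Sum>p\<in>A. ?z p \<omega>)\<^sup>2 \<partial>S) = (\<integral>\<omega>. (\<Sum>p\<in>A. \<Sum>q\<in>A. ?z p \<omega> * ?z q \<omega>) \<partial>S)"
    by (simp add: power2_eq_square sum_product)
  also have "\<dots> = (\<Sum>p\<in>A. \<Sum>q\<in>A. \<integral>\<omega>. ?z p \<omega> * ?z q \<omega> \<partial>S)"
    using ne by (simp add: integrable_pair_kern_mult)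
  also have "\<dots> \<le> (\<Sum>p\<in>A. \<Sum>q\<in>A. 9 / 4 * of_bool (p = q)
      + 3 * kdev m * (of_bool (fst p = fst q) + of_bool (snd p = snd q)) + near2 (m - 1))"
  proof (intro sum_mono)
    fix p q assume pq: "p \<in> A" "q \<in> A"
    then have 1: "fst p \<in> {1..m}" "fst q \<in> {1..m}" by (auto simp: A_def)
    note nn = near2_nonneg[of "m - 1"] kdev_nonneg[of m]
    consider "p = q" | "fst p = fst q \<and> snd p \<noteq> snd q \<or> fst p \<noteq> fst q \<and> snd p = snd q"
      | "fst p \<noteq> fst q" "snd p \<noteq> snd q"
      by (metis prod.expand)
    then show "(\<integral>\<omega>. ?z p \<omega> * ?z q \<omega> \<partial>S) \<le> 9 / 4 * of_bool (p = q)
      + 3 * kdev m * (of_bool (fst p = fst q) + of_bool (snd p = snd q)) + near2 (m - 1)"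
    proof cases
      case 1
      have "(\<integral>\<omega>. ?z p \<omega> * ?z q \<omega> \<partial>S) \<le> (\<integral>\<omega>. 9 / 4 \<partial>S)"
        using ne by (intro integral_mono integrable_pair_kern_mult order_trans[OF abs_ge_self abs_mult_kern]) auto
      with 1 nn show ?thesis by (simp add: prob_space)
    next
      case 2
      have "(\<integral>\<omega>. ?z p \<omega> * ?z q \<omega> \<partial>S) \<le> 3 * kdev (card {1..m})"
        using 1 2 m m0 by (intro expectation_pair_kern_shared) auto
      moreover have "p \<noteq> q" using 2 by auto
      ultimately show ?thesis using 2 nn by auto
    next
      case 3
      have "(\<integral>\<omega>. ?z p \<omega> * ?z q \<omega> \<partial>S) \<le> near2 (card {1..m} - 1)"
        using 1 3 m m0 by (intro expectation_pair_kern_distinct) auto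
      then show ?thesis using 3 nn by auto
    qed
  qed
  also have "\<dots> = 9 / 4 * (real m * real n) + 3 * kdev m * (real m * real n * (real m + real n)) + near2 (m - 1) * (real m * real n)\<^sup>2"
    unfolding A_def by (rule array_sum)
  finally show ?thesis .
qed

text \<open>Both sample means have expectation 1/2, so the difference is already centred.\<close>

definition "linear_part m n \<omega> = (\<Sum>j=1..n. mid_cdf D P (YY j \<omega>)) / real n - (\<Sum>i=1..m. mid_cdf D P (XX i \<omega>)) / real m"

text \<open>\<open>near1 m\<close> pays for passing to the reduced samples; the square root is the
  \<open>L2\<close> bound for the mean of what remains, after division by the number
  \<open>m * n\<close> of pairs.\<close>

lemma LS_linearization_bound:
  assumes m: "m0 < m" and n: "1 \<le> n"
  shows "(\<integral>\<omega>. \<bar>LS M D m (\<lambda>i. XX i \<omega>) n (\<lambda>j. YY j \<omega>) - 1 / 2 - linear_part m n \<omega>\<bar> \<partial>S)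
    \<le> near1 m + sqrt (9 / 4 / (real m * real n) + 3 * kdev m * (1 / real m + 1 / real n) + near2 (m - 1))"
proof -
  define A where "A = {1..m} \<times> {1..n}"
  define N where "N = real m * real n"
  have N: "0 < N" "real (card A) = N" using m n by (auto simp: A_def N_def)
  let ?Z = "\<lambda>p. pair_kern {1..m} (fst p) (snd p)"
  let ?z = "\<lambda>p. pair_kern ({1..m} - {fst p}) (fst p) (snd p)"
  have ne: "{1..m} - {k} \<noteq> {}" "{1..m} \<noteq> {}" for k
    using m m0 loo_nonempty[of "{1..m}" k] by simp_all
  have iz: "integrable S (?z p)" "integrable S (?Z p)" for p
    using ne by (auto intro!: integrable_pair_kern)
  have LS: "LS M D m (\<lambda>i. XX i \<omega>) n (\<lambda>j. YY j \<omega>) - 1 / 2 - linear_part m n \<omega> = (\<Sum>p\<in>A. ?Z p \<omega>) / N" for \<omega>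
    unfolding linear_part_def A_def N_def emp_empty[symmetric] using m n by (intro LS_expansion) auto
  have "(\<integral>\<omega>. \<bar>\<Sum>p\<in>A. ?Z p \<omega>\<bar> \<partial>S) \<le> (\<integral>\<omega>. (\<Sum>p\<in>A. \<bar>?Z p \<omega> - ?z p \<omega>\<bar>) + \<bar>\<Sum>p\<in>A. ?z p \<omega>\<bar> \<partial>S)"
  proof (rule integral_mono)
    fix \<omega>
    have "\<bar>\<Sum>p\<in>A. ?Z p \<omega>\<bar> = \<bar>(\<Sum>p\<in>A. ?Z p \<omega> - ?z p \<omega>) + (\<Sum>p\<in>A. ?z p \<omega>)\<bar>"
      by (simp add: sum_subtractf)
    also have "\<dots> \<le> (\<Sum>p\<in>A. \<bar>?Z p \<omega> - ?z p \<omega>\<bar>) + \<bar>\<Sum>p\<in>A. ?z p \<omega>\<bar>"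
      using sum_abs[of "\<lambda>p. ?Z p \<omega> - ?z p \<omega>" A] abs_triangle_ineq[of "\<Sum>p\<in>A. ?Z p \<omega> - ?z p \<omega>" "\<Sum>p\<in>A. ?z p \<omega>"]
      by linarith
    finally show "\<bar>\<Sum>p\<in>A. ?Z p \<omega>\<bar> \<le> (\<Sum>p\<in>A. \<bar>?Z p \<omega> - ?z p \<omega>\<bar>) + \<bar>\<Sum>p\<in>A. ?z p \<omega>\<bar>" .
  qed (use iz in auto)
  also have "\<dots> = (\<Sum>p\<in>A. \<integral>\<omega>. \<bar>?Z p \<omega> - ?z p \<omega>\<bar> \<partial>S) + (\<integral>\<omega>. \<bar>\<Sum>p\<in>A. ?z p \<omega>\<bar> \<partial>S)"
    using iz by simp
  also have "\<dots> \<le> (\<Sum>p\<in>A. near1 m) + sqrt (9 / 4 * N + 3 * kdev m * (N * (real m + real n)) + near2 (m - 1) * N\<^sup>2)"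
  proof (intro add_mono sum_mono)
    fix p assume "p \<in> A"
    then show "(\<integral>\<omega>. \<bar>?Z p \<omega> - ?z p \<omega>\<bar> \<partial>S) \<le> near1 m"
      using pair_kern_loo_expectation[of "{1..m}" "fst p" "snd p"] m by (auto simp: A_def)
  next
    have "integrable S (\<lambda>\<omega>. (\<Sum>p\<in>A. ?z p \<omega>)\<^sup>2)"
      using ne by (auto simp: power2_eq_square sum_product intro!: integrable_pair_kern_mult Bochner_Integration.integrable_sum)
    then have "(\<integral>\<omega>. \<bar>\<Sum>p\<in>A. ?z p \<omega>\<bar> \<partial>S) \<le> sqrt (\<integral>\<omega>. (\<Sum>p\<in>A. ?z p \<omega>)\<^sup>2 \<partial>S)"
      using iz by (intro expectation_abs_le_sqrt) auto
    also have "\<dots> \<le> sqrt (9 / 4 * N + 3 * kdev m * (N * (real m + real n)) + near2 (m - 1) * N\<^sup>2)"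
      unfolding A_def N_def using second_moment[OF m] by (intro real_sqrt_le_mono)
    finally show "(\<integral>\<omega>. \<bar>\<Sum>p\<in>A. ?z p \<omega>\<bar> \<partial>S) \<le> sqrt (9 / 4 * N + 3 * kdev m * (N * (real m + real n)) + near2 (m - 1) * N\<^sup>2)" .
  qed
  also have "9 / 4 * N + 3 * kdev m * (N * (real m + real n)) + near2 (m - 1) * N\<^sup>2
     = N\<^sup>2 * (9 / 4 / N + 3 * kdev m * (1 / real m + 1 / real n) + near2 (m - 1))"
    using N m n by (simp add: N_def field_simps power2_eq_square)
  also have "(\<Sum>p\<in>A. near1 m) + sqrt (N\<^sup>2 * (9 / 4 / N + 3 * kdev m * (1 / real m + 1 / real n) + near2 (m - 1)))
    = N * (near1 m + sqrt (9 / 4 / N + 3 * kdev m * (1 / real m + 1 / real n) + near2 (m - 1)))"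
  proof -
    have "sqrt (N\<^sup>2 * E) = N * sqrt E" for E using N by (simp add: real_sqrt_mult)
    then show ?thesis unfolding sum_constant N(2) by (simp only: distrib_left[of N "near1 m"])
  qed
  finally have "(\<integral>\<omega>. \<bar>\<Sum>p\<in>A. ?Z p \<omega>\<bar> \<partial>S) / N \<le> near1 m + sqrt (9 / 4 / N + 3 * kdev m * (1 / real m + 1 / real n) + near2 (m - 1))"
    using N by (simp add: field_simps)
  then show ?thesis
    unfolding LS using N by (simp add: N_def)
qed

text \<open>Multiplied by \<open>m\<close>, the terms under the root become
  \<open>9 / 4 / n\<close>, \<open>kdev\<close> times a bounded ratio, and
  \<open>m * near2 (m - 1)\<close>, all of which vanish.\<close>

lemma LS_linearization:
  fixes m n :: "nat \<Rightarrow> nat"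
  assumes m: "filterlim m at_top sequentially" and n: "filterlim n at_top sequentially"
    and \<tau>: "\<tau> < 1" "(\<lambda>k. real (m k) / (real (m k) + real (n k))) \<longlonglongrightarrow> \<tau>"
    and near1: "(\<lambda>m. sqrt (real m) * near1 m) \<longlonglongrightarrow> 0"
    and near2: "(\<lambda>m. real m * near2 m) \<longlonglongrightarrow> 0"
    and kdev: "kdev \<longlonglongrightarrow> 0"
  shows "(\<lambda>k. sqrt (real (m k) * real (n k) / (real (m k) + real (n k))) *
    (\<integral>\<omega>. \<bar>LS M D (m k) (\<lambda>i. XX i \<omega>) (n k) (\<lambda>j. YY j \<omega>) - 1 / 2 - linear_part (m k) (n k) \<omega>\<bar> \<partial>S)) \<longlonglongrightarrow> 0"
proof (rule tendsto_sandwich[where f="\<lambda>_. 0"])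
  let ?U = "\<lambda>k. sqrt (real (m k)) * near1 (m k) + sqrt (9 / 4 / real (n k)
     + 3 * kdev (m k) * (1 + real (m k) / real (n k)) + 2 * (real (m k - 1) * near2 (m k - 1)))"
  have ev: "\<forall>\<^sub>F k in sequentially. m0 < m k" "\<forall>\<^sub>F k in sequentially. 1 \<le> n k"
    using m n unfolding filterlim_at_top Suc_le_eq[symmetric] by blast+
  show "\<forall>\<^sub>F k in sequentially. sqrt (real (m k) * real (n k) / (real (m k) + real (n k))) *
    (\<integral>\<omega>. \<bar>LS M D (m k) (\<lambda>i. XX i \<omega>) (n k) (\<lambda>j. YY j \<omega>) - 1 / 2 - linear_part (m k) (n k) \<omega>\<bar> \<partial>S) \<le> ?U k"
    using ev
  proof eventually_elim
    case (elim k)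
    define a b where "a = real (m k)" "b = real (n k)"
    have ab: "1 \<le> a" "1 \<le> b" using elim by (auto simp: a_b_def)
    let ?E = "9 / 4 / (a * b) + 3 * kdev (m k) * (1 / a + 1 / b) + near2 (m k - 1)"
    have nn: "0 \<le> near2 (m k - 1)" "0 \<le> kdev (m k)" "0 \<le> near1 (m k)"
      by (auto intro: near1_nonneg near2_nonneg kdev_nonneg)
    have E: "0 \<le> ?E" using ab nn by simp
    have "a * ?E \<le> 9 / 4 / b + 3 * kdev (m k) * (1 + a / b) + 2 * (real (m k - 1) * near2 (m k - 1))"
    proof -
      \<comment> \<open>Absorbs the shift in \<open>near2 (m - 1)\<close>: the hypothesis on
        \<open>m * near2 m\<close> can then be used along \<open>m - 1\<close>.\<close>
      have "a \<le> 2 * real (m k - 1)" using elim(1) m0 by (simp add: a_b_def of_nat_diff)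
      then have "a * near2 (m k - 1) \<le> 2 * real (m k - 1) * near2 (m k - 1)"
        using nn by (intro mult_right_mono)
      then show ?thesis using ab by (simp add: field_simps)
    qed
    then have le: "sqrt a * sqrt ?E \<le> sqrt (9 / 4 / b + 3 * kdev (m k) * (1 + a / b) + 2 * (real (m k - 1) * near2 (m k - 1)))"
      unfolding real_sqrt_mult[symmetric] by (rule real_sqrt_le_mono)
    \<comment> \<open>This replaces the scale by \<open>sqrt m\<close>, the one in which the
      hypotheses on \<open>near1\<close> and \<open>near2\<close> are stated.\<close>
    have "a * b / (a + b) \<le> a" using ab by (simp add: field_simps)
    then have "sqrt (a * b / (a + b)) \<le> sqrt a" by (rule real_sqrt_le_mono)
    then have "sqrt (a * b / (a + b)) * (\<integral>\<omega>. \<bar>LS M D (m k) (\<lambda>i. XX i \<omega>) (n k) (\<lambda>j. YY j \<omega>) - 1 / 2 - linear_part (m k) (n k) \<omega>\<bar> \<partial>S)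
      \<le> sqrt a * (near1 (m k) + sqrt ?E)"
      using LS_linearization_bound[OF elim] ab unfolding a_b_def
      by (intro mult_mono) auto
    also have "\<dots> \<le> sqrt a * near1 (m k) + sqrt (9 / 4 / b + 3 * kdev (m k) * (1 + a / b) + 2 * (real (m k - 1) * near2 (m k - 1)))"
      using le by (simp add: distrib_left)
    finally show ?case by (simp only: a_b_def)
  qed
  have rn: "filterlim (\<lambda>k. real (n k)) at_top sequentially"
    using n filterlim_real_sequentially by (rule filterlim_compose[rotated])
  have m1: "filterlim (\<lambda>k. m k - 1) at_top sequentially"
    using m filterlim_minus_const_nat_at_top by (rule filterlim_compose[rotated])
  \<comment> \<open>With t the fraction of the first sample, the ratio of the sizes is
    \<open>t / (1 - t)\<close>, which converges because \<open>\<tau> < 1\<close>.\<close>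
  have ratio: "(\<lambda>k. real (m k) / real (n k)) \<longlonglongrightarrow> \<tau> / (1 - \<tau>)"
  proof (rule Lim_transform_eventually)
    show "(\<lambda>k. (real (m k) / (real (m k) + real (n k))) / (1 - real (m k) / (real (m k) + real (n k)))) \<longlonglongrightarrow> \<tau> / (1 - \<tau>)"
      using \<tau> by (intro tendsto_intros) auto
    show "\<forall>\<^sub>F k in sequentially. (real (m k) / (real (m k) + real (n k))) / (1 - real (m k) / (real (m k) + real (n k))) = real (m k) / real (n k)"
      using ev
    proof eventually_elim
      case (elim k)
      then have "1 - real (m k) / (real (m k) + real (n k)) = real (n k) / (real (m k) + real (n k))"
        by (simp add: field_simps)
      then show ?case using elim by simp
    qed
  qed
  have nk: "(\<lambda>k. 9 / 4 / real (n k)) \<longlonglongrightarrow> 0"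
    using filterlim_at_top_imp_at_infinity[OF rn] by (rule tendsto_divide_0[OF tendsto_const])
  note lims = tendsto_add[OF filterlim_compose[OF near1 m] tendsto_real_sqrt[OF tendsto_add[OF tendsto_add[OF nk
    tendsto_mult[OF tendsto_mult[OF tendsto_const[of 3] filterlim_compose[OF kdev m]] tendsto_add[OF tendsto_const[of 1] ratio]]]
    tendsto_mult[OF tendsto_const[of 2] filterlim_compose[OF near2 m1]]]]]
  then show "?U \<longlonglongrightarrow> 0" by simp
qed (auto intro!: always_eventually)

end

section \<open>Consequences of the assumptions\<close>

locale depth_sequence = depth_family S M P X D
  for S :: "'w measure" and M P :: "'a measure" and X :: "nat \<Rightarrow> 'w \<Rightarrow> 'a" and D
begin

text \<open>The supremum controls the depth change at the random point \<open>X l\<close> as at any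
  other; the almost sure bound is then moved to the product space.\<close>

lemma asm3_stable:
  assumes "asm3 S M D X"
  obtains c m0 where "0 < c" "2 \<le> m0"
    "\<And>m l. m0 \<le> m \<Longrightarrow> AE s in PiM UNIV (\<lambda>_. P). \<bar>D (s l) (emp M {} m s) - D (s l) (emp M {1} m s)\<bar> \<le> c / real m"
proof -
  obtain c m0 where m0: "2 \<le> m0" and c: "\<And>m. m0 \<le> m \<Longrightarrow> AE \<omega> in S.
    sup_dist M D (emp M {} m (\<lambda>i. X i \<omega>)) (emp M {1} m (\<lambda>i. X i \<omega>)) \<le> ennreal (c / real m)"
    using assms unfolding asm3_def by auto
  \<comment> \<open>\<open>\<bar>c\<bar> + 1\<close> is positive whatever the sign of the constant
    in Asm3, as the use of Asm4 requires.\<close>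
  have "AE s in PiM UNIV (\<lambda>_. P). \<bar>D (s l) (emp M {} m s) - D (s l) (emp M {1} m s)\<bar> \<le> (\<bar>c\<bar> + 1) / real m"
    if "m0 \<le> m" for m l
  proof -
    have "AE \<omega> in S. \<bar>D (X l \<omega>) (emp M {} m (\<lambda>i. X i \<omega>)) - D (X l \<omega>) (emp M {1} m (\<lambda>i. X i \<omega>))\<bar> \<le> (\<bar>c\<bar> + 1) / real m"
      using c[OF that] AE_space
    proof eventually_elim
      case (elim \<omega>)
      let ?d = "\<bar>D (X l \<omega>) (emp M {} m (\<lambda>i. X i \<omega>)) - D (X l \<omega>) (emp M {1} m (\<lambda>i. X i \<omega>))\<bar>"
      have "ennreal ?d \<le> sup_dist M D (emp M {} m (\<lambda>i. X i \<omega>)) (emp M {1} m (\<lambda>i. X i \<omega>))"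
        unfolding sup_dist_def by (rule SUP_upper) (rule V_space[OF elim(2)])
      also note elim(1)
      also have "ennreal (c / real m) \<le> ennreal ((\<bar>c\<bar> + 1) / real m)"
        by (intro ennreal_leI divide_right_mono) auto
      finally show ?case by (subst (asm) ennreal_le_iff) auto
    qed
    then show ?thesis
      using AE_process[OF stable_measurable[of m l "(\<bar>c\<bar> + 1) / real m"]] that m0 by simp
  qed
  then show thesis using m0 by (intro that[of "\<bar>c\<bar> + 1" m0]) auto
qed

text \<open>Conditioning on a block means freezing it and integrating the independent block. The
  result is measurable for the generated sigma-algebra and has the correct integrals over its sets
  by \<open>indep_var_decouple\<close>, which identifies the conditional expectation up to null
  sets.\<close>

lemma cond_prob_sample:
  assumes meas: "case_prod g \<in> borel_measurable (PiM A (\<lambda>_. M) \<Otimes>\<^sub>M PiM J (\<lambda>_. M))" and disj: "A \<inter> J = {}"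
    and g: "\<And>u w. g u w = of_bool (Q u w)"
  shows "AE \<omega> in S. cond_prob_given S (sigma_of S M X J) (\<lambda>\<omega>. Q (\<lambda>i\<in>A. X i \<omega>) (\<lambda>i\<in>J. X i \<omega>)) \<omega>
    = (\<integral>\<omega>'. g (\<lambda>i\<in>A. X i \<omega>') (\<lambda>i\<in>J. X i \<omega>) \<partial>S)"
proof -
  let ?W = "\<lambda>\<omega>. \<lambda>i\<in>J. X i \<omega>" and ?U = "\<lambda>\<omega>. \<lambda>i\<in>A. X i \<omega>" and ?F = "sigma_of S M X J"
  define q where "q w = (\<integral>\<omega>'. g (?U \<omega>') w \<partial>S)" for w
  have W[measurable]: "?W \<in> S \<rightarrow>\<^sub>M PiM J (\<lambda>_. M)" and U[measurable]: "?U \<in> S \<rightarrow>\<^sub>M PiM A (\<lambda>_. M)"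
    by measurable
  have W_space: "?W \<in> space S \<rightarrow> space (PiM J (\<lambda>_. M))"
    using measurable_space[OF W] by auto
  have WF: "?W \<in> ?F \<rightarrow>\<^sub>M PiM J (\<lambda>_. M)"
    unfolding sigma_of_def by (rule measurable_vimage_algebra1[OF W_space])
  have sub: "subalgebra S ?F"
    unfolding subalgebra_def sigma_of_def
    using W_space measurable_sets[OF W] by (auto simp: sets_vimage_algebra2)
  interpret F: finite_measure_subalgebra S ?F
    by unfold_locales (rule sub)
  have gm[measurable]: "(\<lambda>z. g (fst z) (snd z)) \<in> borel_measurable (PiM A (\<lambda>_. M) \<Otimes>\<^sub>M PiM J (\<lambda>_. M))"
    using meas by (simp add: split_beta')
  have q[measurable]: "q \<in> borel_measurable (PiM J (\<lambda>_. M))"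
  proof -
    have "(\<lambda>z. (\<lambda>i\<in>A. X i (snd z), fst z)) \<in> PiM J (\<lambda>_. M) \<Otimes>\<^sub>M S \<rightarrow>\<^sub>M PiM A (\<lambda>_. M) \<Otimes>\<^sub>M PiM J (\<lambda>_. M)"
      by measurable
    from measurable_compose[OF this gm] show ?thesis
      unfolding q_def by (intro borel_measurable_lebesgue_integral) (simp add: split_beta')
  qed
  have gb: "\<bar>g u w\<bar> \<le> 1" for u w by (simp add: g)
  have "\<bar>q w\<bar> \<le> 1" for w
  proof -
    have "\<bar>q w\<bar> \<le> (\<integral>\<omega>'. 1 \<partial>S)" unfolding q_def
      by (rule order_trans[OF integral_abs_bound], rule integral_mono_AE')
         (auto simp: gb)
    then show ?thesis by (simp add: prob_space)
  qed
  then have iq: "integrable S (\<lambda>\<omega>. q (?W \<omega>))"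
    by (intro integrable_const_bound[where B=1]) auto
  have ind: "indep_var (PiM A (\<lambda>_. M)) ?U (PiM J (\<lambda>_. M)) ?W"
    by (rule indep_blocks) fact
  let ?E = "{\<omega> \<in> space S. Q (?U \<omega>) (?W \<omega>)}"
  have Eg: "indicator ?E \<omega> = g (?U \<omega>) (?W \<omega>)" if "\<omega> \<in> space S" for \<omega>
    using that by (simp add: g indicator_def)
  have "(\<lambda>\<omega>. g (?U \<omega>) (?W \<omega>)) \<in> borel_measurable S"
    using measurable_compose[OF measurable_Pair[OF U W] gm] by simp
  then have Em[measurable]: "(indicator ?E :: 'w \<Rightarrow> real) \<in> borel_measurable S"
    by (rule measurable_cong[THEN iffD1, rotated]) (simp add: Eg)
  have "AE \<omega> in S. real_cond_exp S ?F (indicator ?E) \<omega> = q (?W \<omega>)"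
  proof (rule F.real_cond_exp_charact)
    show "integrable S (indicator ?E :: 'w \<Rightarrow> real)"
      by (rule integrable_const_bound[where B=1]) auto
    show "integrable S (\<lambda>\<omega>. q (?W \<omega>))" by (rule iq)
    show "(\<lambda>\<omega>. q (?W \<omega>)) \<in> borel_measurable ?F"
      using WF q by (rule measurable_compose)
    fix B assume "B \<in> sets ?F"
    then obtain B' where B': "B' \<in> sets (PiM J (\<lambda>_. M))" "B = ?W -` B' \<inter> space S"
      unfolding sigma_of_def sets_vimage_algebra2[OF W_space] by blast
    note [measurable] = B'(1)
    have B: "indicator B \<omega> = (indicator B' (?W \<omega>) :: real)" if "\<omega> \<in> space S" for \<omega>
      using that by (simp add: B'(2) indicator_def)
    let ?h = "\<lambda>(u, w). indicator B' w * g u w"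
    have hm: "?h \<in> borel_measurable (PiM A (\<lambda>_. M) \<Otimes>\<^sub>M PiM J (\<lambda>_. M))"
      unfolding split_beta' by measurable
    have hb: "\<bar>?h z\<bar> \<le> 1" for z
      using gb by (simp add: split_beta indicator_def)
    have "(\<integral>\<omega>\<in>B. indicator ?E \<omega> \<partial>S) = (\<integral>\<omega>. ?h (?U \<omega>, ?W \<omega>) \<partial>S)"
      unfolding set_lebesgue_integral_def
      by (rule Bochner_Integration.integral_cong) (simp_all add: B Eg)
    also have "\<dots> = (\<integral>\<omega>. (\<integral>\<omega>'. ?h (?U \<omega>', ?W \<omega>) \<partial>S) \<partial>S)"
      by (rule indep_var_decouple[OF ind hm hb])
    also have "\<dots> = (\<integral>\<omega>\<in>B. q (?W \<omega>) \<partial>S)"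
      unfolding set_lebesgue_integral_def q_def
      by (rule Bochner_Integration.integral_cong) (simp_all add: B)
    finally show "(\<integral>\<omega>\<in>B. indicator ?E \<omega> \<partial>S) = (\<integral>\<omega>\<in>B. q (?W \<omega>) \<partial>S)" .
  qed
  then show ?thesis unfolding cond_prob_given_def q_def .
qed

text \<open>Let q be the probability, given \<open>X 2, ..., X m\<close>, that a pair outside the
  sample is close. Two disjoint such pairs are conditionally independent, so both are close with
  probability \<open>E q^2\<close>, and one is close with probability \<open>E q\<close>, at most
  the root of \<open>E q^2\<close>.\<close>

lemma loo_near_moments:
  fixes c :: real
  assumes m: "2 \<le> m"
  defines "I \<equiv> (\<integral>\<omega>. (cond_prob_given S (sigma_of S M X {2..m})
      (\<lambda>\<omega>. \<bar>D (X 1 \<omega>) (emp M {1} m (\<lambda>i. X i \<omega>)) - D (X 0 \<omega>) (emp M {1} m (\<lambda>i. X i \<omega>))\<bar> \<le> 2 * c / real m) \<omega>)\<^sup>2 \<partial>S)"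
  shows "\<P>(s in PiM UNIV (\<lambda>_. P). loo_near M D c m s (s 0) (s 1) \<and> loo_near M D c m s (s (m + 1)) (s (m + 2))) = I" (is ?two)
    and "\<P>(s in PiM UNIV (\<lambda>_. P). loo_near M D c m s (s 0) (s 1)) \<le> sqrt I" (is ?one)
proof -
  let ?J = "{2..m}" and ?A = "{0, 1 :: nat}" and ?B = "{m + 1, m + 2}"
  let ?W = "\<lambda>\<omega>. \<lambda>i\<in>?J. X i \<omega>"
  have J: "{1..m} - {1} = ?J" by auto
  \<comment> \<open>The point \<open>y\<close> comes first to match the order \<open>X 1\<close>,
    \<open>X 0\<close> in Asm4.\<close>
  define near where "near x y w \<longleftrightarrow> \<bar>D y (empirical M ?J w) - D x (empirical M ?J w)\<bar> \<le> 2 * c / real m" for x y w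
  have cong: "near x y s = near x y (restrict s ?J)" for x y s
    unfolding near_def by (subst (1 2) empirical_cong[of ?J s "restrict s ?J"]) auto
  have loo: "loo_near M D c m s x y \<longleftrightarrow> near x y s" for s x y
    unfolding loo_near_def near_def emp_def J by (simp add: abs_minus_commute)
  have near_meas: "Measurable.pred N (\<lambda>z. near (f z) (h z) (\<lambda>i. w i z))"
    if [measurable]: "f \<in> N \<rightarrow>\<^sub>M M" "h \<in> N \<rightarrow>\<^sub>M M" and w: "\<And>i. i \<in> ?J \<Longrightarrow> w i \<in> N \<rightarrow>\<^sub>M M" for f h w and N :: "'z measure"
  proof -
    have [measurable]: "(\<lambda>z. D (f z) (empirical M ?J (\<lambda>i. w i z))) \<in> borel_measurable N"
      "(\<lambda>z. D (h z) (empirical M ?J (\<lambda>i. w i z))) \<in> borel_measurable N"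
      using m w by (auto intro!: depth_empirical_measurable)
    show ?thesis unfolding near_def by measurable
  qed
  define b where "b x y w = (of_bool (near x y w) :: real)" for x y w
  have b_meas: "(\<lambda>z. b (f z) (h z) (\<lambda>i. w i z)) \<in> borel_measurable N"
    if "f \<in> N \<rightarrow>\<^sub>M M" "h \<in> N \<rightarrow>\<^sub>M M" "\<And>i. i \<in> ?J \<Longrightarrow> w i \<in> N \<rightarrow>\<^sub>M M" for f h w and N :: "'z measure"
  proof -
    note [measurable] = near_meas[OF that]
    show ?thesis unfolding b_def by measurable
  qed
  have b_cong: "b x y (restrict s ?J) = b x y s" for x y s
    unfolding b_def using cong[of x y s] by simp
  have b01: "0 \<le> b x y w" "b x y w \<le> 1" for x y w by (auto simp: b_def)
  define q where "q w = (\<integral>\<omega>. b (X 0 \<omega>) (X 1 \<omega>) w \<partial>S)" for w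
  have q_cong: "q (restrict s ?J) = q s" for s by (simp add: q_def b_cong)
  have [measurable]: "q \<in> borel_measurable (PiM ?J (\<lambda>_. M))"
    unfolding q_def by (rule borel_measurable_lebesgue_integral) (auto simp: split_beta' intro!: b_meas)
  have q01: "0 \<le> q w" "q w \<le> 1" for w
  proof -
    show "0 \<le> q w" unfolding q_def by (intro integral_nonneg_AE) (auto simp: b01)
    have "q w \<le> (\<integral>\<omega>. 1 \<partial>S)"
      unfolding q_def using b01 by (intro integral_mono_AE') auto
    then show "q w \<le> 1" by (simp add: prob_space)
  qed
  have W[measurable]: "?W \<in> S \<rightarrow>\<^sub>M PiM ?J (\<lambda>_. M)" by measurable
  have "AE \<omega> in S. cond_prob_given S (sigma_of S M X ?J) (\<lambda>\<omega>. near ((\<lambda>i\<in>?A. X i \<omega>) 0) ((\<lambda>i\<in>?A. X i \<omega>) 1) (?W \<omega>)) \<omega>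
      = (\<integral>\<omega>'. b ((\<lambda>i\<in>?A. X i \<omega>') 0) ((\<lambda>i\<in>?A. X i \<omega>') 1) (?W \<omega>) \<partial>S)"
    by (rule cond_prob_sample[where g="\<lambda>u w. b (u 0) (u 1) w"]) (auto simp: split_beta' b_def[symmetric] intro!: b_meas)
  moreover have "near ((\<lambda>i\<in>?A. X i \<omega>) 0) ((\<lambda>i\<in>?A. X i \<omega>) 1) (?W \<omega>) \<longleftrightarrow>
    \<bar>D (X 1 \<omega>) (emp M {1} m (\<lambda>i. X i \<omega>)) - D (X 0 \<omega>) (emp M {1} m (\<lambda>i. X i \<omega>))\<bar> \<le> 2 * c / real m" for \<omega>
    using cong[of "X 0 \<omega>" "X 1 \<omega>" "\<lambda>i. X i \<omega>"] unfolding near_def emp_def J by simp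
  ultimately have cp: "AE \<omega> in S. cond_prob_given S (sigma_of S M X ?J)
      (\<lambda>\<omega>. \<bar>D (X 1 \<omega>) (emp M {1} m (\<lambda>i. X i \<omega>)) - D (X 0 \<omega>) (emp M {1} m (\<lambda>i. X i \<omega>))\<bar> \<le> 2 * c / real m) \<omega> = q (?W \<omega>)"
    by (simp add: q_def)
  have I: "I = (\<integral>\<omega>. (q (?W \<omega>))\<^sup>2 \<partial>S)"
    unfolding I_def
  proof (rule integral_cong_AE)
    show "AE \<omega> in S. (cond_prob_given S (sigma_of S M X {2..m})
      (\<lambda>\<omega>. \<bar>D (X 1 \<omega>) (emp M {1} m (\<lambda>i. X i \<omega>)) - D (X 0 \<omega>) (emp M {1} m (\<lambda>i. X i \<omega>))\<bar> \<le> 2 * c / real m) \<omega>)\<^sup>2 = (q (?W \<omega>))\<^sup>2"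
      using cp by eventually_elim simp
  qed (auto simp: cond_prob_given_def intro!: borel_measurable_power borel_measurable_cond_exp2)
  \<comment> \<open>Shifting all indices by \<open>m + 1\<close> carries the pair 0, 1 to
    \<open>m + 1\<close>, \<open>m + 2\<close> and keeps the law.\<close>
  have fresh: "(\<integral>\<omega>. b (X (m + 1) \<omega>) (X (m + 2) \<omega>) w \<partial>S) = q w" if w: "w \<in> space (PiM ?J (\<lambda>_. M))" for w
  proof -
    interpret R: iid_family S M P "\<lambda>l. X (l + (m + 1))" by (rule reindex) (simp add: inj_def)
    have wi: "w i \<in> space M" if "i \<in> ?J" for i using w that by (auto simp: space_PiM)
    have "(\<lambda>s. b (s 0) (s 1) w) \<in> borel_measurable (PiM (UNIV :: nat set) (\<lambda>_. M))"
      using wi by (intro b_meas) auto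
    from R.expectation_process[OF this] expectation_process[OF this] show ?thesis
      by (simp add: q_def)
  qed
  \<comment> \<open>\<open>K\<close> holds the reduced sample and the second pair. The pair 0, 1 is
    integrated out with \<open>K\<close> frozen, then the second pair with \<open>{2..m}\<close>
    frozen.\<close>
  define K where "K = {2..m + 2}"
  have mK: "m + 1 \<in> K" "m + 2 \<in> K" using m by (auto simp: K_def)
  have ind1: "indep_var (PiM ?A (\<lambda>_. M)) (\<lambda>\<omega>. \<lambda>i\<in>?A. X i \<omega>) (PiM K (\<lambda>_. M)) (\<lambda>\<omega>. \<lambda>i\<in>K. X i \<omega>)"
    by (rule indep_blocks) (auto simp: K_def)
  have ind2: "indep_var (PiM ?B (\<lambda>_. M)) (\<lambda>\<omega>. \<lambda>i\<in>?B. X i \<omega>) (PiM ?J (\<lambda>_. M)) ?W"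
    by (rule indep_blocks) auto
  have sub: "restrict (restrict s K) ?J = restrict s ?J" for s :: "nat \<Rightarrow> 'a"
    by (auto simp: restrict_def K_def)
  have b_sub: "b x y (restrict s K) = b x y s" for x y s
    using b_cong[of x y "restrict s K"] b_cong[of x y s] by (simp only: sub)
  let ?h1 = "\<lambda>(u, v). b (u 0) (u 1) v * b (v (m + 1)) (v (m + 2)) v"
  have h1: "?h1 \<in> borel_measurable (PiM ?A (\<lambda>_. M) \<Otimes>\<^sub>M PiM K (\<lambda>_. M))"
    unfolding split_beta' using mK by (intro borel_measurable_times b_meas) (auto simp: K_def)
  have h1b: "\<bar>?h1 z\<bar> \<le> 1" for z using b01 by (simp add: split_beta abs_mult mult_le_one)
  have e1: "(\<integral>\<omega>. b (X 0 \<omega>) (X 1 \<omega>) (\<lambda>i. X i \<omega>) * b (X (m + 1) \<omega>) (X (m + 2) \<omega>) (\<lambda>i. X i \<omega>) \<partial>S)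
     = (\<integral>\<omega>. q (?W \<omega>) * b (X (m + 1) \<omega>) (X (m + 2) \<omega>) (?W \<omega>) \<partial>S)"
    using indep_var_decouple[OF ind1 h1 h1b] mK by (simp add: b_sub b_cong q_def)
  let ?h2 = "\<lambda>(v, w). q w * b (v (m + 1)) (v (m + 2)) w"
  have h2: "?h2 \<in> borel_measurable (PiM ?B (\<lambda>_. M) \<Otimes>\<^sub>M PiM ?J (\<lambda>_. M))"
    unfolding split_beta' by (intro borel_measurable_times b_meas) auto
  have h2b: "\<bar>?h2 z\<bar> \<le> 1" for z using b01 q01 by (simp add: split_beta abs_mult mult_le_one)
  have e2: "(\<integral>\<omega>. q (?W \<omega>) * b (X (m + 1) \<omega>) (X (m + 2) \<omega>) (?W \<omega>) \<partial>S) = I"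
  proof -
    have "(\<integral>\<omega>. q (?W \<omega>) * b (X (m + 1) \<omega>) (X (m + 2) \<omega>) (?W \<omega>) \<partial>S)
      = (\<integral>\<omega>. q (?W \<omega>) * (\<integral>\<omega>'. b (X (m + 1) \<omega>') (X (m + 2) \<omega>') (?W \<omega>) \<partial>S) \<partial>S)"
      using indep_var_decouple[OF ind2 h2 h2b] by simp
    also have "\<dots> = I"
      unfolding I power2_eq_square using fresh[OF measurable_space[OF W]]
      by (intro Bochner_Integration.integral_cong) simp_all
    finally show ?thesis .
  qed
  note [measurable] = loo_near_measurable[OF m]
  have n1: "Measurable.pred S (\<lambda>\<omega>. near (X i \<omega>) (X j \<omega>) (\<lambda>i. X i \<omega>))" for i j
    by (rule near_meas) auto
  note [measurable] = n1
  have "\<P>(s in PiM UNIV (\<lambda>_. P). loo_near M D c m s (s 0) (s 1) \<and> loo_near M D c m s (s (m + 1)) (s (m + 2)))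
    = \<P>(\<omega> in S. loo_near M D c m (\<lambda>i. X i \<omega>) (X 0 \<omega>) (X 1 \<omega>) \<and> loo_near M D c m (\<lambda>i. X i \<omega>) (X (m + 1) \<omega>) (X (m + 2) \<omega>))"
    by (rule prob_process[symmetric]) measurable
  also have "\<dots> = (\<integral>\<omega>. b (X 0 \<omega>) (X 1 \<omega>) (\<lambda>i. X i \<omega>) * b (X (m + 1) \<omega>) (X (m + 2) \<omega>) (\<lambda>i. X i \<omega>) \<partial>S)"
    unfolding loo b_def of_bool_conj[symmetric] by (rule prob_eq_expectation_of_bool) measurable
  finally show ?two using e1 e2 by simp
  let ?h3 = "\<lambda>(u, w). b (u 0) (u 1) w"
  have h3: "?h3 \<in> borel_measurable (PiM ?A (\<lambda>_. M) \<Otimes>\<^sub>M PiM ?J (\<lambda>_. M))"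
    unfolding split_beta' by (intro b_meas) auto
  have h3b: "\<bar>?h3 z\<bar> \<le> 1" for z using b01 by (simp add: split_beta)
  have ind3: "indep_var (PiM ?A (\<lambda>_. M)) (\<lambda>\<omega>. \<lambda>i\<in>?A. X i \<omega>) (PiM ?J (\<lambda>_. M)) ?W"
    by (rule indep_blocks) auto
  have "\<P>(s in PiM UNIV (\<lambda>_. P). loo_near M D c m s (s 0) (s 1)) = \<P>(\<omega> in S. loo_near M D c m (\<lambda>i. X i \<omega>) (X 0 \<omega>) (X 1 \<omega>))"
    by (rule prob_process[symmetric]) measurable
  also have "\<dots> = (\<integral>\<omega>. b (X 0 \<omega>) (X 1 \<omega>) (\<lambda>i. X i \<omega>) \<partial>S)"
    unfolding loo b_def by (rule prob_eq_expectation_of_bool) measurable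
  also have "\<dots> = (\<integral>\<omega>. q (?W \<omega>) \<partial>S)"
    using indep_var_decouple[OF ind3 h3 h3b] by (simp add: b_cong q_def)
  also have "\<dots> = (\<integral>\<omega>. \<bar>q (?W \<omega>)\<bar> \<partial>S)" using q01 by simp
  also have "\<dots> \<le> sqrt (\<integral>\<omega>. (q (?W \<omega>))\<^sup>2 \<partial>S)"
    using q01 by (intro expectation_abs_le_sqrt integrable_const_bound[where B=1]) (auto simp: power_le_one)
  finally show ?one unfolding I .
qed

text \<open>Asm4 is used with the constant \<open>2 * c\<close>. As \<open>1 / 2 < \<beta>\<close>,
  the decay \<open>m powr (- 2 * \<beta>)\<close> beats the factor \<open>m\<close>; the bound for a
  single pair is the square root of that for two.\<close>

lemma asm4_near:
  assumes a4: "asm4 S M D X \<beta>" and \<beta>: "1 / 2 < \<beta>" and c: "0 < c"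
  shows "(\<lambda>m. real m * \<P>(s in PiM UNIV (\<lambda>_. P).
      loo_near M D c m s (s 0) (s 1) \<and> loo_near M D c m s (s (m + 1)) (s (m + 2)))) \<longlonglongrightarrow> 0" (is "?f2 \<longlonglongrightarrow> 0")
    and "(\<lambda>m. sqrt (real m) * \<P>(s in PiM UNIV (\<lambda>_. P). loo_near M D c m s (s 0) (s 1))) \<longlonglongrightarrow> 0" (is "?f1 \<longlonglongrightarrow> 0")
proof -
  define I where "I m = (\<integral>\<omega>. (cond_prob_given S (sigma_of S M X {2..m})
      (\<lambda>\<omega>. \<bar>D (X 1 \<omega>) (emp M {1} m (\<lambda>i. X i \<omega>)) - D (X 0 \<omega>) (emp M {1} m (\<lambda>i. X i \<omega>))\<bar> \<le> 2 * c / real m) \<omega>)\<^sup>2 \<partial>S)" for m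
  have "I \<in> O(\<lambda>m. real m powr (- 2 * \<beta>))"
    using a4 c unfolding asm4_def I_def by simp
  then obtain K where K: "\<forall>\<^sub>F m in sequentially. norm (I m) \<le> K * norm (real m powr (- 2 * \<beta>))"
    by (rule landau_o.bigE)
  have I0: "0 \<le> I m" for m unfolding I_def by (rule integral_nonneg_AE) simp
  have mI: "(\<lambda>m. real m * I m) \<longlonglongrightarrow> 0"
  proof (rule tendsto_sandwich[where f="\<lambda>_. 0" and h="\<lambda>m. K * real m powr (1 - 2 * \<beta>)"])
    show "\<forall>\<^sub>F m in sequentially. real m * I m \<le> K * real m powr (1 - 2 * \<beta>)"
      using K eventually_gt_at_top[of 0]
    proof eventually_elim
      case (elim m)
      then have "real m * I m \<le> real m * (K * real m powr (- 2 * \<beta>))"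
        using I0[of m] by (intro mult_left_mono) auto
      also have "\<dots> = K * (real m powr 1 * real m powr (- 2 * \<beta>))"
        using elim by simp
      also have "\<dots> = K * real m powr (1 - 2 * \<beta>)"
        unfolding powr_add[symmetric] by simp
      finally show ?case .
    qed
    have "(\<lambda>m. real m powr (1 - 2 * \<beta>)) \<longlonglongrightarrow> 0"
      using \<beta> by (intro tendsto_neg_powr filterlim_real_sequentially) auto
    then show "(\<lambda>m. K * real m powr (1 - 2 * \<beta>)) \<longlonglongrightarrow> 0"
      by (rule tendsto_mult_right_zero)
  qed (auto simp: I0)
  show "?f2 \<longlonglongrightarrow> 0"
  proof (rule Lim_transform_eventually[OF mI])
    show "\<forall>\<^sub>F m in sequentially. real m * I m = ?f2 m"
      using eventually_ge_at_top[of 2] by eventually_elim (simp only: loo_near_moments(1) I_def)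
  qed
  show "?f1 \<longlonglongrightarrow> 0"
  proof (rule tendsto_sandwich[where f="\<lambda>_. 0" and h="\<lambda>m. sqrt (real m * I m)"])
    show "\<forall>\<^sub>F m in sequentially. ?f1 m \<le> sqrt (real m * I m)"
      using eventually_ge_at_top[of 2]
    proof eventually_elim
      case (elim m)
      show ?case
        unfolding real_sqrt_mult using loo_near_moments(2)[OF elim, of c, folded I_def]
        by (rule mult_left_mono) simp
    qed
    show "(\<lambda>m. sqrt (real m * I m)) \<longlonglongrightarrow> 0"
      using tendsto_real_sqrt[OF mI] by simp
  qed auto
qed

lemma prob_decouple:
  assumes Q[measurable]: "Measurable.pred (M \<Otimes>\<^sub>M M) (\<lambda>(x, y). Q x y)"
    and bound: "\<And>\<omega>. \<omega> \<in> space S \<Longrightarrow> \<P>(\<omega>' in S. Q (X 0 \<omega>') (X 1 \<omega>)) \<le> B"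
  shows "\<P>(\<omega> in S. Q (X 0 \<omega>) (X 1 \<omega>)) \<le> B"
proof -
  have ind: "indep_var (PiM {0} (\<lambda>_. M)) (\<lambda>\<omega>. \<lambda>i\<in>{0}. X i \<omega>) (PiM {1} (\<lambda>_. M)) (\<lambda>\<omega>. \<lambda>i\<in>{1}. X i \<omega>)"
    by (rule indep_blocks) auto
  let ?g = "\<lambda>(u, w). of_bool (Q (u 0) (w 1)) :: real"
  have Q': "Measurable.pred N (\<lambda>z. Q (f z) (h z))" if "f \<in> N \<rightarrow>\<^sub>M M" "h \<in> N \<rightarrow>\<^sub>M M" for f h and N :: "'z measure"
    using measurable_compose[OF measurable_Pair[OF that] Q] by simp
  have "Measurable.pred (PiM {0} (\<lambda>_. M) \<Otimes>\<^sub>M PiM {1} (\<lambda>_. M)) (\<lambda>z. Q (fst z (0::nat)) (snd z (1::nat)))"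
    by (rule Q') auto
  then have g: "?g \<in> borel_measurable (PiM {0} (\<lambda>_. M) \<Otimes>\<^sub>M PiM {1} (\<lambda>_. M))"
    unfolding split_beta' by measurable
  have gb: "\<bar>?g z\<bar> \<le> 1" for z by (simp add: split_beta)
  have "\<P>(\<omega> in S. Q (X 0 \<omega>) (X 1 \<omega>)) = (\<integral>\<omega>. of_bool (Q (X 0 \<omega>) (X 1 \<omega>)) \<partial>S)"
    by (rule prob_eq_expectation_of_bool, rule Q') auto
  also have "\<dots> = (\<integral>\<omega>. (\<integral>\<omega>'. of_bool (Q (X 0 \<omega>') (X 1 \<omega>)) \<partial>S) \<partial>S)"
    using indep_var_decouple[OF ind g gb] by simp
  also have "\<dots> = (\<integral>\<omega>. \<P>(\<omega>' in S. Q (X 0 \<omega>') (X 1 \<omega>)) \<partial>S)"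
    by (intro Bochner_Integration.integral_cong refl prob_eq_expectation_of_bool[symmetric] Q') (auto intro: V_space)
  \<comment> \<open>With a nonnegative majorant the inner probability need not be shown integrable;
    \<open>0 \<le> B\<close> is recovered afterwards from any point of the space.\<close>
  also have "\<dots> \<le> (\<integral>\<omega>. max B 0 \<partial>S)"
    using bound by (intro integral_mono_AE') (auto simp: le_max_iff_disj)
  finally have "\<P>(\<omega> in S. Q (X 0 \<omega>) (X 1 \<omega>)) \<le> max B 0" by (simp add: prob_space)
  moreover have "0 \<le> B"
  proof -
    obtain \<omega> where "\<omega> \<in> space S" using not_empty by auto
    from bound[OF this] show ?thesis by (rule order_trans[OF measure_nonneg])
  qed
  ultimately show ?thesis by simp
qed

text \<open>With \<open>X 1\<close> frozen at depth t, closeness confines the depth of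
  \<open>X 0\<close> to an interval of length at most \<open>2 * e\<close>, to which Asm1 applies
  uniformly in t.\<close>

lemma asm1_pair:
  assumes a1: "asm1 S D P X \<beta>" and D0: "depth_function M D" and \<beta>: "0 < \<beta>"
  obtains C where "0 < C"
    "\<And>e. 0 \<le> e \<Longrightarrow> \<P>(\<omega> in S. \<bar>D (X 0 \<omega>) P - D (X 1 \<omega>) P\<bar> \<le> e) \<le> C * (2 * e) powr \<beta>"
proof -
  obtain C where C: "0 < C" "\<And>y1 y2. 0 \<le> y1 \<Longrightarrow> 0 \<le> y2 \<Longrightarrow>
      prob {\<omega>\<in>space S. D (X 0 \<omega>) P \<in> {y1..y2}} \<le> C * \<bar>y2 - y1\<bar> powr \<beta>"
    using a1 unfolding asm1_def by auto
  have D0: "0 \<le> D x P" if "x \<in> space M" for x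
    using D0 P that unfolding depth_function_def by blast
  show thesis
  proof (rule that[OF C(1)])
    fix e :: real assume e: "0 \<le> e"
    show "\<P>(\<omega> in S. \<bar>D (X 0 \<omega>) P - D (X 1 \<omega>) P\<bar> \<le> e) \<le> C * (2 * e) powr \<beta>"
    proof (rule prob_decouple)
      show "Measurable.pred (M \<Otimes>\<^sub>M M) (\<lambda>(x, y). \<bar>D x P - D y P\<bar> \<le> e)" by measurable
      fix \<omega> assume \<omega>: "\<omega> \<in> space S"
      define t where "t = D (X 1 \<omega>) P"
      have t: "0 \<le> t" using D0 V_space[OF \<omega>] by (simp add: t_def)
      \<comment> \<open>Asm1 asks for nonnegative endpoints; cutting the interval at 0 loses nothing
        since depths are nonnegative.\<close>
      have "\<P>(\<omega>' in S. \<bar>D (X 0 \<omega>') P - t\<bar> \<le> e) \<le> prob {\<omega>'\<in>space S. D (X 0 \<omega>') P \<in> {max 0 (t - e)..t + e}}"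
        using D0 V_space by (intro finite_measure_mono) (auto simp: abs_le_iff)
      also have "\<dots> \<le> C * \<bar>(t + e) - max 0 (t - e)\<bar> powr \<beta>"
        using t e by (intro C) auto
      also have "\<dots> \<le> C * (2 * e) powr \<beta>"
        using C(1) \<beta> t e by (intro mult_left_mono powr_mono2) auto
      finally show "\<P>(\<omega>' in S. \<bar>D (X 0 \<omega>') P - D (X 1 \<omega>) P\<bar> \<le> e) \<le> C * (2 * e) powr \<beta>"
        by (simp add: t_def)
    qed
  qed
qed

text \<open>Markov's inequality for the power \<open>2 * \<beta>\<close> of the uniform deviation,
  which dominates the deviation at the random point \<open>X 0\<close>.\<close>

lemma asm2_consistent:
  assumes a2: "asm2 S M D P X \<beta>" and \<beta>: "0 < \<beta>" and \<epsilon>: "0 < \<epsilon>"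
  shows "(\<lambda>m. \<P>(\<omega> in S. \<epsilon> < \<bar>D (X 0 \<omega>) (emp M {} m (\<lambda>i. X i \<omega>)) - D (X 0 \<omega>) P\<bar>)) \<longlonglongrightarrow> 0" (is "?f \<longlonglongrightarrow> 0")
proof -
  obtain K where K: "0 < K" "\<forall>\<^sub>F m in sequentially.
        (\<integral>\<^sup>+ \<omega>. epowr (sup_dist M D (emp M {} m (\<lambda>i. X i \<omega>)) P) (2 * \<beta>) \<partial>S) \<le> ennreal (K * real m powr (- \<beta>))"
    using a2 unfolding asm2_def by auto
  define a where "a = \<epsilon> powr (2 * \<beta>)"
  have a: "0 < a" using \<epsilon> by (simp add: a_def)
  show ?thesis
  proof (rule tendsto_sandwich[where f="\<lambda>_. 0" and h="\<lambda>m. K / a * real m powr (- \<beta>)"])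
    show "\<forall>\<^sub>F m in sequentially. ?f m \<le> K / a * real m powr (- \<beta>)"
      using K(2) eventually_ge_at_top[of 1]
    proof eventually_elim
      case (elim m)
      define E where "E = {\<omega>\<in>space S. \<epsilon> < \<bar>D (X 0 \<omega>) (emp M {} m (\<lambda>i. X i \<omega>)) - D (X 0 \<omega>) P\<bar>}"
      have [measurable]: "(\<lambda>\<omega>. D (X 0 \<omega>) (emp M {} m (\<lambda>i. X i \<omega>))) \<in> borel_measurable S"
        unfolding emp_empty using elim(2) by (intro depth_empirical_measurable) auto
      have E[measurable]: "E \<in> sets S" unfolding E_def by measurable
      have "ennreal (a * prob E) = (\<integral>\<^sup>+ \<omega>. ennreal a * indicator E \<omega> \<partial>S)"
        using a by (simp add: nn_integral_cmult_indicator emeasure_eq_measure ennreal_mult)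
      also have "\<dots> \<le> (\<integral>\<^sup>+ \<omega>. epowr (sup_dist M D (emp M {} m (\<lambda>i. X i \<omega>)) P) (2 * \<beta>) \<partial>S)"
      proof (rule nn_integral_mono)
        fix \<omega> assume \<omega>: "\<omega> \<in> space S"
        let ?s = "sup_dist M D (emp M {} m (\<lambda>i. X i \<omega>)) P" and ?d = "\<bar>D (X 0 \<omega>) (emp M {} m (\<lambda>i. X i \<omega>)) - D (X 0 \<omega>) P\<bar>"
        have s: "ennreal ?d \<le> ?s"
          unfolding sup_dist_def by (rule SUP_upper) (rule V_space[OF \<omega>])
        show "ennreal a * indicator E \<omega> \<le> epowr ?s (2 * \<beta>)"
        \<comment> \<open>An infinite uniform deviation has infinite \<open>epowr\<close>, which
          makes the bound trivial.\<close>
        proof (cases "\<omega> \<in> E \<and> ?s \<noteq> \<infinity>")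
          case True
          then have d: "\<epsilon> < ?d" by (simp add: E_def)
          have "?d \<le> enn2real ?s"
            using s True by (metis abs_ge_zero enn2real_ennreal enn2real_mono infinity_ennreal_def top.not_eq_extremum)
          then have "a \<le> enn2real ?s powr (2 * \<beta>)"
            unfolding a_def using d \<epsilon> \<beta> by (intro powr_mono2) auto
          then show ?thesis using True by (simp add: epowr_def ennreal_leI)
        qed (auto simp: epowr_def indicator_def)
      qed
      also note elim(1)
      finally have "a * prob E \<le> K * real m powr (- \<beta>)"
        using K(1) by (subst (asm) ennreal_le_iff) auto
      then show ?case using a by (simp add: E_def[symmetric] field_simps)
    qed
    have "(\<lambda>m. real m powr (- \<beta>)) \<longlonglongrightarrow> 0"
      using \<beta> by (intro tendsto_neg_powr filterlim_real_sequentially) auto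
    then show "(\<lambda>m. K / a * real m powr (- \<beta>)) \<longlonglongrightarrow> 0"
      by (rule tendsto_mult_right_zero)
  qed auto
qed

text \<open>The kernels at the reduced sample and at P differ only if the depths at P nearly tie,
  which Asm1 makes unlikely, or if one of the depths has moved by more than
  \<open>\<epsilon>\<close>, which Asm2 makes unlikely.\<close>

lemma kern_deviation:
  assumes a1: "asm1 S D P X \<beta>" and a2: "asm2 S M D P X \<beta>" and D0: "depth_function M D" and \<beta>: "0 < \<beta>"
  shows "(\<lambda>m. \<integral>s. \<bar>kern D P (emp M {1} m s) (s 0) (s 1) - kern D P P (s 0) (s 1)\<bar> \<partial>PiM UNIV (\<lambda>_. P)) \<longlonglongrightarrow> 0"
    (is "?k \<longlonglongrightarrow> 0")
proof (rule LIMSEQ_I)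
  fix r :: real assume r: "0 < r"
  obtain C where C: "0 < C" "\<And>e. 0 \<le> e \<Longrightarrow> \<P>(\<omega> in S. \<bar>D (X 0 \<omega>) P - D (X 1 \<omega>) P\<bar> \<le> e) \<le> C * (2 * e) powr \<beta>"
    using asm1_pair[OF a1 D0 \<beta>] by blast
  \<comment> \<open>Solves \<open>C * (4 * \<epsilon>) powr \<beta> = r / 2\<close>: a near tie has
    radius \<open>2 * \<epsilon>\<close>, which the bound for pairs doubles again.\<close>
  define \<epsilon> where "\<epsilon> = (r / (2 * C)) powr (1 / \<beta>) / 4"
  have \<epsilon>: "0 < \<epsilon>" "C * (2 * (2 * \<epsilon>)) powr \<beta> = r / 2"
    using r C(1) \<beta> by (auto simp: \<epsilon>_def powr_powr)
  define bad where "bad m = \<P>(\<omega> in S. \<epsilon> < \<bar>D (X 0 \<omega>) (emp M {} m (\<lambda>i. X i \<omega>)) - D (X 0 \<omega>) P\<bar>)" for m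
  have "bad \<longlonglongrightarrow> 0" unfolding bad_def by (rule asm2_consistent[OF a2 \<beta> \<epsilon>(1)])
  from LIMSEQ_D[OF this, of "r / 4"] r obtain N where N: "\<And>m. N \<le> m \<Longrightarrow> bad m < r / 4"
    by (auto simp: bad_def)
  have "norm (?k m - 0) < r" if m: "N + 2 \<le> m" for m
  proof -
    have J: "{1..m} - {1} = {2..m}" "{2..m} \<noteq> {}" using m by auto
    let ?\<mu> = "\<lambda>\<omega>. empirical M {2..m} (\<lambda>i. X i \<omega>)"
    let ?bad = "\<lambda>a \<omega>. \<epsilon> < \<bar>D (X a \<omega>) (?\<mu> \<omega>) - D (X a \<omega>) P\<bar>"
    let ?near = "\<lambda>\<omega>. \<bar>D (X 0 \<omega>) P - D (X 1 \<omega>) P\<bar> \<le> 2 * \<epsilon>"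
    have [measurable]: "(\<lambda>\<omega>. D (X a \<omega>) (?\<mu> \<omega>)) \<in> borel_measurable S" for a
      using J(2) by (intro depth_empirical_measurable) auto
    have bad_eq: "\<P>(\<omega> in S. ?bad a \<omega>) = bad (m - 1)" if a: "a \<in> {0, 1}" for a
    proof -
      \<comment> \<open>Index 0 goes to the point of evaluation \<open>a\<close> and
        \<open>{1..m - 1}\<close> to \<open>{2..m}\<close>, so the reduced sample counts as a full
        sample of size \<open>m - 1\<close>.\<close>
      define g where "g l = (if l = 0 then a else Suc l)" for l
      interpret R: iid_family S M P "\<lambda>l. X (g l)"
        using a by (intro reindex) (auto simp: inj_def g_def)
      have "bij_betw g {1..m - 1} {2..m}"
        using m by (intro bij_betwI[where g="\<lambda>l. l - 1"]) (auto simp: g_def)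
      then have e: "?\<mu> \<omega> = emp M {} (m - 1) (\<lambda>l. X (g l) \<omega>)" for \<omega>
        unfolding emp_empty by (intro empirical_reindex) auto
      have "{1..m - 1} - {} \<noteq> {}" using m by auto
      note [measurable] = depth_emp_seq_measurable[OF this]
      have Q: "Measurable.pred (PiM UNIV (\<lambda>_. M)) (\<lambda>s. \<epsilon> < \<bar>D (s 0) (emp M {} (m - 1) s) - D (s 0) P\<bar>)"
        by measurable
      have "g 0 = a" by (simp add: g_def)
      then show ?thesis
        unfolding bad_def e using R.prob_process[OF Q] prob_process[OF Q] by simp
    qed
    have [measurable]: "(\<lambda>s. kern D P (emp M {1} m s) (s 0) (s 1)) \<in> borel_measurable (PiM (UNIV :: nat set) (\<lambda>_. M))"
      unfolding emp_def J(1) using J(2) by (intro kern_empirical_measurable) auto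
    have [measurable]: "(\<lambda>\<omega>. kern D P (?\<mu> \<omega>) (X 0 \<omega>) (X 1 \<omega>)) \<in> borel_measurable S"
      using J(2) by (intro kern_empirical_measurable) auto
    have "?k m = (\<integral>\<omega>. \<bar>kern D P (emp M {1} m (\<lambda>i. X i \<omega>)) (X 0 \<omega>) (X 1 \<omega>) - kern D P P (X 0 \<omega>) (X 1 \<omega>)\<bar> \<partial>S)"
      by (rule expectation_process[symmetric]) measurable
    also have "\<dots> = (\<integral>\<omega>. \<bar>kern D P (?\<mu> \<omega>) (X 0 \<omega>) (X 1 \<omega>) - kern D P P (X 0 \<omega>) (X 1 \<omega>)\<bar> \<partial>S)"
      unfolding emp_def J(1) ..
    also have "\<dots> \<le> \<P>(\<omega> in S. ?near \<omega> \<or> ?bad 0 \<omega> \<or> ?bad 1 \<omega>)"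
    proof (rule expectation_le_prob)
      show "(\<lambda>\<omega>. \<bar>kern D P (?\<mu> \<omega>) (X 0 \<omega>) (X 1 \<omega>) - kern D P P (X 0 \<omega>) (X 1 \<omega>)\<bar>) \<in> borel_measurable S"
        by measurable
      show "Measurable.pred S (\<lambda>\<omega>. ?near \<omega> \<or> ?bad 0 \<omega> \<or> ?bad 1 \<omega>)"
        by measurable
      show "AE \<omega> in S. \<bar>kern D P (?\<mu> \<omega>) (X 0 \<omega>) (X 1 \<omega>) - kern D P P (X 0 \<omega>) (X 1 \<omega>)\<bar>
        \<le> of_bool (?near \<omega> \<or> ?bad 0 \<omega> \<or> ?bad 1 \<omega>)"
      proof (rule AE_I2)
        fix \<omega>
        have "\<bar>kern D P (?\<mu> \<omega>) (X 0 \<omega>) (X 1 \<omega>) - kern D P P (X 0 \<omega>) (X 1 \<omega>)\<bar> \<le> 1"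
          using cmp_bounds[of "D (X 0 \<omega>) (?\<mu> \<omega>)" "D (X 1 \<omega>) (?\<mu> \<omega>)"] cmp_bounds[of "D (X 0 \<omega>) P" "D (X 1 \<omega>) P"]
          unfolding kern_def by linarith
        then show "\<bar>kern D P (?\<mu> \<omega>) (X 0 \<omega>) (X 1 \<omega>) - kern D P P (X 0 \<omega>) (X 1 \<omega>)\<bar>
          \<le> of_bool (?near \<omega> \<or> ?bad 0 \<omega> \<or> ?bad 1 \<omega>)"
          using kern_diff_le[of D "X 0 \<omega>" "?\<mu> \<omega>" P \<epsilon> "X 1 \<omega>" P]
          by (cases "?near \<omega> \<or> ?bad 0 \<omega> \<or> ?bad 1 \<omega>") auto
      qed
    qed auto
    also have "\<dots> = prob ({\<omega>\<in>space S. ?near \<omega>} \<union> ({\<omega>\<in>space S. ?bad 0 \<omega>} \<union> {\<omega>\<in>space S. ?bad 1 \<omega>}))"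
      by (rule arg_cong[where f=prob]) auto
    also have "\<dots> \<le> \<P>(\<omega> in S. ?near \<omega>) + (\<P>(\<omega> in S. ?bad 0 \<omega>) + \<P>(\<omega> in S. ?bad 1 \<omega>))"
      by (intro order_trans[OF measure_Un_le] add_left_mono measure_Un_le) auto
    also have "\<dots> \<le> r / 2 + (bad (m - 1) + bad (m - 1))"
      using C(2)[of "2 * \<epsilon>"] \<epsilon> bad_eq[of 0] bad_eq[of 1] by simp
    also have "\<dots> < r"
    proof -
      have "N \<le> m - 1" using m by simp
      from N[OF this] show ?thesis by simp
    qed
    finally show ?thesis by (simp add: integral_nonneg_AE)
  qed
  then show "\<exists>N. \<forall>m\<ge>N. norm (?k m - 0) < r" by blast
qed

text \<open>Given \<open>X i\<close>, the two comparisons are independent with common mean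
  \<open>mid_cdf D P (X i)\<close>.\<close>

lemma expectation_cmp_cmp:
  assumes "i \<noteq> j" "i \<noteq> k" "j \<noteq> k"
  shows "(\<integral>\<omega>. cmp (D (X j \<omega>) P) (D (X i \<omega>) P) * cmp (D (X k \<omega>) P) (D (X i \<omega>) P) \<partial>S) = (\<integral>x. (mid_cdf D P x)\<^sup>2 \<partial>P)"
proof -
  have G: "(\<integral>\<omega>. cmp (D (X l \<omega>) P) (D x P) \<partial>S) = mid_cdf D P x" for l x
    unfolding mid_cdf_def by (rule expectation_V) measurable
  have abs_mid: "\<bar>mid_cdf D P x\<bar> \<le> 1" for x
    using mid_cdf_bounds[of x] by simp
  have ind1: "indep_var (PiM {j} (\<lambda>_. M)) (\<lambda>\<omega>. \<lambda>i\<in>{j}. X i \<omega>) (PiM {i, k} (\<lambda>_. M)) (\<lambda>\<omega>. \<lambda>i\<in>{i, k}. X i \<omega>)"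
    using assms by (intro indep_blocks) auto
  have ind2: "indep_var (PiM {k} (\<lambda>_. M)) (\<lambda>\<omega>. \<lambda>i\<in>{k}. X i \<omega>) (PiM {i} (\<lambda>_. M)) (\<lambda>\<omega>. \<lambda>i\<in>{i}. X i \<omega>)"
    using assms by (intro indep_blocks) auto
  let ?g1 = "\<lambda>(u, w). cmp (D (u j) P) (D (w i) P) * cmp (D (w k) P) (D (w i) P)"
  have g1: "?g1 \<in> borel_measurable (PiM {j} (\<lambda>_. M) \<Otimes>\<^sub>M PiM {i, k} (\<lambda>_. M))" by measurable
  have b1: "\<bar>?g1 z\<bar> \<le> 1" for z by (simp add: split_beta abs_mult abs_cmp mult_le_one)
  let ?g2 = "\<lambda>(u, w). mid_cdf D P (w i) * cmp (D (u k) P) (D (w i) P)"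
  have g2: "?g2 \<in> borel_measurable (PiM {k} (\<lambda>_. M) \<Otimes>\<^sub>M PiM {i} (\<lambda>_. M))" by measurable
  have b2: "\<bar>?g2 z\<bar> \<le> 1" for z by (simp add: split_beta abs_mult abs_cmp abs_mid mult_le_one)
  have "(\<integral>\<omega>. cmp (D (X j \<omega>) P) (D (X i \<omega>) P) * cmp (D (X k \<omega>) P) (D (X i \<omega>) P) \<partial>S)
    = (\<integral>\<omega>. mid_cdf D P (X i \<omega>) * cmp (D (X k \<omega>) P) (D (X i \<omega>) P) \<partial>S)"
    using indep_var_decouple[OF ind1 g1 b1] by (simp add: G)
  also have "\<dots> = (\<integral>\<omega>. mid_cdf D P (X i \<omega>) * mid_cdf D P (X i \<omega>) \<partial>S)"
    using indep_var_decouple[OF ind2 g2 b2] by (simp add: G)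
  also have "\<dots> = (\<integral>x. (mid_cdf D P x)\<^sup>2 \<partial>P)"
    unfolding power2_eq_square by (rule expectation_V) measurable
  finally show ?thesis .
qed

text \<open>Among three points without ties exactly one has the largest depth.\<close>

lemma integral_mid_cdf_square:
  assumes a1: "asm1 S D P X \<beta>" and D0: "depth_function M D" and \<beta>: "0 < \<beta>"
  shows "(\<integral>x. (mid_cdf D P x)\<^sup>2 \<partial>P) = 1 / 3"
proof -
  obtain C where C: "\<And>e. 0 \<le> e \<Longrightarrow> \<P>(\<omega> in S. \<bar>D (X 0 \<omega>) P - D (X 1 \<omega>) P\<bar> \<le> e) \<le> C * (2 * e) powr \<beta>"
    using asm1_pair[OF a1 D0 \<beta>] by blast
  have Q: "Measurable.pred (PiM (UNIV :: nat set) (\<lambda>_. M)) (\<lambda>s. D (s 0) P \<noteq> D (s 1) P)"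
  proof -
    have "Measurable.pred (PiM (UNIV :: nat set) (\<lambda>_. M)) (\<lambda>s. 0 < \<bar>D (s 0) P - D (s 1) P\<bar>)"
      by measurable
    then show ?thesis by simp
  qed
  \<comment> \<open>The pair bound at radius 0 excludes ties, because
    \<open>0 powr \<beta> = 0\<close>.\<close>
  have "\<P>(\<omega> in S. D (X 0 \<omega>) P = D (X 1 \<omega>) P) = 0"
    using C[of 0] measure_nonneg[of S] by (simp add: order_antisym)
  then have "AE \<omega> in S. D (X 0 \<omega>) P \<noteq> D (X 1 \<omega>) P"
    by (subst (asm) prob_eq_0) auto
  then have AE_L: "AE s in PiM (UNIV :: nat set) (\<lambda>_. P). D (s 0) P \<noteq> D (s 1) P"
    using AE_process[OF Q] by simp
  have ne: "AE \<omega> in S. D (X (f 0) \<omega>) P \<noteq> D (X (f 1) \<omega>) P" if "inj f" for f :: "nat \<Rightarrow> nat"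
  proof -
    interpret R: iid_family S M P "\<lambda>l. X (f l)" by (rule reindex) fact
    show ?thesis using R.AE_process[OF Q] AE_L by simp
  qed
  \<comment> \<open>The injections \<open>l\<close>, \<open>2 * l\<close> and \<open>l + 1\<close>
    send 0, 1 to the three pairs from 0, 1, 2.\<close>
  have ne3: "AE \<omega> in S. D (X 0 \<omega>) P \<noteq> D (X 1 \<omega>) P" "AE \<omega> in S. D (X 0 \<omega>) P \<noteq> D (X 2 \<omega>) P"
    "AE \<omega> in S. D (X 1 \<omega>) P \<noteq> D (X 2 \<omega>) P"
    using ne[of "\<lambda>l. l"] ne[of "\<lambda>l. 2 * l"] ne[of "\<lambda>l. l + 1"] by (auto simp: inj_def numeral_2_eq_2)
  have cmp3: "cmp y x * cmp z x + cmp x y * cmp z y + cmp x z * cmp y z = 1" if "x \<noteq> y" "x \<noteq> z" "y \<noteq> z" for x y z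
    using that by (auto simp: cmp_def)
  let ?c = "\<lambda>j k i \<omega>. cmp (D (X j \<omega>) P) (D (X i \<omega>) P) * cmp (D (X k \<omega>) P) (D (X i \<omega>) P)"
  have i: "integrable S (?c j k i)" for i j k
    by (rule integrable_const_bound[where B=1]) (auto simp: abs_mult abs_cmp mult_le_one)
  have "(\<integral>\<omega>. ?c 1 2 0 \<omega> + ?c 0 2 1 \<omega> + ?c 0 1 2 \<omega> \<partial>S) = (\<integral>\<omega>. 1 \<partial>S)"
  proof (rule integral_cong_AE)
    show "AE \<omega> in S. ?c 1 2 0 \<omega> + ?c 0 2 1 \<omega> + ?c 0 1 2 \<omega> = 1"
      using ne3 by eventually_elim (rule cmp3)
  qed auto
  then have "(\<integral>\<omega>. ?c 1 2 0 \<omega> \<partial>S) + (\<integral>\<omega>. ?c 0 2 1 \<omega> \<partial>S) + (\<integral>\<omega>. ?c 0 1 2 \<omega> \<partial>S) = 1"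
    using i by (simp only: Bochner_Integration.integral_add Bochner_Integration.integrable_add) (simp add: prob_space)
  then show ?thesis
    using expectation_cmp_cmp[of 0 1 2] expectation_cmp_cmp[of 1 0 2] expectation_cmp_cmp[of 2 0 1] by simp
qed

end

section \<open>Limit theorems\<close>

lemma (in prob_space) char_lipschitz:
  fixes U :: "'a \<Rightarrow> real"
  assumes U: "integrable M U"
  shows "cmod (char (distr M borel U) s - char (distr M borel U) t) \<le> \<bar>s - t\<bar> * expectation (\<lambda>\<omega>. \<bar>U \<omega>\<bar>)"
proof -
  have [measurable]: "U \<in> borel_measurable M" using U by simp
  have i: "integrable M (\<lambda>\<omega>. iexp (r * U \<omega>))" for r
    by (rule integrable_iexp) auto
  have "char (distr M borel U) s - char (distr M borel U) t = (CLINT \<omega>|M. iexp (s * U \<omega>) - iexp (t * U \<omega>))"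
    unfolding char_def using i by (simp add: integral_distr)
  also have "cmod \<dots> \<le> (\<integral>\<omega>. \<bar>s - t\<bar> * \<bar>U \<omega>\<bar> \<partial>M)"
  proof (rule order_trans[OF integral_norm_bound], rule integral_mono)
    fix \<omega>
    have "iexp (s * U \<omega>) - iexp (t * U \<omega>) = iexp (t * U \<omega>) * (iexp ((s - t) * U \<omega>) - 1)"
    proof -
      have "iexp (s * U \<omega>) = iexp (t * U \<omega>) * iexp ((s - t) * U \<omega>)"
        unfolding exp_add[symmetric] by (simp add: algebra_simps)
      then show ?thesis by (simp add: algebra_simps)
    qed
    then have "cmod (iexp (s * U \<omega>) - iexp (t * U \<omega>)) = cmod (iexp ((s - t) * U \<omega>) - 1)"
      by (simp add: norm_mult del: of_real_mult)
    also have "\<dots> \<le> \<bar>(s - t) * U \<omega>\<bar>"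
      using iexp_approx1[of "(s - t) * U \<omega>" 0] by simp
    finally show "cmod (iexp (s * U \<omega>) - iexp (t * U \<omega>)) \<le> \<bar>s - t\<bar> * \<bar>U \<omega>\<bar>"
      by (simp add: abs_mult)
  qed (use i U in auto)
  finally show ?thesis by simp
qed

lemma (in prob_space) char_distr_scale:
  fixes U :: "'a \<Rightarrow> real"
  assumes [measurable]: "random_variable borel U"
  shows "char (distr M borel (\<lambda>\<omega>. c * U \<omega>)) t = char (distr M borel U) (c * t)"
  unfolding char_def by (simp add: integral_distr ac_simps)

text \<open>First moments bounded by 1 give all characteristic functions one Lipschitz constant, so
  convergence at fixed points extends to moving arguments. This absorbs the weights of the two
  samples, which vary with \<open>k\<close>.\<close>

lemma (in prob_space) char_tendsto_shift:
  fixes U :: "nat \<Rightarrow> 'a \<Rightarrow> real"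
  assumes U: "\<And>k. integrable M (U k)" "\<And>k. expectation (\<lambda>\<omega>. \<bar>U k \<omega>\<bar>) \<le> 1"
    and lim: "\<And>s. (\<lambda>k. char (distr M borel (U k)) s) \<longlonglongrightarrow> L s" and t: "t \<longlonglongrightarrow> s"
  shows "(\<lambda>k. char (distr M borel (U k)) (t k)) \<longlonglongrightarrow> L s"
proof -
  have "(\<lambda>k. char (distr M borel (U k)) (t k) - char (distr M borel (U k)) s) \<longlonglongrightarrow> 0"
  proof (rule Lim_null_comparison)
    show "\<forall>\<^sub>F k in sequentially. cmod (char (distr M borel (U k)) (t k) - char (distr M borel (U k)) s) \<le> \<bar>t k - s\<bar>"
    proof (rule always_eventually, rule allI)
      fix k
      have "\<bar>t k - s\<bar> * expectation (\<lambda>\<omega>. \<bar>U k \<omega>\<bar>) \<le> \<bar>t k - s\<bar> * 1"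
        by (intro mult_left_mono U) auto
      then show "cmod (char (distr M borel (U k)) (t k) - char (distr M borel (U k)) s) \<le> \<bar>t k - s\<bar>"
        using char_lipschitz[OF U(1), of k "t k" s] by simp
    qed
    show "(\<lambda>k. \<bar>t k - s\<bar>) \<longlonglongrightarrow> 0"
      using t by (simp add: LIM_zero tendsto_rabs_zero)
  qed
  from tendsto_add[OF this lim[of s]] show ?thesis by simp
qed

text \<open>Off the events that \<open>norm (W k)\<close> or \<open>norm (Z k - W k)\<close> is large, f is uniformly continuous.\<close>

lemma (in prob_space) slutsky:
  fixes Z W :: "nat \<Rightarrow> 'a \<Rightarrow> 'b :: euclidean_space" and f :: "'b \<Rightarrow> real"
  assumes f: "continuous_on UNIV f" "\<And>z. \<bar>f z\<bar> \<le> B"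
    and Z: "\<And>k. integrable M (Z k)" and W: "\<And>k. integrable M (W k)"
    and K: "\<forall>\<^sub>F k in sequentially. expectation (\<lambda>\<omega>. norm (W k \<omega>)) \<le> K"
    and lim: "(\<lambda>k. expectation (\<lambda>\<omega>. norm (Z k \<omega> - W k \<omega>))) \<longlonglongrightarrow> 0"
  shows "(\<lambda>k. expectation (\<lambda>\<omega>. f (Z k \<omega>)) - expectation (\<lambda>\<omega>. f (W k \<omega>))) \<longlonglongrightarrow> 0"
proof (rule LIMSEQ_I)
  fix r :: real assume r: "0 < r"
  have B: "0 \<le> B" using f(2)[of 0] by linarith
  have [measurable]: "f \<in> borel_measurable borel"
    using f(1) by (rule borel_measurable_continuous_onI)
  have [measurable]: "Z k \<in> borel_measurable M" "W k \<in> borel_measurable M" for k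
    using Z W by auto
  \<comment> \<open>Makes the term with \<open>norm w\<close> contribute at most
    \<open>r / 4\<close> in mean; \<open>B + 1\<close> keeps \<open>R\<close> positive when
    \<open>B = 0\<close>.\<close>
  define R where "R = 8 * (B + 1) * (\<bar>K\<bar> + 1) / r"
  have R: "0 < R" using B r by (simp add: R_def)
  have "uniformly_continuous_on (cball 0 (R + 1)) f"
    using f(1) by (intro compact_uniformly_continuous) (auto intro: continuous_on_subset)
  then obtain d0 where d0: "0 < d0" "\<And>x y. x \<in> cball 0 (R + 1) \<Longrightarrow> y \<in> cball 0 (R + 1) \<Longrightarrow> dist y x < d0 \<Longrightarrow> dist (f y) (f x) < r / 4"
    unfolding uniformly_continuous_on_def using r by (metis zero_less_divide_iff zero_less_numeral)
  define d where "d = min d0 1"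
  have d: "0 < d" "d \<le> d0" "d \<le> 1" using d0(1) by (auto simp: d_def)
  \<comment> \<open>On an exceptional event \<open>norm w / R\<close> or
    \<open>norm (z - w) / d\<close> is at least 1, so the trivial bound \<open>2 * B\<close> is
    charged to it. Taking means of this pointwise estimate does the work of Markov's
    inequality.\<close>
  have pt: "\<bar>f z - f w\<bar> \<le> r / 4 + 2 * B / R * norm w + 2 * B / d * norm (z - w)" for z w
  proof (cases "norm w \<le> R \<and> norm (z - w) < d")
    case True
    have "norm z \<le> norm w + norm (z - w)" by (metis add.commute norm_triangle_sub)
    then have "dist (f z) (f w) < r / 4"
      using True d R by (intro d0(2)) (auto simp: dist_norm)
    moreover have "0 \<le> 2 * B / R * norm w" "0 \<le> 2 * B / d * norm (z - w)"
      using B R d by auto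
    ultimately show ?thesis by (simp add: dist_real_def)
  next
    case False
    have le: "\<bar>f z - f w\<bar> \<le> 2 * B" using f(2)[of z] f(2)[of w] by linarith
    have n: "0 \<le> 2 * B / R * norm w" "0 \<le> 2 * B / d * norm (z - w)"
      using B R d by auto
    from False consider "R \<le> norm w" | "d \<le> norm (z - w)" by linarith
    then show ?thesis
    proof cases
      case 1
      then have "2 * B * 1 \<le> 2 * B * (norm w / R)" using B R by (intro mult_left_mono) auto
      then show ?thesis using le n r by simp
    next
      case 2
      then have "2 * B * 1 \<le> 2 * B * (norm (z - w) / d)" using B d by (intro mult_left_mono) auto
      then show ?thesis using le n r by simp
    qed
  qed
  have iW: "integrable M (\<lambda>\<omega>. norm (W k \<omega>))" "integrable M (\<lambda>\<omega>. norm (Z k \<omega> - W k \<omega>))" for k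
    using Z W by auto
  have i_f: "integrable M (\<lambda>\<omega>. f (Z k \<omega>))" "integrable M (\<lambda>\<omega>. f (W k \<omega>))" for k
    by (rule integrable_const_bound[where B=B]; use f in simp)+
  have ev: "\<forall>\<^sub>F k in sequentially. expectation (\<lambda>\<omega>. norm (Z k \<omega> - W k \<omega>)) < r * d / (8 * (B + 1))"
    using order_tendstoD(2)[OF lim, of "r * d / (8 * (B + 1))"] r d B by simp
  have "\<forall>\<^sub>F k in sequentially. norm (expectation (\<lambda>\<omega>. f (Z k \<omega>)) - expectation (\<lambda>\<omega>. f (W k \<omega>)) - 0) < r"
    using K ev
  proof eventually_elim
    case (elim k)
    have "\<bar>expectation (\<lambda>\<omega>. f (Z k \<omega>)) - expectation (\<lambda>\<omega>. f (W k \<omega>))\<bar> = \<bar>expectation (\<lambda>\<omega>. f (Z k \<omega>) - f (W k \<omega>))\<bar>"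
      using i_f by simp
    also have "\<dots> \<le> expectation (\<lambda>\<omega>. \<bar>f (Z k \<omega>) - f (W k \<omega>)\<bar>)" by (rule integral_abs_bound)
    also have "\<dots> \<le> expectation (\<lambda>\<omega>. r / 4 + 2 * B / R * norm (W k \<omega>) + 2 * B / d * norm (Z k \<omega> - W k \<omega>))"
      using i_f iW by (intro integral_mono pt) auto
    also have "\<dots> = r / 4 + 2 * B / R * expectation (\<lambda>\<omega>. norm (W k \<omega>)) + 2 * B / d * expectation (\<lambda>\<omega>. norm (Z k \<omega> - W k \<omega>))"
      using iW by (simp add: prob_space)
    also have "\<dots> \<le> r / 4 + 2 * B / R * (\<bar>K\<bar> + 1) + 2 * B / d * (r * d / (8 * (B + 1)))"
      using elim B R d by (intro add_mono mult_left_mono) auto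
    also have "2 * B / R * (\<bar>K\<bar> + 1) = r / 4 * (B / (B + 1))"
    proof -
      define q where "q = \<bar>K\<bar> + 1"
      define b where "b = B + 1"
      have "q \<noteq> 0" "b \<noteq> 0" using B by (auto simp: q_def b_def)
      then show ?thesis
        using r unfolding R_def q_def[symmetric] b_def[symmetric] by (simp add: field_simps)
    qed
    also have "2 * B / d * (r * d / (8 * (B + 1))) = r / 4 * (B / (B + 1))"
    proof -
      define b where "b = B + 1"
      have "b \<noteq> 0" using B by (simp add: b_def)
      then show ?thesis using d unfolding b_def[symmetric] by (simp add: field_simps)
    qed
    also have "r / 4 + r / 4 * (B / (B + 1)) + r / 4 * (B / (B + 1)) < r"
    proof -
      have "B / (B + 1) \<le> 1" using B by simp
      then have "r / 4 * (B / (B + 1)) \<le> r / 4 * 1" using r by (intro mult_left_mono) auto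
      then show ?thesis using r by linarith
    qed
    finally show ?case by simp
  qed
  then show "\<exists>N. \<forall>k\<ge>N. norm (expectation (\<lambda>\<omega>. f (Z k \<omega>)) - expectation (\<lambda>\<omega>. f (W k \<omega>)) - 0) < r"
    by (simp add: eventually_sequentially)
qed

section \<open>Central limit theorem for weighted sums over two independent samples\<close>

context iid_family
begin

context
  fixes h :: "'a \<Rightarrow> real" and B v :: real
  assumes h[measurable]: "h \<in> borel_measurable M" and hB: "\<And>x. \<bar>h x\<bar> \<le> B"
    and h0: "(\<integral>x. h x \<partial>P) = 0" and hv: "(\<integral>x. (h x)\<^sup>2 \<partial>P) = v" and v: "0 < v"
begin

lemma integrable_hV: "integrable S (\<lambda>\<omega>. h (V i \<omega>))"
  using hB by (intro integrable_const_bound[where B=B]) auto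

lemma integrable_hV_mult: "integrable S (\<lambda>\<omega>. h (V i \<omega>) * h (V j \<omega>))"
proof (rule integrable_const_bound[where B="B * B"])
  have "0 \<le> B" using hB[of undefined] by linarith
  then show "AE \<omega> in S. norm (h (V i \<omega>) * h (V j \<omega>)) \<le> B * B"
    using hB by (auto simp: abs_mult intro!: mult_mono)
qed measurable

lemma expectation_hV_mult: "(\<integral>\<omega>. h (V i \<omega>) * h (V j \<omega>) \<partial>S) = (if i = j then v else 0)"
proof (cases "i = j")
  case True
  then show ?thesis using expectation_V[of "\<lambda>x. h x * h x" j] hv by (simp add: power2_eq_square)
next
  case False
  let ?g = "\<lambda>(u, w). h (u i) * h (w j)"
  have ind: "indep_var (PiM {i} (\<lambda>_. M)) (\<lambda>\<omega>. \<lambda>i\<in>{i}. V i \<omega>) (PiM {j} (\<lambda>_. M)) (\<lambda>\<omega>. \<lambda>i\<in>{j}. V i \<omega>)"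
    using False by (intro indep_blocks) auto
  have g: "?g \<in> borel_measurable (PiM {i} (\<lambda>_. M) \<Otimes>\<^sub>M PiM {j} (\<lambda>_. M))" by measurable
  have "0 \<le> B" using hB[of undefined] by linarith
  then have gb: "\<bar>?g z\<bar> \<le> B * B" for z
    using hB by (auto simp: split_beta abs_mult intro!: mult_mono)
  show ?thesis
    using indep_var_decouple[OF ind g gb] False expectation_V[OF h] h0 by simp
qed

text \<open>Indexed by a set, not by a length, so that independence of the sums over two samples is
  disjointness. Empty and infinite sets give 0.\<close>

definition "normalized_sum A \<omega> = (\<Sum>i\<in>A. h (V i \<omega>)) / sqrt (real (card A) * v)"

lemma normalized_sum_integrable: "integrable S (normalized_sum A)"
  unfolding normalized_sum_def by (intro integrable_divide Bochner_Integration.integrable_sum integrable_hV)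

text \<open>By orthogonality the second moment is exactly 1 for finite nonempty sets. The bound
  feeds both \<open>char_tendsto_shift\<close> and the moment condition of
  \<open>slutsky\<close>.\<close>

lemma normalized_sum_first_moment: "(\<integral>\<omega>. \<bar>normalized_sum A \<omega>\<bar> \<partial>S) \<le> 1"
proof (cases "finite A \<and> A \<noteq> {}")
  case True
  then have c: "0 < real (card A) * v" using v by (simp add: card_gt_0_iff)
  have sq: "(normalized_sum A \<omega>)\<^sup>2 = (\<Sum>i\<in>A. \<Sum>j\<in>A. h (V i \<omega>) * h (V j \<omega>)) / (real (card A) * v)" for \<omega>
    unfolding normalized_sum_def power_divide using c by (simp add: power2_eq_square sum_product del: real_sqrt_mult)
  have "(\<integral>\<omega>. (normalized_sum A \<omega>)\<^sup>2 \<partial>S) = (\<Sum>i\<in>A. \<Sum>j\<in>A. \<integral>\<omega>. h (V i \<omega>) * h (V j \<omega>) \<partial>S) / (real (card A) * v)"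
    unfolding sq by (simp add: integrable_hV_mult)
  also have "\<dots> = 1"
    using True c v by (simp add: expectation_hV_mult)
  finally have "(\<integral>\<omega>. (normalized_sum A \<omega>)\<^sup>2 \<partial>S) = 1" .
  moreover have "integrable S (\<lambda>\<omega>. (normalized_sum A \<omega>)\<^sup>2)"
    unfolding sq by (intro integrable_divide Bochner_Integration.integrable_sum integrable_hV_mult)
  ultimately show ?thesis using expectation_abs_le_sqrt[OF normalized_sum_integrable[of A]] by simp
next
  case False
  then have "normalized_sum A \<omega> = 0" for \<omega> by (auto simp: normalized_sum_def)
  then show ?thesis by simp
qed

lemma char_normalized_sum:
  assumes "inj f"
  shows "(\<lambda>n. char (distr S borel (normalized_sum (f ` {1..n :: nat}))) t) \<longlonglongrightarrow> exp (- (t\<^sup>2) / 2)"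
proof -
  have fi: "inj_on f A" for A using assms by (rule inj_on_subset) simp
  interpret R: iid_family S M P "\<lambda>l. V (f (Suc l))"
    using assms by (intro reindex) (auto simp: inj_def)
  define Y where "Y i \<omega> = h (V (f (Suc i)) \<omega>)" for i \<omega>
  have "weak_conv_m (\<lambda>n. distr S borel (\<lambda>\<omega>. (\<Sum>i<n. Y i \<omega>) / sqrt (real n * (sqrt v)\<^sup>2))) std_normal_distribution"
  proof (rule central_limit_theorem_zero_mean)
    show "indep_vars (\<lambda>i. borel) Y UNIV"
      unfolding Y_def[abs_def] by (rule indep_vars_compose2[OF R.indep]) simp
    show "expectation (Y n) = 0" for n
      unfolding Y_def[abs_def] using expectation_V[OF h] h0 by simp
    show "0 < sqrt v" using v by simp
    show "integrable S (\<lambda>x. (Y n x)\<^sup>2)" for n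
      using integrable_hV_mult by (simp add: Y_def power2_eq_square)
    show "variance (Y n) = (sqrt v)\<^sup>2" for n
      unfolding Y_def[abs_def] using v expectation_V[OF h] h0 expectation_hV_mult by (simp add: power2_eq_square)
    show "distr S borel (Y n) = distr P borel h" for n
      unfolding Y_def[abs_def] distr_V[symmetric, of "f (Suc n)"]
      by (subst distr_distr) (auto simp: comp_def)
  qed
  moreover have "(\<Sum>i\<in>f ` {1..n}. h (V i \<omega>)) = (\<Sum>i<n. Y i \<omega>)" for n \<omega>
    unfolding sum.reindex[OF fi[of "{1..n}"]] Y_def comp_def by (simp only: One_nat_def sum.atLeast1_atMost_eq)
  then have "(\<lambda>\<omega>. (\<Sum>i<n. Y i \<omega>) / sqrt (real n * (sqrt v)\<^sup>2)) = normalized_sum (f ` {1..n})" for n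
    unfolding normalized_sum_def card_image[OF fi[of "{1..n}"]] using v by simp
  ultimately have "weak_conv_m (\<lambda>n. distr S borel (normalized_sum (f ` {1..n}))) std_normal_distribution"
    by simp
  then have "(\<lambda>n. char (distr S borel (normalized_sum (f ` {1..n}))) t) \<longlonglongrightarrow> char std_normal_distribution t"
    using normalized_sum_integrable real_dist_normal_dist
    by (intro levy_continuity1 real_distribution_distr) (auto intro: borel_measurable_integrable)
  then show ?thesis by (simp add: char_std_normal_distribution)
qed

lemma indep_normalized_sum:
  assumes "A \<inter> C = {}"
  shows "indep_var borel (\<lambda>\<omega>. a * normalized_sum A \<omega>) borel (\<lambda>\<omega>. b * normalized_sum C \<omega>)"
proof -
  have "indep_var borel ((\<lambda>s. a * ((\<Sum>i\<in>A. h (s i)) / sqrt (real (card A) * v))) \<circ> (\<lambda>\<omega>. restrict (\<lambda>i. V i \<omega>) A))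
    borel ((\<lambda>s. b * ((\<Sum>i\<in>C. h (s i)) / sqrt (real (card C) * v))) \<circ> (\<lambda>\<omega>. restrict (\<lambda>i. V i \<omega>) C))"
    by (rule indep_var_compose[OF indep_blocks[OF assms]]) measurable
  then show ?thesis by (simp add: normalized_sum_def comp_def)
qed

text \<open>Independence factors the characteristic function; each factor is evaluated at an
  argument moving with its weight, and the limit variances add up to
  \<open>a\<^sup>2 + b\<^sup>2 = 1\<close>.\<close>

lemma two_sample_clt:
  fixes f g :: "nat \<Rightarrow> 'i" and m n :: "nat \<Rightarrow> nat" and \<alpha> \<beta> :: "nat \<Rightarrow> real"
  assumes fg: "inj f" "inj g" "range f \<inter> range g = {}"
    and mn: "filterlim m at_top sequentially" "filterlim n at_top sequentially"
    and lim: "\<alpha> \<longlonglongrightarrow> a" "\<beta> \<longlonglongrightarrow> b" and ab: "a\<^sup>2 + b\<^sup>2 = 1"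
  shows "weak_conv_m (\<lambda>k. distr S borel (\<lambda>\<omega>. \<alpha> k * normalized_sum (f ` {1..m k}) \<omega> + \<beta> k * normalized_sum (g ` {1..n k}) \<omega>)) std_normal_distribution"
proof (rule levy_continuity)
  have [measurable]: "normalized_sum A \<in> borel_measurable S" for A
    using normalized_sum_integrable by (rule borel_measurable_integrable)
  show "real_distribution (distr S borel (\<lambda>\<omega>. \<alpha> k * normalized_sum (f ` {1..m k}) \<omega> + \<beta> k * normalized_sum (g ` {1..n k}) \<omega>))" for k
    by (rule real_distribution_distr) measurable
  show "real_distribution std_normal_distribution" by (rule real_dist_normal_dist)
  fix t :: real
  have "char (distr S borel (\<lambda>\<omega>. \<alpha> k * normalized_sum (f ` {1..m k}) \<omega> + \<beta> k * normalized_sum (g ` {1..n k}) \<omega>)) t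
    = char (distr S borel (normalized_sum (f ` {1..m k}))) (\<alpha> k * t) * char (distr S borel (normalized_sum (g ` {1..n k}))) (\<beta> k * t)" for k
    by (subst char_distr_add[OF indep_normalized_sum]) (use fg(3) in \<open>auto simp: char_distr_scale\<close>)
  moreover have "(\<lambda>k. char (distr S borel (normalized_sum (f ` {1..m k}))) (\<alpha> k * t)) \<longlonglongrightarrow> complex_of_real (exp (- ((a * t)\<^sup>2) / 2))"
    using tendsto_mult_right[OF lim(1), of t]
    by (rule char_tendsto_shift[OF normalized_sum_integrable normalized_sum_first_moment filterlim_compose[OF char_normalized_sum[OF fg(1)] mn(1)]])
  moreover have "(\<lambda>k. char (distr S borel (normalized_sum (g ` {1..n k}))) (\<beta> k * t)) \<longlonglongrightarrow> complex_of_real (exp (- ((b * t)\<^sup>2) / 2))"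
    using tendsto_mult_right[OF lim(2), of t]
    by (rule char_tendsto_shift[OF normalized_sum_integrable normalized_sum_first_moment filterlim_compose[OF char_normalized_sum[OF fg(2)] mn(2)]])
  ultimately have "(\<lambda>k. char (distr S borel (\<lambda>\<omega>. \<alpha> k * normalized_sum (f ` {1..m k}) \<omega> + \<beta> k * normalized_sum (g ` {1..n k}) \<omega>)) t)
     \<longlonglongrightarrow> complex_of_real (exp (- ((a * t)\<^sup>2) / 2)) * complex_of_real (exp (- ((b * t)\<^sup>2) / 2))"
    by (simp only: tendsto_mult)
  moreover have "exp (- ((a * t)\<^sup>2) / 2) * exp (- ((b * t)\<^sup>2) / 2) = exp (- (t\<^sup>2) / 2)"
  proof -
    have "(a * t)\<^sup>2 + (b * t)\<^sup>2 = (a\<^sup>2 + b\<^sup>2) * t\<^sup>2" by (simp add: power_mult_distrib algebra_simps)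
    then have "- ((a * t)\<^sup>2) / 2 + - ((b * t)\<^sup>2) / 2 = - (t\<^sup>2) / 2" unfolding ab by simp
    then show ?thesis unfolding exp_add[symmetric] by simp
  qed
  ultimately show "(\<lambda>k. char (distr S borel (\<lambda>\<omega>. \<alpha> k * normalized_sum (f ` {1..m k}) \<omega> + \<beta> k * normalized_sum (g ` {1..n k}) \<omega>)) t)
     \<longlonglongrightarrow> char std_normal_distribution t"
    by (simp add: char_std_normal_distribution of_real_mult[symmetric] del: of_real_mult)
qed

end

end

section \<open>The joint limit\<close>

lemma vector_2_eq: "(vector [a, b] :: real ^ 2) = a *\<^sub>R axis 1 1 + b *\<^sub>R axis 2 1"
  by (simp add: vec_eq_iff forall_2 axis_def)

lemma norm_vector_2_le: "norm (vector [a, b] :: real ^ 2) \<le> \<bar>a\<bar> + \<bar>b\<bar>"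
  using norm_le_l1_cart[of "vector [a, b] :: real ^ 2"] by (simp add: sum_2)

lemma integrable_vector_2:
  assumes "integrable M a" "integrable M b"
  shows "integrable M (\<lambda>\<omega>. vector [a \<omega>, b \<omega>] :: real ^ 2)"
  unfolding vector_2_eq using assms by (intro Bochner_Integration.integrable_add integrable_scaleR_left)

lemma continuous_vector_2: "continuous_on UNIV (\<lambda>u. vector [u, - u] :: real ^ 2)"
  unfolding vector_2_eq by (intro continuous_intros)

lemma distr_std_normal_scale: "distr std_normal_distribution borel (\<lambda>u. c * u) = normal_law 0 (c\<^sup>2)"
proof (cases "c = 0")
  case True
  interpret prob_space std_normal_distribution by (rule prob_space_normal_density) simp
  show ?thesis using True by (simp add: normal_law_def)
next
  case False
  interpret prob_space std_normal_distribution by (rule prob_space_normal_density) simp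
  have "distributed std_normal_distribution lborel (\<lambda>u. u) std_normal_density"
    unfolding distributed_def by (simp add: distr_id2)
  from normal_density_affine[OF this, of c 0] False
  have "distr std_normal_distribution lborel (\<lambda>u. c * u) = density lborel (normal_density 0 \<bar>c\<bar>)"
    by (simp add: distributed_def)
  moreover have "distr std_normal_distribution lborel (\<lambda>u. c * u) = distr std_normal_distribution borel (\<lambda>u. c * u)"
    by (rule distr_cong) auto
  ultimately show ?thesis using False by (simp add: normal_law_def)
qed

text \<open>The covariance has rank one: a linear form \<open>t\<close> acts on the vector as
  multiplication by \<open>t $ 1 - t $ 2\<close>, whose square is the quadratic form of the matrix.
  It may vanish, giving the point mass of \<open>normal_law\<close>.\<close>

lemma antidiagonal_normal:
  defines "N \<equiv> distr std_normal_distribution borel (\<lambda>u. vector [u, - u] :: real ^ 2)"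
  shows "multivariate_normal N (vector [0, 0]) (vector [vector [1, -1], vector [-1, 1]])"
proof -
  interpret prob_space std_normal_distribution by (rule prob_space_normal_density) simp
  have [measurable]: "(\<lambda>u. vector [u, - u] :: real ^ 2) \<in> borel_measurable borel"
    by (rule borel_measurable_continuous_onI[OF continuous_vector_2])
  have "distr N borel (\<lambda>z. t \<bullet> z) = normal_law (t \<bullet> vector [0, 0]) (t \<bullet> (vector [vector [1, -1], vector [-1, 1]] *v t))"
    for t :: "real ^ 2"
  proof -
    have "distr N borel (\<lambda>z. t \<bullet> z) = distr std_normal_distribution borel (\<lambda>u. t \<bullet> vector [u, - u])"
      unfolding N_def by (subst distr_distr) (auto simp: comp_def)
    also have "(\<lambda>u. t \<bullet> vector [u, - u]) = (\<lambda>u. (t $ 1 - t $ 2) * u)"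
      by (auto simp: inner_vec_def sum_2 algebra_simps)
    also have "distr std_normal_distribution borel \<dots> = normal_law 0 ((t $ 1 - t $ 2)\<^sup>2)"
      by (rule distr_std_normal_scale)
    also have "(t $ 1 - t $ 2)\<^sup>2 = t \<bullet> (vector [vector [1, -1], vector [-1, 1]] *v t)"
      by (simp add: inner_vec_def sum_2 matrix_vector_mult_def power2_eq_square algebra_simps)
    also have "0 = t \<bullet> vector [0, 0]" by (simp add: inner_vec_def sum_2)
    finally show ?thesis .
  qed
  moreover have "prob_space N" unfolding N_def by (rule prob_space_distr) measurable
  ultimately show ?thesis unfolding multivariate_normal_def by (simp add: N_def)
qed

section \<open>Integrability of the statistic and its linear part\<close>

context two_sample
begin

lemma LS_integrable: "integrable S (\<lambda>\<omega>. LS M D m (\<lambda>i. XX i \<omega>) n (\<lambda>j. YY j \<omega>))"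
proof (cases "m = 0")
  case True
  then show ?thesis by (simp add: LS_def)
next
  case False
  have [measurable]: "(\<lambda>\<omega>. D (V a \<omega>) (emp M {} m (\<lambda>i. XX i \<omega>))) \<in> borel_measurable S" for a
    unfolding emp_empty using False by (intro depth_empirical_measurable) auto
  have "integrable S (\<lambda>\<omega>. cmp (D (XX i \<omega>) (emp M {} m (\<lambda>i. XX i \<omega>))) (D (YY j \<omega>) (emp M {} m (\<lambda>i. XX i \<omega>))))" for i j
    using abs_cmp by (intro integrable_const_bound[where B=1]) auto
  then show ?thesis
    unfolding LS_def cmp_def[symmetric] by (intro integrable_mult_right Bochner_Integration.integrable_sum)
qed

lemma linear_part_integrable: "integrable S (linear_part m n)"
proof -
  have "integrable S (\<lambda>\<omega>. mid_cdf D P (V a \<omega>))" for a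
    using mid_cdf_bounds by (intro integrable_const_bound[where B=1]) (auto simp: abs_le_iff intro: order_trans[of _ 0])
  then show ?thesis unfolding linear_part_def by auto
qed

end

theorem theorem2p3:
  fixes M P Q :: "'a measure"
    and D :: "'a \<Rightarrow> 'a measure \<Rightarrow> real"
    and S :: "'w measure"
    and X Y :: "nat \<Rightarrow> 'w \<Rightarrow> 'a"
    and \<beta> \<tau> :: real
    and m n :: "nat \<Rightarrow> nat"
  assumes "prob_space S"
    and "P \<in> space (prob_algebra M)" and "Q \<in> space (prob_algebra M)"
    and "depth_function M D" and "depth_measurable M D P"
    and "prob_space.indep_vars S (\<lambda>_. M) (case_sum X Y) UNIV"
    and "\<And>i. distr S M (X i) = P" and "\<And>j. distr S M (Y j) = Q"
    and "1 / 2 < \<beta>" and "\<beta> \<le> 1"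
    and "asm1 S D P X \<beta>" and "asm2 S M D P X \<beta>" and "asm3 S M D X" and "asm4 S M D X \<beta>"
    and "filterlim m at_top sequentially" and "filterlim n at_top sequentially"
    and "0 < \<tau>" and "\<tau> < 1"
    and "(\<lambda>k. real (m k) / (real (m k) + real (n k))) \<longlonglongrightarrow> \<tau>"
    and "P = Q"
  shows "\<exists>N :: (real ^ 2) measure.
    multivariate_normal N (vector [0, 0]) (vector [vector [1, -1], vector [-1, 1]]) \<and>
    converges_in_distribution S
      (\<lambda>k \<omega>. sqrt (12 * real (m k) * real (n k) / (real (m k) + real (n k))) *\<^sub>R
         (vector [LS M D (m k) (\<lambda>i. X i \<omega>) (n k) (\<lambda>j. Y j \<omega>),
                  LS M D (n k) (\<lambda>j. Y j \<omega>) (m k) (\<lambda>i. X i \<omega>)]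
          - vector [1 / 2, 1 / 2]))
      N"
proof -
  note D0 = assms(4) and a1 = assms(11) and a2 = assms(12) and m = assms(15) and n = assms(16) and \<tau> = assms(17-19)
  have \<beta>: "0 < \<beta>" using assms(9) by simp
  interpret F: iid_family S M P "case_sum X Y"
  proof -
    interpret prob_space S by fact
    show "iid_family S M P (case_sum X Y)"
      by unfold_locales (use assms in \<open>auto split: sum.split\<close>)
  qed
  interpret XI: iid_family S M P X
    using F.reindex[of Inl] by simp
  interpret XS: depth_sequence S M P X D
    by unfold_locales fact
  obtain c m0 where c: "0 < c" and m0: "2 \<le> m0" and stable: "\<And>m l. m0 \<le> m \<Longrightarrow> AE s in PiM UNIV (\<lambda>_. P).
      \<bar>D (s l) (emp M {} m s) - D (s l) (emp M {1} m s)\<bar> \<le> c / real m"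
    using XS.asm3_stable[OF assms(13)] by blast
  interpret T1: two_sample S M P "case_sum X Y" D c m0
    by unfold_locales (use assms(5) m0 stable in auto)
  \<comment> \<open>Swapping the summands of \<open>nat + nat\<close> is a renumbering, so the
    family with the samples interchanged is again independent with law P.\<close>
  have "inj (case_sum Inr Inl :: nat + nat \<Rightarrow> nat + nat)"
    by (rule injI) (auto split: sum.splits)
  from F.reindex[OF this] have "iid_family S M P (case_sum Y X)"
    by (rule back_subst[where P="iid_family S M P"]) (auto split: sum.splits)
  then interpret YX: iid_family S M P "case_sum Y X" .
  \<comment> \<open>Here \<open>Y\<close> is the first sample. The product-space quantities coincide
    with those of \<open>T1\<close>, so \<open>near\<close> and \<open>dev\<close> serve both
    orders.\<close>
  interpret T2: two_sample S M P "case_sum Y X" D c m0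
    by unfold_locales (use assms(5) m0 stable in auto)
  note near = XS.asm4_near[OF assms(14,9) c] and dev = XS.kern_deviation[OF a1 a2 D0 \<beta>]
  let ?r = "\<lambda>k. sqrt (real (m k) * real (n k) / (real (m k) + real (n k)))"
  let ?L1 = "\<lambda>k \<omega>. LS M D (m k) (\<lambda>i. X i \<omega>) (n k) (\<lambda>j. Y j \<omega>)"
  let ?L2 = "\<lambda>k \<omega>. LS M D (n k) (\<lambda>j. Y j \<omega>) (m k) (\<lambda>i. X i \<omega>)"
  let ?linear_part = "\<lambda>k. T1.linear_part (m k) (n k)"
  have E1: "(\<lambda>k. ?r k * (\<integral>\<omega>. \<bar>?L1 k \<omega> - 1 / 2 - ?linear_part k \<omega>\<bar> \<partial>S)) \<longlonglongrightarrow> 0"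
    using T1.LS_linearization[OF m n \<tau>(2,3)] near dev
    unfolding T1.near1_def T1.near2_def T1.kdev_def[abs_def] by simp
  have sum_pos: "\<forall>\<^sub>F k in sequentially. 1 \<le> m k" "\<forall>\<^sub>F k in sequentially. 1 \<le> n k"
    using m n unfolding filterlim_at_top by blast+
  have \<tau>': "(\<lambda>k. real (n k) / (real (n k) + real (m k))) \<longlonglongrightarrow> 1 - \<tau>"
  proof (rule Lim_transform_eventually[OF tendsto_diff[OF tendsto_const[of 1] \<tau>(3)]])
    show "\<forall>\<^sub>F k in sequentially. 1 - real (m k) / (real (m k) + real (n k)) = real (n k) / (real (n k) + real (m k))"
      using sum_pos by eventually_elim (simp add: field_simps)
  qed
  have lin2: "T2.linear_part (n k) (m k) \<omega> = - ?linear_part k \<omega>" for k \<omega>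
    unfolding T1.linear_part_def T2.linear_part_def by simp
  have E2: "(\<lambda>k. ?r k * (\<integral>\<omega>. \<bar>?L2 k \<omega> - 1 / 2 + ?linear_part k \<omega>\<bar> \<partial>S)) \<longlonglongrightarrow> 0"
    using T2.LS_linearization[OF n m _ \<tau>'] \<tau>(1) near dev
    unfolding T2.near1_def T2.near2_def T2.kdev_def[abs_def] lin2 by (simp add: ac_simps)
  define h where "h x = mid_cdf D P x - 1 / 2" for x
  have h[measurable]: "h \<in> borel_measurable M" unfolding h_def[abs_def] by measurable
  have hB: "\<bar>h x\<bar> \<le> 1" for x using T1.mid_cdf_bounds[of x] by (auto simp: h_def)
  have isq: "integrable P (\<lambda>x. (mid_cdf D P x)\<^sup>2)"
    using T1.mid_cdf_bounds by (intro F.P.integrable_const_bound[where B=1]) (auto simp: power_le_one)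
  have h0: "(\<integral>x. h x \<partial>P) = 0"
    unfolding h_def by (simp add: T1.integrable_mid_cdf T1.integral_mid_cdf)
  \<comment> \<open>\<open>1 / 3 - 1 / 2 + 1 / 4 = 1 / 12\<close>, the variance of the uniform law
    and the origin of the factor 12 in the scale.\<close>
  have hv: "(\<integral>x. (h x)\<^sup>2 \<partial>P) = 1 / 12"
  proof -
    have "(\<integral>x. (h x)\<^sup>2 \<partial>P) = (\<integral>x. (mid_cdf D P x)\<^sup>2 - mid_cdf D P x + 1 / 4 \<partial>P)"
      unfolding h_def by (rule Bochner_Integration.integral_cong) (auto simp: power2_eq_square algebra_simps)
    also have "\<dots> = 1 / 12"
      using isq by (simp add: T1.integrable_mid_cdf T1.integral_mid_cdf XS.integral_mid_cdf_square[OF a1 D0 \<beta>])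
    finally show ?thesis .
  qed
  \<comment> \<open>Multiplying a sum over the second sample by
    \<open>sqrt (12 * m * n / (m + n)) / n\<close> leaves the weight
    \<open>sqrt (m / (m + n))\<close> once the sum is normalized by \<open>sqrt (n / 12)\<close>;
    each weight thus carries the size of the other sample.\<close>
  let ?\<alpha> = "\<lambda>k. sqrt (real (m k) / (real (m k) + real (n k)))" and ?\<gamma> = "\<lambda>k. - sqrt (real (n k) / (real (n k) + real (m k)))"
  define U where "U k \<omega> = ?\<alpha> k * F.normalized_sum h (1 / 12) (Inr ` {1..n k}) \<omega> + ?\<gamma> k * F.normalized_sum h (1 / 12) (Inl ` {1..m k}) \<omega>" for k \<omega>
  have v: "(0 :: real) < 1 / 12" by simp
  note normalized_sum_int = F.normalized_sum_integrable[OF h hB h0 hv v] and normalized_sum_1 = F.normalized_sum_first_moment[OF h hB h0 hv v]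
  have clt: "weak_conv_m (\<lambda>k. distr S borel (U k)) std_normal_distribution"
    unfolding U_def[abs_def]
  proof (rule F.two_sample_clt[OF h hB h0 hv v _ _ _ n m])
    show "?\<alpha> \<longlonglongrightarrow> sqrt \<tau>" using \<tau>(3) by (rule tendsto_real_sqrt)
    show "?\<gamma> \<longlonglongrightarrow> - sqrt (1 - \<tau>)" using \<tau>' by (intro tendsto_minus tendsto_real_sqrt)
    show "(sqrt \<tau>)\<^sup>2 + (- sqrt (1 - \<tau>))\<^sup>2 = 1" using \<tau>(1,2) by simp
  qed auto
  have iU: "integrable S (U k)" for k
    unfolding U_def[abs_def] by (intro Bochner_Integration.integrable_add integrable_mult_right normalized_sum_int)
  have U1: "(\<integral>\<omega>. \<bar>U k \<omega>\<bar> \<partial>S) \<le> 2" for k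
  proof -
    have le1: "\<bar>?\<alpha> k\<bar> \<le> 1" "\<bar>?\<gamma> k\<bar> \<le> 1" by (auto simp: divide_le_eq_1)
    have "(\<integral>\<omega>. \<bar>U k \<omega>\<bar> \<partial>S) \<le> (\<integral>\<omega>. \<bar>F.normalized_sum h (1 / 12) (Inr ` {1..n k}) \<omega>\<bar> + \<bar>F.normalized_sum h (1 / 12) (Inl ` {1..m k}) \<omega>\<bar> \<partial>S)"
    proof (rule integral_mono)
      fix \<omega>
      have "\<bar>U k \<omega>\<bar> \<le> \<bar>?\<alpha> k\<bar> * \<bar>F.normalized_sum h (1 / 12) (Inr ` {1..n k}) \<omega>\<bar> + \<bar>?\<gamma> k\<bar> * \<bar>F.normalized_sum h (1 / 12) (Inl ` {1..m k}) \<omega>\<bar>"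
        unfolding U_def abs_mult[symmetric] by (rule abs_triangle_ineq)
      also have "\<dots> \<le> 1 * \<bar>F.normalized_sum h (1 / 12) (Inr ` {1..n k}) \<omega>\<bar> + 1 * \<bar>F.normalized_sum h (1 / 12) (Inl ` {1..m k}) \<omega>\<bar>"
        by (intro add_mono mult_right_mono le1) auto
      finally show "\<bar>U k \<omega>\<bar> \<le> \<bar>F.normalized_sum h (1 / 12) (Inr ` {1..n k}) \<omega>\<bar> + \<bar>F.normalized_sum h (1 / 12) (Inl ` {1..m k}) \<omega>\<bar>" by simp
    qed (use iU normalized_sum_int in auto)
    also have "\<dots> \<le> 1 + 1"
      using normalized_sum_int by (simp add: normalized_sum_1 add_mono[OF normalized_sum_1 normalized_sum_1, simplified])
    finally show ?thesis by simp
  qed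
  let ?s = "\<lambda>k. sqrt (12 * real (m k) * real (n k) / (real (m k) + real (n k)))"
  have s: "?s k = sqrt 12 * ?r k" for k
    by (simp add: real_sqrt_mult[symmetric] del: real_sqrt_mult)
  have sU: "\<forall>\<^sub>F k in sequentially. \<forall>\<omega>. ?s k * ?linear_part k \<omega> = U k \<omega>"
    using sum_pos
  proof eventually_elim
    case (elim k)
    define p q w where "p = sqrt (real (m k))" "q = sqrt (real (n k))" "w = sqrt (real (m k) + real (n k))"
    have pq: "0 < p" "0 < q" "0 < w" "real (m k) = p\<^sup>2" "real (n k) = q\<^sup>2"
      using elim by (auto simp: p_q_w_def)
    have inj: "inj_on Inl A" "inj_on Inr A" for A by (auto simp: inj_on_def)
    show ?case
    proof
      fix \<omega>
      define A B where "A = (\<Sum>j=1..n k. mid_cdf D P (Y j \<omega>))" and "B = (\<Sum>i=1..m k. mid_cdf D P (X i \<omega>))"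
      have sums: "(\<Sum>j=1..n k. h (Y j \<omega>)) = A - q\<^sup>2 / 2" "(\<Sum>i=1..m k. h (X i \<omega>)) = B - p\<^sup>2 / 2"
        by (simp_all add: h_def A_def B_def sum_subtractf pq(4,5)[symmetric])
      have "?s k * ?linear_part k \<omega> = sqrt 12 * p * q / w * (A / q\<^sup>2 - B / p\<^sup>2)"
        unfolding T1.linear_part_def A_def B_def pq(4,5)[symmetric] by (simp add: p_q_w_def real_sqrt_mult real_sqrt_divide)
      \<comment> \<open>The centring contributes \<open>sqrt 12 * p * q / (2 * w)\<close> to both
        summands and cancels.\<close>
      also have "\<dots> = p / w * ((A - q\<^sup>2 / 2) / (q / sqrt 12)) - q / w * ((B - p\<^sup>2 / 2) / (p / sqrt 12))"
        using pq(1-3) by (simp add: field_simps power2_eq_square)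
      also have "\<dots> = U k \<omega>"
        unfolding U_def F.normalized_sum_def[OF h hB h0 hv v] sums[symmetric]
        by (simp add: sum.reindex[OF inj(1)] sum.reindex[OF inj(2)] card_image[OF inj(1)] card_image[OF inj(2)]
          comp_def p_q_w_def real_sqrt_mult real_sqrt_divide add.commute)
      finally show "?s k * ?linear_part k \<omega> = U k \<omega>" .
    qed
  qed
  define Z where "Z k \<omega> = ?s k *\<^sub>R (vector [?L1 k \<omega>, ?L2 k \<omega>] - vector [1 / 2, 1 / 2] :: real ^ 2)" for k \<omega>
  \<comment> \<open>The approximant of \<open>Z\<close> is a continuous image of \<open>U\<close>,
    so its bivariate limit follows from the one-dimensional one.\<close>
  define W where "W k \<omega> = (vector [U k \<omega>, - U k \<omega>] :: real ^ 2)" for k \<omega>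
  define N where "N = distr std_normal_distribution borel (\<lambda>u. vector [u, - u] :: real ^ 2)"
  have iL: "integrable S (?L1 k)" "integrable S (?L2 k)" "integrable S (?linear_part k)" for k
    using T1.LS_integrable[of "m k" "n k"] T2.LS_integrable[of "n k" "m k"] T1.linear_part_integrable by auto
  have Z_eq: "Z k \<omega> = vector [?s k * (?L1 k \<omega> - 1 / 2), ?s k * (?L2 k \<omega> - 1 / 2)]" for k \<omega>
    by (simp add: Z_def vec_eq_iff forall_2)
  have iZ: "integrable S (Z k)" for k
    unfolding Z_eq using iL F.integrable_const by (intro integrable_vector_2 integrable_mult_right Bochner_Integration.integrable_diff) auto
  have iW: "integrable S (W k)" for k
    unfolding W_def by (intro integrable_vector_2 Bochner_Integration.integrable_minus iU)
  have EW: "(\<integral>\<omega>. norm (W k \<omega>) \<partial>S) \<le> 4" for k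
  proof -
    have "(\<integral>\<omega>. norm (W k \<omega>) \<partial>S) \<le> (\<integral>\<omega>. 2 * \<bar>U k \<omega>\<bar> \<partial>S)"
    proof (rule integral_mono)
      show "norm (W k \<omega>) \<le> 2 * \<bar>U k \<omega>\<bar>" for \<omega>
        using norm_vector_2_le[of "U k \<omega>" "- U k \<omega>"] by (simp add: W_def)
    qed (use iW iU in auto)
    then show ?thesis using U1[of k] by simp
  qed
  have lim: "(\<lambda>k. \<integral>\<omega>. norm (Z k \<omega> - W k \<omega>) \<partial>S) \<longlonglongrightarrow> 0"
  proof (rule tendsto_sandwich[where f="\<lambda>_. 0"])
    let ?e = "\<lambda>k. ?r k * (\<integral>\<omega>. \<bar>?L1 k \<omega> - 1 / 2 - ?linear_part k \<omega>\<bar> \<partial>S) + ?r k * (\<integral>\<omega>. \<bar>?L2 k \<omega> - 1 / 2 + ?linear_part k \<omega>\<bar> \<partial>S)"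
    show "\<forall>\<^sub>F k in sequentially. (\<integral>\<omega>. norm (Z k \<omega> - W k \<omega>) \<partial>S) \<le> sqrt 12 * ?e k"
      using sU
    proof eventually_elim
      case (elim k)
      have "norm (Z k \<omega> - W k \<omega>) \<le> ?s k * \<bar>?L1 k \<omega> - 1 / 2 - ?linear_part k \<omega>\<bar> + ?s k * \<bar>?L2 k \<omega> - 1 / 2 + ?linear_part k \<omega>\<bar>" for \<omega>
      proof -
        have "Z k \<omega> - W k \<omega> = vector [?s k * (?L1 k \<omega> - 1 / 2 - ?linear_part k \<omega>), ?s k * (?L2 k \<omega> - 1 / 2 + ?linear_part k \<omega>)]"
          using elim[rule_format, of \<omega>, symmetric] by (simp add: Z_eq W_def vec_eq_iff forall_2 algebra_simps)
        then show ?thesis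
          using norm_vector_2_le[of "?s k * (?L1 k \<omega> - 1 / 2 - ?linear_part k \<omega>)" "?s k * (?L2 k \<omega> - 1 / 2 + ?linear_part k \<omega>)"]
          by (simp add: abs_mult)
      qed
      then have "(\<integral>\<omega>. norm (Z k \<omega> - W k \<omega>) \<partial>S)
        \<le> (\<integral>\<omega>. ?s k * \<bar>?L1 k \<omega> - 1 / 2 - ?linear_part k \<omega>\<bar> + ?s k * \<bar>?L2 k \<omega> - 1 / 2 + ?linear_part k \<omega>\<bar> \<partial>S)"
        using iZ iW iL F.integrable_const by (intro integral_mono) auto
      also have "\<dots> = sqrt 12 * ?e k"
        unfolding s using iL F.integrable_const by (simp add: algebra_simps)
      finally show ?case .
    qed
    show "(\<lambda>k. sqrt 12 * ?e k) \<longlonglongrightarrow> 0"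
      using tendsto_mult_right_zero[OF tendsto_add_zero[OF E1 E2]] by simp
  qed auto
  have "converges_in_distribution S Z N"
    unfolding converges_in_distribution_def
  proof (intro conjI allI impI)
    show "Z k \<in> borel_measurable S" for k using iZ by (rule borel_measurable_integrable)
    fix f :: "real ^ 2 \<Rightarrow> real" assume f: "continuous_on UNIV f" "bounded (range f)"
    then obtain B where B: "\<And>z. \<bar>f z\<bar> \<le> B" unfolding bounded_iff by auto
    \<comment> \<open>Restricting a bivariate test function to the antidiagonal gives a bounded
      continuous function of \<open>U\<close>.\<close>
    have "continuous_on UNIV (\<lambda>u. f (vector [u, - u]))"
      using f(1) continuous_vector_2 by (rule continuous_on_compose2) auto
    then have "isCont (\<lambda>u. f (vector [u, - u])) u" for u
      by (simp add: continuous_on_eq_continuous_at)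
    then have "(\<lambda>k. \<integral>u. f (vector [u, - u]) \<partial>distr S borel (U k)) \<longlonglongrightarrow> (\<integral>u. f (vector [u, - u]) \<partial>std_normal_distribution)"
      using B F.real_distribution_distr[OF borel_measurable_integrable[OF iU]]
      by (intro weak_conv_imp_integral_bdd_continuous_conv[OF _ real_dist_normal_dist clt, where B=B]) auto
    moreover have [measurable]: "f \<in> borel_measurable borel" "(\<lambda>u. vector [u, - u] :: real ^ 2) \<in> borel_measurable borel"
      by (auto intro: borel_measurable_continuous_onI f continuous_vector_2)
    moreover have "(\<integral>u. f (vector [u, - u]) \<partial>distr S borel (U k)) = (\<integral>\<omega>. f (W k \<omega>) \<partial>S)" for k
      using borel_measurable_integrable[OF iU] by (subst integral_distr) (auto simp: W_def)
    moreover have "(\<integral>z. f z \<partial>N) = (\<integral>u. f (vector [u, - u]) \<partial>std_normal_distribution)"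
      unfolding N_def by (subst integral_distr) auto
    ultimately have "(\<lambda>k. \<integral>\<omega>. f (W k \<omega>) \<partial>S) \<longlonglongrightarrow> (\<integral>z. f z \<partial>N)" by simp
    from tendsto_add[OF F.slutsky[OF f(1) B iZ iW always_eventually[OF allI[OF EW]] lim] this]
    show "(\<lambda>k. \<integral>\<omega>. f (Z k \<omega>) \<partial>S) \<longlonglongrightarrow> (\<integral>z. f z \<partial>N)" by simp
  qed
  then show ?thesis
    unfolding Z_def[abs_def] N_def using antidiagonal_normal by blast
qed

end
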